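(* Let $K$ be a field and let $E$ be a graph satisfying condition (K). Then the values of the stable rank of $L(E)$ are: (1) $\mathrm{sr}(L(E))=1$ if $E$ is acyclic. (2) $\mathrm{sr}(L(E))=\infty$ if there exists a hereditary saturated subset $H$ of $E^0$ such that the quotient graph $E/H$ is nonempty, finite, cofinal and contains no sinks. (3) $\mathrm{sr}(L(E))=2$ otherwise.
   Context: A (directed) graph $E=(E^0,E^1,r,s)$ consists of countable sets $E^0$ (vertices) and $E^1$ (edges) and maps $r,s:E^1\to E^0$ (range and source). All graphs are assumed row-finite: $s^{-1}(v)$ is finite for every $v\in E^0$. A graph is finite if $E^0$ is finite. A sink is a vertex emitting no edges. A path is a sequence of edges $\mu=(\mu_1,\dots,\mu_n)$ with $r(\mu_i)=s(\mu_{i+1})$; $s(\mu)=s(\mu_1)$, $r(\mu)=r(\mu_n)$; vertices are paths of length $0$. Write $v\ge w$ if there is a path $\mu$ (possibly of length $0$) with $s(\mu)=v$, $r(\mu)=w$. A subset $H\subseteq E^0$ is hereditary if $v\in H$ and $v\ge w$ imply $w\in H$; it is saturated if $s^{-1}(v)\ne\emptyset$ and $r(s^{-1}(v))\subseteq H$ imply $v\in H$. A cycle is a path $\mu=(\mu_1,\dots,\mu_n)$, $n\geq 1$, with $s(\mu)=r(\mu)$ and $s(\mu_i)\ne s(\mu_j)$ for $i\ne j$; $E$ is acyclic if it has no cycles. A closed simple path based at $v$ is a path $\mu=(\mu_1,\dots,\mu_n)$, $n\ge1$, with $s(\mu)=r(\mu)=v$ and $s(\mu_i)\ne v$ for $i>1$.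 $E$ satisfies condition (K) if for each vertex $v$ on a closed simple path there are at least two distinct closed simple paths based at $v$. $E^{\le\infty}$ is the set of all infinite paths of $E$ together with all finite paths (including those of length $0$) whose end vertex is a sink. A vertex $v$ is cofinal if for every $\gamma\in E^{\le\infty}$ there is a vertex $w$ in $\gamma$ with $v\ge w$; $E$ is cofinal if all its vertices are. For $H\subseteq E^0$ hereditary, the quotient graph $E/H$ has vertex set $E^0\setminus H$ and edge set $\{e\in E^1: r(e)\notin H\}$, with restricted range and source maps. The Leavitt path algebra $L(E)=L_K(E)$ is the (not necessarily unital) $K$-algebra generated by a set $\{v: v\in E^0\}$ of pairwise orthogonal idempotents together with variables $\{e,e^*: e\in E^1\}$ subject to: $s(e)e=er(e)=e$; $r(e)e^*=e^*s(e)=e^*$; $e^*e'=\delta_{e,e'}r(e)$ for $e,e'\in E^1$; $v=\sum_{s(e)=v}ee^*$ for every $v\in E^0$ that emits edges. Stable rank: let $R$ be a ring and $S$ any unital ring containing $R$ as a two-sided ideal. A column vector $b=(b_i)_{i=1}^n$ over $S$ is $R$-unimodular if $b_1-1\in R$, $b_i\in R$ for $i>1$, and there exist $a_1,\dots,a_n$ with $a_1-1\in R$, $a_i\in R$ ($i>1$) and $\sum_{i=1}^n a_ib_i=1$. The stable rank $\mathrm{sr}(R)$ is the least natural number $m\ge 1$ such that for every $R$-unimodular vector $(b_i)_{i=1}^{m+1}$ there exist $v_1,\dots,v_m\in R$ such that $(b_i+v_ib_{m+1})_{i=1}^m$ is $R$-unimodular; $\mathrm{sr}(R)=\infty$ if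 no such $m$ exists. *)

theory Defs
  imports
    "HOL-Algebra.QuotRing"
    "HOL-Algebra.Module"
    "HOL-Library.Countable_Set"
    "HOL-Library.Extended_Nat"
    "Graph_Theory.Arc_Walk"
begin

section \<open>Graphs\<close>

text \<open>
  A graph \<open>(E\<^sup>0, E\<^sup>1, r, s)\<close> is a \<^typ>\<open>('v, 'e) pre_digraph\<close> \<open>E\<close> with \<open>E\<^sup>0 = verts E\<close>, \<open>E\<^sup>1 = arcs E\<close>, \<open>s = tail E\<close>
  and \<open>r = head E\<close>.  A path is an \<^const>\<open>pre_digraph.awalk\<close>, the relation \<open>v \<ge> w\<close> is
  \<open>v \<rightarrow>\<^sup>*\<^bsub>E\<^esub> w\<close>, and \<open>s\<^sup>-\<^sup>1(v)\<close> is \<^term>\<open>out_arcs E v\<close>.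
\<close>

locale row_finite_graph = wf_digraph E for E :: "('v, 'e) pre_digraph" (structure) +
  assumes countable_verts: "countable (verts E)"
    and countable_arcs: "countable (arcs E)"
    and row_finite: "v \<in> verts E \<Longrightarrow> finite (out_arcs E v)"

definition sink :: "('v, 'e) pre_digraph \<Rightarrow> 'v \<Rightarrow> bool" where
  "sink E v \<longleftrightarrow> v \<in> verts E \<and> out_arcs E v = {}"

definition hereditary :: "('v, 'e) pre_digraph \<Rightarrow> 'v set \<Rightarrow> bool" where
  "hereditary E H \<longleftrightarrow> H \<subseteq> verts E \<and> (\<forall>v w. v \<in> H \<and> v \<rightarrow>\<^sup>*\<^bsub>E\<^esub> w \<longrightarrow> w \<in> H)"

definition saturated :: "('v, 'e) pre_digraph \<Rightarrow> 'v set \<Rightarrow> bool" where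
  "saturated E H \<longleftrightarrow> H \<subseteq> verts E \<and>
     (\<forall>v \<in> verts E. out_arcs E v \<noteq> {} \<and> head E ` out_arcs E v \<subseteq> H \<longrightarrow> v \<in> H)"

definition acyclic_graph :: "('v, 'e) pre_digraph \<Rightarrow> bool" where
  "acyclic_graph E \<longleftrightarrow> \<not> (\<exists>p. pre_digraph.cycle E p)"

definition closed_simple_path :: "('v, 'e) pre_digraph \<Rightarrow> 'v \<Rightarrow> 'e list \<Rightarrow> bool" where
  "closed_simple_path E v p \<longleftrightarrow>
     p \<noteq> [] \<and> pre_digraph.awalk E v p v \<and> (\<forall>e \<in> set (tl p). tail E e \<noteq> v)"

definition condition_K :: "('v, 'e) pre_digraph \<Rightarrow> bool" where
  "condition_K E \<longleftrightarrow>
     (\<forall>v. (\<exists>w p. closed_simple_path E w p \<and> v \<in> set (pre_digraph.awalk_verts E w p)) \<longrightarrow>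
          (\<exists>p q. closed_simple_path E v p \<and> closed_simple_path E v q \<and> p \<noteq> q))"

definition infinite_path :: "('v, 'e) pre_digraph \<Rightarrow> (nat \<Rightarrow> 'e) \<Rightarrow> bool" where
  "infinite_path E \<gamma> \<longleftrightarrow> (\<forall>i. \<gamma> i \<in> arcs E \<and> head E (\<gamma> i) = tail E (\<gamma> (Suc i)))"

text \<open>
  Cofinality refers to the elements of \<open>E\<^sup>\<le>\<^sup>\<infinity>\<close> only through the vertices they visit; these are the
  vertex sets of the members of \<open>E\<^sup>\<le>\<^sup>\<infinity>\<close>.
\<close>

definition maximal_path_vertex_sets :: "('v, 'e) pre_digraph \<Rightarrow> 'v set set" where
  "maximal_path_vertex_sets E =
     {range (\<lambda>i. tail E (\<gamma> i)) | \<gamma>. infinite_path E \<gamma>} \<union>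
     {set (pre_digraph.awalk_verts E u p) | u p w. pre_digraph.awalk E u p w \<and> sink E w}"

definition cofinal_vertex :: "('v, 'e) pre_digraph \<Rightarrow> 'v \<Rightarrow> bool" where
  "cofinal_vertex E v \<longleftrightarrow> (\<forall>W \<in> maximal_path_vertex_sets E. \<exists>w \<in> W. v \<rightarrow>\<^sup>*\<^bsub>E\<^esub> w)"

definition cofinal_graph :: "('v, 'e) pre_digraph \<Rightarrow> bool" where
  "cofinal_graph E \<longleftrightarrow> (\<forall>v \<in> verts E. cofinal_vertex E v)"

definition quotient_graph :: "('v, 'e) pre_digraph \<Rightarrow> 'v set \<Rightarrow> ('v, 'e) pre_digraph" where
  "quotient_graph E H =
     \<lparr>verts = verts E - H, arcs = {e \<in> arcs E. head E e \<notin> H}, tail = tail E, head = head E\<rparr>"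


section \<open>Rings without unit and their stable rank\<close>

text \<open>
  A ring that need not have a unit is a ring record whose \<^const>\<open>one\<close> field is disregarded.
\<close>

locale nonunital_ring = abelian_group R for R (structure) +
  assumes mult_closed: "\<lbrakk>x \<in> carrier R; y \<in> carrier R\<rbrakk> \<Longrightarrow> x \<otimes> y \<in> carrier R"
    and mult_assoc: "\<lbrakk>x \<in> carrier R; y \<in> carrier R; z \<in> carrier R\<rbrakk> \<Longrightarrow>
      (x \<otimes> y) \<otimes> z = x \<otimes> (y \<otimes> z)"
    and distrib_right: "\<lbrakk>x \<in> carrier R; y \<in> carrier R; z \<in> carrier R\<rbrakk> \<Longrightarrow>
      (x \<oplus> y) \<otimes> z = x \<otimes> z \<oplus> y \<otimes> z"
    and distrib_left: "\<lbrakk>x \<in> carrier R; y \<in> carrier R; z \<in> carrier R\<rbrakk> \<Longrightarrow>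
      z \<otimes> (x \<oplus> y) = z \<otimes> x \<oplus> z \<otimes> y"

text \<open>
  In the following definitions \<open>I\<close> is a two-sided ideal of the unital ring \<open>S\<close>, and a vector
  \<open>(b\<^sub>1, \<dots>, b\<^sub>n)\<close> is a function on \<^typ>\<open>nat\<close> of which only the values on \<^term>\<open>{1..n}\<close> matter.
\<close>

definition unit_vector_mod :: "('s, 'm) ring_scheme \<Rightarrow> 's set \<Rightarrow> nat \<Rightarrow> (nat \<Rightarrow> 's) \<Rightarrow> bool" where
  "unit_vector_mod S I n b \<longleftrightarrow>
     b 1 \<in> carrier S \<and> b 1 \<ominus>\<^bsub>S\<^esub> \<one>\<^bsub>S\<^esub> \<in> I \<and> (\<forall>i \<in> {2..n}. b i \<in> I)"

definition unimodular :: "('s, 'm) ring_scheme \<Rightarrow> 's set \<Rightarrow> nat \<Rightarrow> (nat \<Rightarrow> 's) \<Rightarrow> bool" where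
  "unimodular S I n b \<longleftrightarrow>
     unit_vector_mod S I n b \<and>
     (\<exists>a. unit_vector_mod S I n a \<and> (\<Oplus>\<^bsub>S\<^esub>i \<in> {1..n}. a i \<otimes>\<^bsub>S\<^esub> b i) = \<one>\<^bsub>S\<^esub>)"

definition in_stable_range :: "('s, 'm) ring_scheme \<Rightarrow> 's set \<Rightarrow> nat \<Rightarrow> bool" where
  "in_stable_range S I m \<longleftrightarrow>
     m \<ge> 1 \<and>
     (\<forall>b. unimodular S I (m + 1) b \<longrightarrow>
        (\<exists>v. (\<forall>i \<in> {1..m}. v i \<in> I) \<and>
             unimodular S I m (\<lambda>i. b i \<oplus>\<^bsub>S\<^esub> v i \<otimes>\<^bsub>S\<^esub> b (m + 1))))"

definition stable_rank_in :: "('s, 'm) ring_scheme \<Rightarrow> 's set \<Rightarrow> enat" where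
  "stable_rank_in S I =
     (if \<exists>m. in_stable_range S I m then enat (LEAST m. in_stable_range S I m) else \<infinity>)"

text \<open>
  The stable rank of a ring without unit is computed in the unitization \<open>\<int> \<oplus> R\<close>.  By
  \<open>stable_rank_in_eq_stable_rank\<close> below, every unital ring that contains \<open>R\<close> as a two-sided ideal
  gives the same value.
\<close>

definition unitization :: "('a, 'm) ring_scheme \<Rightarrow> (int \<times> 'a) ring" where
  "unitization R =
     \<lparr>carrier = UNIV \<times> carrier R,
      mult = (\<lambda>(m, x) (n, y). (m * n, add_pow R m y \<oplus>\<^bsub>R\<^esub> add_pow R n x \<oplus>\<^bsub>R\<^esub> x \<otimes>\<^bsub>R\<^esub> y)),
      one = (1, \<zero>\<^bsub>R\<^esub>),
      zero = (0, \<zero>\<^bsub>R\<^esub>),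
      add = (\<lambda>(m, x) (n, y). (m + n, x \<oplus>\<^bsub>R\<^esub> y))\<rparr>"

definition stable_rank :: "('a, 'm) ring_scheme \<Rightarrow> enat" where
  "stable_rank R = stable_rank_in (unitization R) ((\<lambda>x. (0, x)) ` carrier R)"


subsection \<open>Independence of the ambient unital ring\<close>

context nonunital_ring
begin

lemma mult_zero_left: "x \<in> carrier R \<Longrightarrow> \<zero> \<otimes> x = \<zero>"
  by (metis add.r_cancel_one' distrib_right mult_closed r_zero zero_closed)

lemma mult_zero_right: "x \<in> carrier R \<Longrightarrow> x \<otimes> \<zero> = \<zero>"
  by (metis add.r_cancel_one' distrib_left mult_closed r_zero zero_closed)

lemma add_pow_mult_left:
  assumes "x \<in> carrier R" "y \<in> carrier R"
  shows "add_pow R (m::int) (x \<otimes> y) = add_pow R m x \<otimes> y"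
proof -
  have "(\<lambda>x. x \<otimes> y) \<in> hom (add_monoid R) (add_monoid R)"
    using assms by (auto simp: hom_def mult_closed distrib_right)
  from hom_int_pow[OF this, of x m] show ?thesis
    using assms a_comm_group by (simp add: add_pow_def comm_group_def)
qed

lemma add_pow_mult_right:
  assumes "x \<in> carrier R" "y \<in> carrier R"
  shows "add_pow R (m::int) (x \<otimes> y) = x \<otimes> add_pow R m y"
proof -
  have "(\<lambda>y. x \<otimes> y) \<in> hom (add_monoid R) (add_monoid R)"
    using assms by (auto simp: hom_def mult_closed distrib_left)
  from hom_int_pow[OF this, of y m] show ?thesis
    using assms a_comm_group by (simp add: add_pow_def comm_group_def)
qed

lemma ring_unitization: "ring (unitization R)"
proof (rule ringI)
  show "abelian_group (unitization R)"
  proof (rule abelian_groupI)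
    fix x assume "x \<in> carrier (unitization R)"
    then show "\<exists>y\<in>carrier (unitization R). y \<oplus>\<^bsub>unitization R\<^esub> x = \<zero>\<^bsub>unitization R\<^esub>"
      by (intro bexI[of _ "(- fst x, \<ominus> snd x)"]) (auto simp: unitization_def l_neg)
  qed (auto simp: unitization_def a_ac)
  show "Group.monoid (unitization R)"
    by (rule monoidI)
      (auto simp: unitization_def mult_closed mult_assoc mult_zero_left mult_zero_right
        distrib_left distrib_right add.int_pow_distrib add.int_pow_pow a_ac
        add_pow_mult_left[symmetric] add_pow_mult_right[symmetric] mult.commute mult.left_commute)
qed (auto simp: unitization_def mult_closed distrib_left distrib_right add.int_pow_distrib
        add.int_pow_mult a_ac distrib_right algebra_simps)


text \<open>
  An intrinsic form of the stable range condition: \<open>y\<close> stands for \<open>(1 + y\<^sub>1, y\<^sub>2, \<dots>, y\<^sub>n)\<close>.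
\<close>

definition umod :: "nat \<Rightarrow> (nat \<Rightarrow> 'a) \<Rightarrow> bool" where
  "umod n y \<longleftrightarrow> (\<forall>i \<in> {1..n}. y i \<in> carrier R) \<and>
     (\<exists>x. (\<forall>i \<in> {1..n}. x i \<in> carrier R) \<and>
          x 1 \<oplus> y 1 \<oplus> (\<Oplus>i \<in> {1..n}. x i \<otimes> y i) = \<zero>)"

definition srange :: "nat \<Rightarrow> bool" where
  "srange m \<longleftrightarrow> m \<ge> 1 \<and>
     (\<forall>y. umod (m + 1) y \<longrightarrow>
        (\<exists>v. (\<forall>i \<in> {1..m}. v i \<in> carrier R) \<and> umod m (\<lambda>i. y i \<oplus> v i \<otimes> y (m + 1))))"

end

locale nonunital_ring_ideal_embedding = R: nonunital_ring R + S: ring S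
  for R (structure) and S (structure) +
  fixes \<phi>
  assumes inj: "inj_on \<phi> (carrier R)"
    and hom_add: "\<lbrakk>x \<in> carrier R; y \<in> carrier R\<rbrakk> \<Longrightarrow> \<phi> (x \<oplus> y) = \<phi> x \<oplus>\<^bsub>S\<^esub> \<phi> y"
    and hom_mult: "\<lbrakk>x \<in> carrier R; y \<in> carrier R\<rbrakk> \<Longrightarrow> \<phi> (x \<otimes> y) = \<phi> x \<otimes>\<^bsub>S\<^esub> \<phi> y"
    and ideal_image: "ideal (\<phi> ` carrier R) S"
begin

definition lift :: "(nat \<Rightarrow> 'a) \<Rightarrow> nat \<Rightarrow> 'c" where
  "lift y i = (if i = 1 then \<one>\<^bsub>S\<^esub> \<oplus>\<^bsub>S\<^esub> \<phi> (y 1) else \<phi> (y i))"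

lemma phi_closed: "x \<in> carrier R \<Longrightarrow> \<phi> x \<in> carrier S"
  using ideal.Icarr[OF ideal_image] by blast

lemma phi_zero: "\<phi> \<zero> = \<zero>\<^bsub>S\<^esub>"
  by (metis R.zero_closed R.r_zero S.add.r_cancel_one' hom_add phi_closed)

lemma phi_finsum:
  assumes "finite A" "\<And>i. i \<in> A \<Longrightarrow> f i \<in> carrier R"
  shows "\<phi> (finsum R f A) = finsum S (\<lambda>i. \<phi> (f i)) A"
  using assms
  by (induction A) (auto simp: phi_zero hom_add phi_closed Pi_def)

lemma unit_vector_mod_iff:
  assumes "n \<ge> 1"
  shows "unit_vector_mod S (\<phi> ` carrier R) n b \<longleftrightarrow>
    (\<exists>y. (\<forall>i \<in> {1..n}. y i \<in> carrier R) \<and> (\<forall>i \<in> {1..n}. b i = lift y i))"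
proof
  assume b: "unit_vector_mod S (\<phi> ` carrier R) n b"
  have "\<forall>i \<in> {1..n}. \<exists>z. z \<in> carrier R \<and> \<phi> z = (if i = 1 then b 1 \<ominus>\<^bsub>S\<^esub> \<one>\<^bsub>S\<^esub> else b i)"
  proof
    fix i assume i: "i \<in> {1..n}"
    have "(if i = 1 then b 1 \<ominus>\<^bsub>S\<^esub> \<one>\<^bsub>S\<^esub> else b i) \<in> \<phi> ` carrier R"
      using b i by (cases "i = 1") (simp_all add: unit_vector_mod_def)
    then show "\<exists>z. z \<in> carrier R \<and> \<phi> z = (if i = 1 then b 1 \<ominus>\<^bsub>S\<^esub> \<one>\<^bsub>S\<^esub> else b i)"
      by (metis imageE)
  qed
  from bchoice[OF this] obtain y where y: "\<forall>i \<in> {1..n}. y i \<in> carrier R \<and>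
      \<phi> (y i) = (if i = 1 then b 1 \<ominus>\<^bsub>S\<^esub> \<one>\<^bsub>S\<^esub> else b i)"
    by blast
  have "\<one>\<^bsub>S\<^esub> \<oplus>\<^bsub>S\<^esub> (b 1 \<ominus>\<^bsub>S\<^esub> \<one>\<^bsub>S\<^esub>) = b 1"
  proof -
    have "b 1 \<in> carrier S"
      using b by (simp add: unit_vector_mod_def)
    then show ?thesis
      using S.a_lcomm[of "\<one>\<^bsub>S\<^esub>" "b 1" "\<ominus>\<^bsub>S\<^esub> \<one>\<^bsub>S\<^esub>"] by (simp add: a_minus_def S.r_neg)
  qed
  then have "\<forall>i \<in> {1..n}. b i = lift y i"
    using y assms by (simp add: lift_def)
  with y show "\<exists>y. (\<forall>i \<in> {1..n}. y i \<in> carrier R) \<and> (\<forall>i \<in> {1..n}. b i = lift y i)"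
    by blast
next
  assume "\<exists>y. (\<forall>i \<in> {1..n}. y i \<in> carrier R) \<and> (\<forall>i \<in> {1..n}. b i = lift y i)"
  then obtain y where y: "\<And>i. i \<in> {1..n} \<Longrightarrow> y i \<in> carrier R" "\<And>i. i \<in> {1..n} \<Longrightarrow> b i = lift y i"
    by blast
  have 1: "b 1 = \<one>\<^bsub>S\<^esub> \<oplus>\<^bsub>S\<^esub> \<phi> (y 1)" "y 1 \<in> carrier R"
    using y[of 1] assms by (auto simp: lift_def)
  have "b 1 \<ominus>\<^bsub>S\<^esub> \<one>\<^bsub>S\<^esub> = \<phi> (y 1)"
    unfolding 1 using phi_closed[OF 1(2)]
    by (simp add: a_minus_def S.a_assoc S.a_comm[of "\<phi> (y 1)"] S.a_lcomm[of "\<one>\<^bsub>S\<^esub>"] S.r_neg S.r_neg1)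
  then show "unit_vector_mod S (\<phi> ` carrier R) n b"
    using 1 y phi_closed by (auto simp: unit_vector_mod_def lift_def)
qed

lemma sum_lift:
  assumes "n \<ge> 1" "\<And>i. i \<in> {1..n} \<Longrightarrow> x i \<in> carrier R" "\<And>i. i \<in> {1..n} \<Longrightarrow> y i \<in> carrier R"
  shows "(\<Oplus>\<^bsub>S\<^esub>i \<in> {1..n}. lift x i \<otimes>\<^bsub>S\<^esub> lift y i) =
    \<one>\<^bsub>S\<^esub> \<oplus>\<^bsub>S\<^esub> \<phi> (x 1 \<oplus> y 1 \<oplus> (\<Oplus>i \<in> {1..n}. x i \<otimes> y i))"
proof -
  have eq: "{1..n} = insert 1 {2..n}" "1 \<notin> {2..n}"
    using assms(1) by auto
  have x: "x 1 \<in> carrier R" "x i \<in> carrier R" if "i \<in> {2..n}" for i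
    using assms(1,2) that by auto
  have y: "y 1 \<in> carrier R" "y i \<in> carrier R" if "i \<in> {2..n}" for i
    using assms(1,3) that by auto
  have xy1: "x 1 \<in> carrier R" "y 1 \<in> carrier R"
    using assms by auto
  have A: "(\<Oplus>\<^bsub>S\<^esub>i \<in> {2..n}. lift x i \<otimes>\<^bsub>S\<^esub> lift y i) = \<phi> (\<Oplus>i \<in> {2..n}. x i \<otimes> y i)"
    using x y phi_closed
    by (subst phi_finsum) (auto simp: lift_def hom_mult R.mult_closed intro!: S.finsum_cong')
  have B: "(\<Oplus>i \<in> {2..n}. x i \<otimes> y i) \<in> carrier R"
    using x y by (intro R.finsum_closed) (auto simp: R.mult_closed)
  have "(\<Oplus>\<^bsub>S\<^esub>i \<in> {1..n}. lift x i \<otimes>\<^bsub>S\<^esub> lift y i) =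
      lift x 1 \<otimes>\<^bsub>S\<^esub> lift y 1 \<oplus>\<^bsub>S\<^esub> \<phi> (\<Oplus>i \<in> {2..n}. x i \<otimes> y i)"
    unfolding eq A[symmetric] using x y xy1 eq(2) phi_closed
    by (subst S.finsum_insert) (auto simp: lift_def)
  also have "\<dots> = \<one>\<^bsub>S\<^esub> \<oplus>\<^bsub>S\<^esub> \<phi> (x 1 \<oplus> y 1 \<oplus> (x 1 \<otimes> y 1 \<oplus> (\<Oplus>i \<in> {2..n}. x i \<otimes> y i)))"
  proof -
    have *: "(\<one>\<^bsub>S\<^esub> \<oplus>\<^bsub>S\<^esub> X) \<otimes>\<^bsub>S\<^esub> (\<one>\<^bsub>S\<^esub> \<oplus>\<^bsub>S\<^esub> Y) \<oplus>\<^bsub>S\<^esub> Q =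
        \<one>\<^bsub>S\<^esub> \<oplus>\<^bsub>S\<^esub> (X \<oplus>\<^bsub>S\<^esub> Y \<oplus>\<^bsub>S\<^esub> (X \<otimes>\<^bsub>S\<^esub> Y \<oplus>\<^bsub>S\<^esub> Q))"
      if "X \<in> carrier S" "Y \<in> carrier S" "Q \<in> carrier S" for X Y Q
      using that by (simp add: S.l_distr S.r_distr S.a_assoc S.a_lcomm[of Y X])
    have "\<phi> (x 1 \<oplus> y 1 \<oplus> (x 1 \<otimes> y 1 \<oplus> (\<Oplus>i \<in> {2..n}. x i \<otimes> y i))) =
        \<phi> (x 1) \<oplus>\<^bsub>S\<^esub> \<phi> (y 1) \<oplus>\<^bsub>S\<^esub>
          (\<phi> (x 1) \<otimes>\<^bsub>S\<^esub> \<phi> (y 1) \<oplus>\<^bsub>S\<^esub> \<phi> (\<Oplus>i \<in> {2..n}. x i \<otimes> y i))"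
      using xy1 B by (simp add: hom_add hom_mult R.mult_closed)
    then show ?thesis
      using *[OF phi_closed[OF xy1(1)] phi_closed[OF xy1(2)] phi_closed[OF B]]
      by (simp only: lift_def if_True simp_thms)
  qed
  also have "x 1 \<otimes> y 1 \<oplus> (\<Oplus>i \<in> {2..n}. x i \<otimes> y i) = (\<Oplus>i \<in> {1..n}. x i \<otimes> y i)"
    unfolding eq using x y xy1 eq(2)
    by (subst R.finsum_insert) (auto simp: R.mult_closed)
  finally show ?thesis .
qed

lemma phi_eq_zero_iff: "x \<in> carrier R \<Longrightarrow> \<one>\<^bsub>S\<^esub> \<oplus>\<^bsub>S\<^esub> \<phi> x = \<one>\<^bsub>S\<^esub> \<longleftrightarrow> x = \<zero>"
  using S.add.l_cancel_one[of "\<one>\<^bsub>S\<^esub>" "\<phi> x"] inj_onD[OF inj, of x \<zero>] phi_closed[of x] phi_zero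
  by auto

lemma unimodular_iff:
  assumes n: "n \<ge> 1"
  shows "unimodular S (\<phi> ` carrier R) n b \<longleftrightarrow> (\<exists>y. R.umod n y \<and> (\<forall>i \<in> {1..n}. b i = lift y i))"
proof -
  have key: "(\<Oplus>\<^bsub>S\<^esub>i \<in> {1..n}. a i \<otimes>\<^bsub>S\<^esub> b i) = \<one>\<^bsub>S\<^esub> \<longleftrightarrow>
      x 1 \<oplus> y 1 \<oplus> (\<Oplus>i \<in> {1..n}. x i \<otimes> y i) = \<zero>"
    if x: "\<And>i. i \<in> {1..n} \<Longrightarrow> x i \<in> carrier R" and y: "\<And>i. i \<in> {1..n} \<Longrightarrow> y i \<in> carrier R"
      and a: "\<And>i. i \<in> {1..n} \<Longrightarrow> a i = lift x i" and b: "\<And>i. i \<in> {1..n} \<Longrightarrow> b i = lift y i"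
    for x y a b
  proof -
    have cl: "lift x i \<in> carrier S" "lift y i \<in> carrier S" if "i \<in> {1..n}" for i
      using that x[of i] y[of i] phi_closed by (auto simp: lift_def)
    have "(\<Oplus>\<^bsub>S\<^esub>i \<in> {1..n}. a i \<otimes>\<^bsub>S\<^esub> b i) = (\<Oplus>\<^bsub>S\<^esub>i \<in> {1..n}. lift x i \<otimes>\<^bsub>S\<^esub> lift y i)"
      by (rule S.finsum_cong') (auto simp: a b cl)
    also have "\<dots> = \<one>\<^bsub>S\<^esub> \<oplus>\<^bsub>S\<^esub> \<phi> (x 1 \<oplus> y 1 \<oplus> (\<Oplus>i \<in> {1..n}. x i \<otimes> y i))"
      by (rule sum_lift[OF n x y])
    also have "\<dots> = \<one>\<^bsub>S\<^esub> \<longleftrightarrow> x 1 \<oplus> y 1 \<oplus> (\<Oplus>i \<in> {1..n}. x i \<otimes> y i) = \<zero>"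
      using x y n by (intro phi_eq_zero_iff R.add.m_closed R.finsum_closed) (auto simp: R.mult_closed)
    finally show ?thesis .
  qed
  show ?thesis
  proof
    assume "unimodular S (\<phi> ` carrier R) n b"
    then obtain a y x where
      "\<forall>i \<in> {1..n}. y i \<in> carrier R" "\<forall>i \<in> {1..n}. b i = lift y i"
      "\<forall>i \<in> {1..n}. x i \<in> carrier R" "\<forall>i \<in> {1..n}. a i = lift x i"
      "(\<Oplus>\<^bsub>S\<^esub>i \<in> {1..n}. a i \<otimes>\<^bsub>S\<^esub> b i) = \<one>\<^bsub>S\<^esub>"
      unfolding unimodular_def unit_vector_mod_iff[OF n] by blast
    with key[of x y a b] show "\<exists>y. R.umod n y \<and> (\<forall>i \<in> {1..n}. b i = lift y i)"
      unfolding R.umod_def by blast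
  next
    assume "\<exists>y. R.umod n y \<and> (\<forall>i \<in> {1..n}. b i = lift y i)"
    then obtain y x where
      *: "\<forall>i \<in> {1..n}. y i \<in> carrier R" "\<forall>i \<in> {1..n}. b i = lift y i"
      "\<forall>i \<in> {1..n}. x i \<in> carrier R"
      "x 1 \<oplus> y 1 \<oplus> (\<Oplus>i \<in> {1..n}. x i \<otimes> y i) = \<zero>"
      unfolding R.umod_def by blast
    with key[of x y "lift x" b] have "(\<Oplus>\<^bsub>S\<^esub>i \<in> {1..n}. lift x i \<otimes>\<^bsub>S\<^esub> b i) = \<one>\<^bsub>S\<^esub>"
      by blast
    with * show "unimodular S (\<phi> ` carrier R) n b"
      unfolding unimodular_def unit_vector_mod_iff[OF n] by blast
  qed
qed

lemma lift_inj:
  assumes "\<forall>i \<in> {1..n}. y i \<in> carrier R" "\<forall>i \<in> {1..n}. z i \<in> carrier R"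
    and "\<forall>i \<in> {1..n}. lift y i = lift z i" and "i \<in> {1..n}"
  shows "y i = z i"
proof -
  have "y i \<in> carrier R" "z i \<in> carrier R" "lift y i = lift z i"
    using assms by auto
  then show ?thesis
    using inj phi_closed
    by (cases "i = 1") (auto simp: lift_def inj_on_def)
qed

lemma umod_cong: "(\<And>i. i \<in> {1..n} \<Longrightarrow> y i = z i) \<Longrightarrow> n \<ge> 1 \<Longrightarrow> R.umod n y \<longleftrightarrow> R.umod n z"
proof -
  have *: "R.umod n z" if "\<And>i. i \<in> {1..n} \<Longrightarrow> y i = z i" "n \<ge> 1" "R.umod n y" for y z
  proof -
    from that obtain x where x: "\<forall>i \<in> {1..n}. y i \<in> carrier R" "\<forall>i \<in> {1..n}. x i \<in> carrier R"
      "x 1 \<oplus> y 1 \<oplus> (\<Oplus>i \<in> {1..n}. x i \<otimes> y i) = \<zero>"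
      unfolding R.umod_def by blast
    have "(\<Oplus>i \<in> {1..n}. x i \<otimes> y i) = (\<Oplus>i \<in> {1..n}. x i \<otimes> z i)"
      using x that by (intro R.finsum_cong') (auto simp: R.mult_closed)
    moreover have "y 1 = z 1" using that by auto
    ultimately show ?thesis
      using x that unfolding R.umod_def by (intro conjI exI[of _ x]) auto
  qed
  assume "\<And>i. i \<in> {1..n} \<Longrightarrow> y i = z i" "n \<ge> 1"
  then show ?thesis using *[of y z] *[of z y] by auto
qed

lemma unimodular_lift_iff:
  assumes n: "n \<ge> 1" and y: "\<forall>i \<in> {1..n}. y i \<in> carrier R" and b: "\<forall>i \<in> {1..n}. b i = lift y i"
  shows "unimodular S (\<phi> ` carrier R) n b \<longleftrightarrow> R.umod n y"
proof
  assume "unimodular S (\<phi> ` carrier R) n b"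
  then obtain z where z: "R.umod n z" "\<forall>i \<in> {1..n}. b i = lift z i"
    unfolding unimodular_iff[OF n] by blast
  then have "y i = z i" if "i \<in> {1..n}" for i
    using y b that by (intro lift_inj[of n]) (auto simp: R.umod_def)
  with z n show "R.umod n y" using umod_cong[of n y z] by auto
qed (use b unimodular_iff[OF n] in blast)

lemma in_stable_range_iff: "in_stable_range S (\<phi> ` carrier R) m \<longleftrightarrow> R.srange m"
proof -
  have step: "unimodular S (\<phi> ` carrier R) m (\<lambda>i. b i \<oplus>\<^bsub>S\<^esub> v i \<otimes>\<^bsub>S\<^esub> b (m + 1)) \<longleftrightarrow>
      R.umod m (\<lambda>i. y i \<oplus> w i \<otimes> y (m + 1))"
    if m: "m \<ge> 1" and y: "R.umod (m + 1) y" and b: "\<forall>i \<in> {1..m + 1}. b i = lift y i"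
      and w: "\<forall>i \<in> {1..m}. w i \<in> carrier R" and v: "\<forall>i \<in> {1..m}. v i = \<phi> (w i)" for y b v w
  proof (rule unimodular_lift_iff[OF m])
    have yc: "y i \<in> carrier R" if "i \<in> {1..m + 1}" for i
      using y that by (auto simp: R.umod_def)
    show "\<forall>i\<in>{1..m}. y i \<oplus> w i \<otimes> y (m + 1) \<in> carrier R"
      using yc w by (auto simp: R.mult_closed)
    show "\<forall>i\<in>{1..m}. b i \<oplus>\<^bsub>S\<^esub> v i \<otimes>\<^bsub>S\<^esub> b (m + 1) = lift (\<lambda>i. y i \<oplus> w i \<otimes> y (m + 1)) i"
    proof
      fix i assume i: "i \<in> {1..m}"
      have c: "y i \<in> carrier R" "y (m + 1) \<in> carrier R" "w i \<in> carrier R"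
        using i w yc by auto
      have e: "b i = lift y i" "b (m + 1) = \<phi> (y (m + 1))" "v i = \<phi> (w i)"
        using i b v m by (auto simp: lift_def)
      show "b i \<oplus>\<^bsub>S\<^esub> v i \<otimes>\<^bsub>S\<^esub> b (m + 1) = lift (\<lambda>i. y i \<oplus> w i \<otimes> y (m + 1)) i"
        unfolding e using c
        by (cases "i = 1") (simp_all add: lift_def hom_add hom_mult R.mult_closed phi_closed S.a_assoc)
    qed
  qed
  show ?thesis
  proof
    assume L: "in_stable_range S (\<phi> ` carrier R) m"
    then have m: "m \<ge> 1" by (simp add: in_stable_range_def)
    show "R.srange m"
      unfolding R.srange_def
    proof (intro conjI allI impI)
      fix y assume y: "R.umod (m + 1) y"
      then have "unimodular S (\<phi> ` carrier R) (m + 1) (lift y)"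
        using unimodular_iff[of "m + 1"] by auto
      with L obtain v where v: "\<forall>i \<in> {1..m}. v i \<in> \<phi> ` carrier R"
        "unimodular S (\<phi> ` carrier R) m (\<lambda>i. lift y i \<oplus>\<^bsub>S\<^esub> v i \<otimes>\<^bsub>S\<^esub> lift y (m + 1))"
        unfolding in_stable_range_def by blast
      from v(1) have "\<forall>i \<in> {1..m}. \<exists>z. z \<in> carrier R \<and> v i = \<phi> z"
        by blast
      from bchoice[OF this] obtain w where w: "\<forall>i \<in> {1..m}. w i \<in> carrier R \<and> v i = \<phi> (w i)"
        by blast
      with step[OF m y, of "lift y" w v] v(2)
      show "\<exists>v. (\<forall>i \<in> {1..m}. v i \<in> carrier R) \<and> R.umod m (\<lambda>i. y i \<oplus> v i \<otimes> y (m + 1))"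
        by blast
    qed (rule m)
  next
    assume L: "R.srange m"
    then have m: "m \<ge> 1" by (simp add: R.srange_def)
    show "in_stable_range S (\<phi> ` carrier R) m"
      unfolding in_stable_range_def
    proof (intro conjI allI impI)
      fix b assume "unimodular S (\<phi> ` carrier R) (m + 1) b"
      then obtain y where y: "R.umod (m + 1) y" "\<forall>i \<in> {1..m + 1}. b i = lift y i"
        using unimodular_iff[of "m + 1"] by auto
      with L obtain w where w: "\<forall>i \<in> {1..m}. w i \<in> carrier R"
        "R.umod m (\<lambda>i. y i \<oplus> w i \<otimes> y (m + 1))"
        unfolding R.srange_def by blast
      with step[OF m y w(1), of "\<lambda>i. \<phi> (w i)"]
      show "\<exists>v. (\<forall>i \<in> {1..m}. v i \<in> \<phi> ` carrier R) \<and>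
          unimodular S (\<phi> ` carrier R) m (\<lambda>i. b i \<oplus>\<^bsub>S\<^esub> v i \<otimes>\<^bsub>S\<^esub> b (m + 1))"
        by (intro exI[of _ "\<lambda>i. \<phi> (w i)"]) auto
    qed (rule m)
  qed
qed

lemma stable_rank_in_image:
  "stable_rank_in S (\<phi> ` carrier R) = (if \<exists>m. R.srange m then enat (LEAST m. R.srange m) else \<infinity>)"
  by (simp only: stable_rank_in_def in_stable_range_iff)

end

lemma (in nonunital_ring) embedding_unitization:
  "nonunital_ring_ideal_embedding R (unitization R) (\<lambda>x. (0, x))"
proof -
  interpret U: ring "unitization R" by (rule ring_unitization)
  have neg: "\<ominus>\<^bsub>unitization R\<^esub> (0, x) = (0, \<ominus> x)" if "x \<in> carrier R" for x
    by (rule U.minus_equality) (use that in \<open>auto simp: unitization_def l_neg\<close>)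
  have "ideal ((\<lambda>x. (0, x)) ` carrier R) (unitization R)"
  proof (rule idealI)
    show "subgroup ((\<lambda>x. (0, x)) ` carrier R) (add_monoid (unitization R))"
      using neg
      by (intro U.add.subgroupI) (auto simp: unitization_def a_inv_def)
  qed (auto simp: ring_unitization, auto simp: unitization_def mult_closed)
  then show ?thesis
    by (intro nonunital_ring_ideal_embedding.intro nonunital_ring_ideal_embedding_axioms.intro
        nonunital_ring_axioms U.ring_axioms)
      (auto simp: unitization_def inj_on_def mult_closed add_pow_def)
qed

theorem stable_rank_in_eq_stable_rank:
  assumes "nonunital_ring_ideal_embedding R S \<phi>"
  shows "stable_rank_in S (\<phi> ` carrier R) = stable_rank R"
proof -
  interpret nonunital_ring_ideal_embedding R S \<phi> by fact
  interpret U: nonunital_ring_ideal_embedding R "unitization R" "\<lambda>x. (0, x)"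
    by (rule R.embedding_unitization)
  show ?thesis
    by (simp add: stable_rank_def stable_rank_in_image U.stable_rank_in_image)
qed


section \<open>Leavitt path algebras\<close>

subsection \<open>Free algebras and quotients\<close>

text \<open>
  The free non-unital \<open>K\<close>-algebra on \<open>X\<close>: finite \<open>K\<close>-linear combinations of nonempty words in \<open>X\<close>,
  represented by their coefficient functions, with the product extending concatenation of words.
  The \<^const>\<open>one\<close> field carries no meaning.
\<close>

definition free_algebra ::
  "'k::field itself \<Rightarrow> 'x set \<Rightarrow> ('k, 'x list \<Rightarrow> 'k) module" where
  "free_algebra _ X =
     \<lparr>carrier = {f. finite {w. f w \<noteq> 0} \<and> {w. f w \<noteq> 0} \<subseteq> lists X - {[]}},
      mult = (\<lambda>f g w. \<Sum>i\<le>length w. f (take i w) * g (drop i w)),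
      one = (\<lambda>w. 0),
      zero = (\<lambda>w. 0),
      add = (\<lambda>f g w. f w + g w),
      smult = (\<lambda>c f w. c * f w)\<rparr>"

definition free_gen :: "'x \<Rightarrow> 'x list \<Rightarrow> 'k::field" where
  "free_gen x = (\<lambda>w. if w = [x] then 1 else 0)"

definition algebra_ideal :: "('k, 'a, 'm) module_scheme \<Rightarrow> 'a set \<Rightarrow> bool" where
  "algebra_ideal A I \<longleftrightarrow>
     additive_subgroup I A \<and>
     (\<forall>x \<in> I. \<forall>a \<in> carrier A. a \<otimes>\<^bsub>A\<^esub> x \<in> I \<and> x \<otimes>\<^bsub>A\<^esub> a \<in> I) \<and>
     (\<forall>x \<in> I. \<forall>c. c \<odot>\<^bsub>A\<^esub> x \<in> I)"

definition gen_algebra_ideal :: "('k, 'a, 'm) module_scheme \<Rightarrow> 'a set \<Rightarrow> 'a set" where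
  "gen_algebra_ideal A T = \<Inter> {I. algebra_ideal A I \<and> T \<subseteq> I}"

definition quotient_algebra :: "('k, 'a, 'm) module_scheme \<Rightarrow> 'a set \<Rightarrow> ('k, 'a set) module" where
  "quotient_algebra A I =
     ring.extend (A Quot I)
       (module.fields (\<lambda>c C. \<Union>a \<in> C. I +>\<^bsub>A\<^esub> (c \<odot>\<^bsub>A\<^esub> a)))"

subsection \<open>The Leavitt path algebra of a graph\<close>

datatype ('v, 'e) lpa_gen = Vertex 'v | Edge 'e | Ghost 'e

definition lpa_gens :: "('v, 'e) pre_digraph \<Rightarrow> ('v, 'e) lpa_gen set" where
  "lpa_gens E = Vertex ` verts E \<union> Edge ` arcs E \<union> Ghost ` arcs E"

definition lpa_free ::
  "'k::field itself \<Rightarrow> ('v, 'e) pre_digraph \<Rightarrow> ('k, ('v, 'e) lpa_gen list \<Rightarrow> 'k) module" where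
  "lpa_free k E = free_algebra k (lpa_gens E)"

text \<open>The relations \<open>x = y\<close> are encoded as the differences \<open>x - y\<close>.\<close>

definition lpa_relations ::
  "'k::field itself \<Rightarrow> ('v, 'e) pre_digraph \<Rightarrow> (('v, 'e) lpa_gen list \<Rightarrow> 'k) set" where
  "lpa_relations k E =
    (let F = lpa_free k E;
         vx = (\<lambda>v. free_gen (Vertex v));
         ed = (\<lambda>e. free_gen (Edge e));
         gh = (\<lambda>e. free_gen (Ghost e))
     in
       {vx v \<otimes>\<^bsub>F\<^esub> vx w \<ominus>\<^bsub>F\<^esub> (if v = w then vx v else \<zero>\<^bsub>F\<^esub>) | v w. v \<in> verts E \<and> w \<in> verts E}
     \<union> {vx (tail E e) \<otimes>\<^bsub>F\<^esub> ed e \<ominus>\<^bsub>F\<^esub> ed e | e. e \<in> arcs E}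
     \<union> {ed e \<otimes>\<^bsub>F\<^esub> vx (head E e) \<ominus>\<^bsub>F\<^esub> ed e | e. e \<in> arcs E}
     \<union> {vx (head E e) \<otimes>\<^bsub>F\<^esub> gh e \<ominus>\<^bsub>F\<^esub> gh e | e. e \<in> arcs E}
     \<union> {gh e \<otimes>\<^bsub>F\<^esub> vx (tail E e) \<ominus>\<^bsub>F\<^esub> gh e | e. e \<in> arcs E}
     \<union> {gh e \<otimes>\<^bsub>F\<^esub> ed e' \<ominus>\<^bsub>F\<^esub> (if e = e' then vx (head E e) else \<zero>\<^bsub>F\<^esub>) | e e'.
          e \<in> arcs E \<and> e' \<in> arcs E}
     \<union> {vx v \<ominus>\<^bsub>F\<^esub> (\<Oplus>\<^bsub>F\<^esub>e \<in> out_arcs E v. ed e \<otimes>\<^bsub>F\<^esub> gh e) | v.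
          v \<in> verts E \<and> out_arcs E v \<noteq> {}})"

definition leavitt_path_algebra ::
  "'k::field itself \<Rightarrow> ('v, 'e) pre_digraph \<Rightarrow> ('k, (('v, 'e) lpa_gen list \<Rightarrow> 'k) set) module" where
  "leavitt_path_algebra k E =
     quotient_algebra (lpa_free k E) (gen_algebra_ideal (lpa_free k E) (lpa_relations k E))"


subsection \<open>The Leavitt path algebra is a ring\<close>

lemma free_algebra_mult_assoc:
  fixes f g h :: "'x list \<Rightarrow> 'k::field" and X :: "'x set"
  defines "m \<equiv> mult (free_algebra TYPE('k) X)"
  shows "m (m f g) h = m f (m g h)"
proof
  fix w :: "'x list"
  let ?n = "length w"
  define F where "F j k = f (take j w) * g (take k (drop j w)) * h (drop (j + k) w)" for j k
  have "m (m f g) h w = (\<Sum>i\<le>?n. \<Sum>j\<le>i. F j (i - j))"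
    unfolding m_def free_algebra_def
    by (simp, intro sum.cong refl) (auto simp: F_def sum_distrib_right drop_take min_def intro!: sum.cong)
  also have "\<dots> = (\<Sum>(j, k) \<in> {(j, k). j + k \<le> ?n}. F j k)"
    by (rule sum.triangle_reindex_eq[symmetric])
  also have "{(j, k). j + k \<le> ?n} = (SIGMA j:{..?n}. {..?n - j})"
    by auto
  also have "(\<Sum>(j, k) \<in> (SIGMA j:{..?n}. {..?n - j}). F j k) = (\<Sum>j\<le>?n. \<Sum>k\<le>?n - j. F j k)"
    by (rule sum.Sigma[symmetric]) auto
  also have "\<dots> = m f (m g h) w"
    unfolding m_def free_algebra_def
    by (simp, intro sum.cong refl)
      (auto simp: F_def sum_distrib_left mult.assoc add.commute intro!: sum.cong)
  finally show "m (m f g) h w = m f (m g h) w" .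
qed

lemma free_algebra_mult_closed:
  fixes f g :: "'x list \<Rightarrow> 'k::field"
  assumes "f \<in> carrier (free_algebra TYPE('k) X)" "g \<in> carrier (free_algebra TYPE('k) X)"
  shows "f \<otimes>\<^bsub>free_algebra TYPE('k) X\<^esub> g \<in> carrier (free_algebra TYPE('k) X)"
proof -
  let ?S = "\<lambda>f :: 'x list \<Rightarrow> 'k. {w. f w \<noteq> 0}"
  let ?p = "f \<otimes>\<^bsub>free_algebra TYPE('k) X\<^esub> g"
  have sub: "?S ?p \<subseteq> (\<lambda>(u, v). u @ v) ` (?S f \<times> ?S g)"
  proof
    fix w assume "w \<in> ?S ?p"
    then have "(\<Sum>i\<le>length w. f (take i w) * g (drop i w)) \<noteq> 0"
      by (simp add: free_algebra_def)
    then obtain i where "f (take i w) * g (drop i w) \<noteq> 0"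
      by (meson sum.neutral)
    then show "w \<in> (\<lambda>(u, v). u @ v) ` (?S f \<times> ?S g)"
      by (intro image_eqI[of _ _ "(take i w, drop i w)"]) auto
  qed
  have fg: "finite (?S f)" "finite (?S g)" "?S f \<subseteq> lists X - {[]}" "?S g \<subseteq> lists X - {[]}"
    using assms by (simp_all add: free_algebra_def)
  have "finite (?S ?p)"
    by (rule finite_subset[OF sub]) (intro finite_imageI finite_cartesian_product fg)
  moreover have "?S ?p \<subseteq> lists X - {[]}"
  proof (rule subset_trans[OF sub])
    show "(\<lambda>(u, v). u @ v) ` (?S f \<times> ?S g) \<subseteq> lists X - {[]}"
      using fg(3,4) by fastforce
  qed
  ultimately show ?thesis
    by (simp add: free_algebra_def)
qed

lemma abelian_group_free_algebra:
  fixes X :: "'x set"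
  shows "abelian_group (free_algebra TYPE('k::field) X)"
proof (rule abelian_groupI)
  fix f g :: "'x list \<Rightarrow> 'k"
  assume f: "f \<in> carrier (free_algebra TYPE('k) X)" and g: "g \<in> carrier (free_algebra TYPE('k) X)"
  have "{w. f w + g w \<noteq> 0} \<subseteq> {w. f w \<noteq> 0} \<union> {w. g w \<noteq> 0}"
    by auto
  with f g show "f \<oplus>\<^bsub>free_algebra TYPE('k) X\<^esub> g \<in> carrier (free_algebra TYPE('k) X)"
    unfolding free_algebra_def by (auto intro: finite_subset)
next
  fix f :: "'x list \<Rightarrow> 'k"
  assume f: "f \<in> carrier (free_algebra TYPE('k) X)"
  then show "\<exists>g\<in>carrier (free_algebra TYPE('k) X).
      g \<oplus>\<^bsub>free_algebra TYPE('k) X\<^esub> f = \<zero>\<^bsub>free_algebra TYPE('k) X\<^esub>"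
    by (intro bexI[of _ "\<lambda>w. - f w"]) (auto simp: free_algebra_def)
qed (auto simp: free_algebra_def add_ac)

lemma nonunital_ring_free_algebra: "nonunital_ring (free_algebra TYPE('k::field) X)"
  by (intro nonunital_ring.intro abelian_group_free_algebra nonunital_ring_axioms.intro
      free_algebra_mult_closed free_algebra_mult_assoc)
    (auto simp: free_algebra_def sum.distrib distrib_left distrib_right)

lemma free_gen_in_free_algebra: "x \<in> X \<Longrightarrow> free_gen x \<in> carrier (free_algebra TYPE('k::field) X)"
proof -
  assume "x \<in> X"
  moreover have "{w. (free_gen x :: _ \<Rightarrow> 'k) w \<noteq> 0} = {[x]}"
    by (auto simp: free_gen_def)
  ultimately show ?thesis
    by (simp add: free_algebra_def)
qed

lemma free_algebra_smult_closed:
  "f \<in> carrier (free_algebra TYPE('k::field) X) \<Longrightarrow>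
     c \<odot>\<^bsub>free_algebra TYPE('k) X\<^esub> f \<in> carrier (free_algebra TYPE('k) X)"
  by (cases "c = 0") (auto simp: free_algebra_def)

lemma algebra_ideal_gen_algebra_ideal:
  assumes "nonunital_ring A" and smult: "\<And>c x. x \<in> carrier A \<Longrightarrow> c \<odot>\<^bsub>A\<^esub> x \<in> carrier A"
    and T: "T \<subseteq> carrier A"
  shows "algebra_ideal A (gen_algebra_ideal A T)"
proof -
  interpret nonunital_ring A by fact
  have whole: "algebra_ideal A (carrier A)"
    unfolding algebra_ideal_def
    by (auto simp: mult_closed smult intro!: additive_subgroup.intro add.subgroupI
        simp flip: a_inv_def)
  have "additive_subgroup (gen_algebra_ideal A T) A"
    unfolding gen_algebra_ideal_def
  proof (intro additive_subgroup.intro add.subgroups_Inter)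
    show "{I. algebra_ideal A I \<and> T \<subseteq> I} \<noteq> {}"
      using whole T by blast
  qed (auto simp: algebra_ideal_def additive_subgroup_def)
  then show ?thesis
    unfolding algebra_ideal_def[of A "gen_algebra_ideal A T"]
    by (auto simp: gen_algebra_ideal_def) (auto simp: algebra_ideal_def)
qed

lemma nonunital_ring_quotient_algebra:
  assumes "nonunital_ring A" "algebra_ideal A I"
  shows "nonunital_ring (quotient_algebra A I)"
proof -
  interpret nonunital_ring A by fact
  interpret I: additive_subgroup I A
    using assms(2) by (simp add: algebra_ideal_def)
  interpret I: abelian_subgroup I A
    by (rule abelian_subgroupI3) (rule I.additive_subgroup_axioms abelian_group_axioms)+
  let ?Q = "quotient_algebra A I"
  have car: "carrier ?Q = (\<lambda>x. I +>\<^bsub>A\<^esub> x) ` carrier A"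
    by (auto simp: quotient_algebra_def ring.defs module.defs FactRing_def A_RCOSETS_def')
  have add: "(I +>\<^bsub>A\<^esub> x) \<oplus>\<^bsub>?Q\<^esub> (I +>\<^bsub>A\<^esub> y) = I +>\<^bsub>A\<^esub> (x \<oplus>\<^bsub>A\<^esub> y)"
    if "x \<in> carrier A" "y \<in> carrier A" for x y
    using that by (simp add: quotient_algebra_def ring.defs module.defs FactRing_def I.a_rcos_sum)
  have zero: "\<zero>\<^bsub>?Q\<^esub> = I +>\<^bsub>A\<^esub> \<zero>\<^bsub>A\<^esub>"
    by (simp add: quotient_algebra_def ring.defs module.defs FactRing_def I.a_subset)
  have mult: "(I +>\<^bsub>A\<^esub> x) \<otimes>\<^bsub>?Q\<^esub> (I +>\<^bsub>A\<^esub> y) = I +>\<^bsub>A\<^esub> (x \<otimes>\<^bsub>A\<^esub> y)"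
    if xy: "x \<in> carrier A" "y \<in> carrier A" for x y
  proof -
    have *: "I +>\<^bsub>A\<^esub> (x' \<otimes>\<^bsub>A\<^esub> y') = I +>\<^bsub>A\<^esub> (x \<otimes>\<^bsub>A\<^esub> y)"
      if x': "x' \<in> I +>\<^bsub>A\<^esub> x" and y': "y' \<in> I +>\<^bsub>A\<^esub> y" for x' y'
    proof -
      from x' y' obtain h k where h: "h \<in> I" "x' = h \<oplus>\<^bsub>A\<^esub> x" and k: "k \<in> I" "y' = k \<oplus>\<^bsub>A\<^esub> y"
        by (auto simp: a_r_coset_def r_coset_def)
      have c: "h \<in> carrier A" "k \<in> carrier A" "y' \<in> carrier A"
        using h k xy I.a_Hcarr by auto
      have "x' \<otimes>\<^bsub>A\<^esub> y' = (h \<otimes>\<^bsub>A\<^esub> y' \<oplus>\<^bsub>A\<^esub> x \<otimes>\<^bsub>A\<^esub> k) \<oplus>\<^bsub>A\<^esub> x \<otimes>\<^bsub>A\<^esub> y"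
        unfolding h(2) using c xy
        by (simp add: distrib_right mult_closed) (simp add: k(2) distrib_left mult_closed a_assoc)
      moreover have "h \<otimes>\<^bsub>A\<^esub> y' \<oplus>\<^bsub>A\<^esub> x \<otimes>\<^bsub>A\<^esub> k \<in> I"
        using assms(2) h(1) k(1) c xy unfolding algebra_ideal_def by (intro I.a_closed) auto
      ultimately have "x' \<otimes>\<^bsub>A\<^esub> y' \<in> I +>\<^bsub>A\<^esub> (x \<otimes>\<^bsub>A\<^esub> y)"
        by (auto simp: a_r_coset_def r_coset_def)
      then show ?thesis
        using xy by (intro a_repr_independence[symmetric]) (auto simp: mult_closed I.a_subgroup)
    qed
    have "(I +>\<^bsub>A\<^esub> x) \<otimes>\<^bsub>?Q\<^esub> (I +>\<^bsub>A\<^esub> y) =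
        (\<Union>a \<in> I +>\<^bsub>A\<^esub> x. \<Union>b \<in> I +>\<^bsub>A\<^esub> y. I +>\<^bsub>A\<^esub> (a \<otimes>\<^bsub>A\<^esub> b))"
      by (simp add: quotient_algebra_def ring.defs module.defs FactRing_def rcoset_mult_def)
    also have "\<dots> = (\<Union>a \<in> I +>\<^bsub>A\<^esub> x. \<Union>b \<in> I +>\<^bsub>A\<^esub> y. I +>\<^bsub>A\<^esub> (x \<otimes>\<^bsub>A\<^esub> y))"
      using * by (intro SUP_cong refl)
    also have "\<dots> = I +>\<^bsub>A\<^esub> (x \<otimes>\<^bsub>A\<^esub> y)"
      using I.a_rcos_self[OF xy(1)] I.a_rcos_self[OF xy(2)] by (simp add: UN_constant) blast
    finally show ?thesis .
  qed
  have "abelian_group ?Q"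
  proof (rule abelian_groupI)
    fix x assume "x \<in> carrier ?Q"
    then obtain a where a: "a \<in> carrier A" "x = I +>\<^bsub>A\<^esub> a" by (auto simp: car)
    then show "\<exists>y\<in>carrier ?Q. y \<oplus>\<^bsub>?Q\<^esub> x = \<zero>\<^bsub>?Q\<^esub>"
      by (intro bexI[of _ "I +>\<^bsub>A\<^esub> (\<ominus>\<^bsub>A\<^esub> a)"]) (auto simp: car add zero l_neg)
  qed (auto simp: car add zero a_ac)
  then show ?thesis
    by (intro nonunital_ring.intro nonunital_ring_axioms.intro)
      (auto simp: car add mult mult_closed mult_assoc distrib_left distrib_right)
qed

lemma (in row_finite_graph) lpa_relations_subset:
  "lpa_relations TYPE('k::field) E \<subseteq> carrier (lpa_free TYPE('k) E)"
proof -
  let ?F = "lpa_free TYPE('k) E"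
  interpret F: nonunital_ring ?F
    unfolding lpa_free_def by (rule nonunital_ring_free_algebra)
  have v: "free_gen (Vertex v) \<in> carrier ?F" if "v \<in> verts E" for v
    using that by (auto simp: lpa_free_def lpa_gens_def intro!: free_gen_in_free_algebra)
  have e: "free_gen (Edge e) \<in> carrier ?F" "free_gen (Ghost e) \<in> carrier ?F" if "e \<in> arcs E" for e
    using that by (auto simp: lpa_free_def lpa_gens_def intro!: free_gen_in_free_algebra)
  show ?thesis
    unfolding lpa_relations_def Let_def
    by (auto intro!: F.minus_closed F.finsum_closed F.mult_closed v e)
qed

theorem (in row_finite_graph) nonunital_ring_leavitt_path_algebra:
  "nonunital_ring (leavitt_path_algebra TYPE('k::field) E)"
  unfolding leavitt_path_algebra_def
  by (intro nonunital_ring_quotient_algebra algebra_ideal_gen_algebra_ideal lpa_relations_subset)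
    (auto simp: lpa_free_def nonunital_ring_free_algebra free_algebra_smult_closed)

end

theory Submission
  imports Defs "HOL-Library.Function_Algebras" "HOL-Library.Sublist"
begin

text \<open>
  Every element of \<open>L(E)\<close> is a linear combination of monomials \<open>\<alpha>\<beta>\<^sup>*\<close> with \<open>\<alpha>\<close>, \<open>\<beta>\<close> paths that have the
  same end.  Everything rests on how such monomials multiply: \<open>\<alpha>\<^sup>*\<beta> = 0\<close> unless one path is a prefix
  of the other.  Call \<open>w\<close> an ancestor of \<open>v\<close> if there is a path from \<open>w\<close> to \<open>v\<close>.

  \<^emph>\<open>Upper bounds.\<close>  Let \<open>Z\<close> be the set of vertices that can be reached from a closed path, and let \<open>I\<close>
  be the span of the monomials whose paths end in \<open>Z\<close>; it is an ideal.  Modulo \<open>I\<close> only paths outside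
  \<open>Z\<close> count, and finitely many elements involve only finitely many of them; prolonging all of these
  until they leave a fixed finite set of vertices turns the monomials into matrix units, so the given
  elements lie modulo \<open>I\<close> in a finite product of matrix algebras over \<open>K\<close>
  (\<open>stable_rank_one_modulo_span_monomials\<close>).  Matrices over a field have stable rank one, by the exchange
  property of bases (\<open>left_invertible_by_adding_rows\<close>).  If \<open>E\<close> is acyclic, then \<open>I = 0\<close> and the stable
  rank is \<open>1\<close>.

  Suppose next that every vertex of \<open>Z\<close> has infinitely many ancestors.  Finitely many elements of \<open>I\<close>
  are fixed from the left by an idempotent \<open>q = \<Sum>\<gamma>\<gamma>\<^sup>*\<close>, and for the paths \<open>\<gamma>\<close> there are paths \<open>\<sigma>\<^sub>\<gamma>\<close>
  with the same ends but with new and distinct sources; \<open>s = \<Sum>\<sigma>\<^sub>\<gamma>\<gamma>\<^sup>*\<close> moves \<open>q\<close> to an orthogonal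
  idempotent (\<open>absorbing_span_monomials\<close>).  Given a unimodular \<open>(b\<^sub>1, b\<^sub>2, b\<^sub>3)\<close>, stable rank one modulo \<open>I\<close>
  makes \<open>b\<^sub>1\<close> left invertible modulo \<open>I\<close>, after which \<open>b\<^sub>2\<close> and \<open>b\<^sub>3\<close> may be taken in \<open>I\<close>; then
  \<open>b\<^sub>2 + s b\<^sub>3\<close> still determines both \<open>b\<^sub>2\<close> and \<open>b\<^sub>3\<close>, so \<open>(b\<^sub>1, b\<^sub>2 + s b\<^sub>3)\<close> is unimodular and the stable
  rank is at most \<open>2\<close> (\<open>stable_range_two\<close>).

  If, on the contrary, some vertex on a closed path has only finitely many ancestors, take one with
  the fewest.  Its ancestors are the vertices of a quotient graph that is finite, cofinal and without
  sinks (\<open>finite_ancestors_imp_quotient\<close>).  So the trichotomy of the theorem is a statement about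
  ancestors.

  \<^emph>\<open>Lower bounds.\<close>  By condition (K) a vertex \<open>u\<close> on a closed path is the base of two closed paths of
  which neither is a prefix of the other.  They are elements \<open>c\<close>, \<open>d\<close> with \<open>c\<^sup>*c = d\<^sup>*d = u\<close> and
  \<open>c\<^sup>*d = 0\<close>.  Stable rank one would force \<open>cc\<^sup>* = u\<close>, which contradicts \<open>d \<noteq> 0\<close>.  If \<open>E/H\<close> is finite,
  cofinal and without sinks, then in \<open>L(E/H)\<close> every vertex, and therefore also the unit, is equivalent
  to an idempotent below \<open>u\<close>.  This gives infinitely many isometries with orthogonal ranges, and with
  them unimodular vectors of any length that cannot be shortened
  (\<open>isometries_imp_no_stable_range\<close>).  The stable range conditions pass from \<open>L(E)\<close> to its quotients.

  The computations take place in rings of linear operators.  The algebra \<open>L(E)\<close> embeds into such a ring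
  (\<open>faithful_hom\<close>), and \<open>L(E/H)\<close> maps to one in which no vertex outside \<open>H\<close> becomes zero
  (\<open>representation\<close>).
\<close>

section \<open>Stable range conditions in a subring\<close>

definition subrng :: "'r::ring_1 set \<Rightarrow> bool" where
  "subrng R \<longleftrightarrow> 0 \<in> R \<and> (\<forall>x\<in>R. \<forall>y\<in>R. x + y \<in> R \<and> x - y \<in> R \<and> x * y \<in> R)"

definition ideal_in :: "'r::ring_1 set \<Rightarrow> 'r set \<Rightarrow> bool" where
  "ideal_in R I \<longleftrightarrow> I \<subseteq> R \<and> 0 \<in> I \<and> (\<forall>x\<in>I. \<forall>y\<in>I. x + y \<in> I \<and> x - y \<in> I) \<and>
     (\<forall>x\<in>I. \<forall>r\<in>R. r * x \<in> I \<and> x * r \<in> I)"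

text \<open>
  As for \<open>umod\<close>, the family \<open>y\<close> stands for the column \<open>(1 + y\<^sub>1, y\<^sub>2, \<dots>, y\<^sub>n)\<close>.  The unit of the
  surrounding ring need not belong to \<open>R\<close>.
\<close>

definition column_unimodular :: "'r::ring_1 set \<Rightarrow> nat \<Rightarrow> (nat \<Rightarrow> 'r) \<Rightarrow> bool" where
  "column_unimodular R n y \<longleftrightarrow> (\<forall>i\<in>{1..n}. y i \<in> R) \<and>
     (\<exists>x. (\<forall>i\<in>{1..n}. x i \<in> R) \<and> x 1 + y 1 + (\<Sum>i=1..n. x i * y i) = 0)"

definition stable_range_in :: "'r::ring_1 set \<Rightarrow> nat \<Rightarrow> bool" where
  "stable_range_in R m \<longleftrightarrow> m \<ge> 1 \<and>
     (\<forall>y. column_unimodular R (m + 1) y \<longrightarrow>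
        (\<exists>v. (\<forall>i\<in>{1..m}. v i \<in> R) \<and> column_unimodular R m (\<lambda>i. y i + v i * y (m + 1))))"

text \<open>
  The condition of stable rank one for \<open>R / I\<close>, phrased with representatives.  The coefficient of the
  second entry of the unimodular column is taken to be \<open>1\<close>; a general column \<open>(b, c')\<close> with
  coefficients \<open>a\<close>, \<open>a'\<close> is the case \<open>c = a'c'\<close>.
\<close>

definition stable_rank_one_modulo :: "'r::ring_1 set \<Rightarrow> 'r set \<Rightarrow> bool" where
  "stable_rank_one_modulo R I \<longleftrightarrow> (\<forall>a b c. a - 1 \<in> R \<and> b - 1 \<in> R \<and> c \<in> R \<and> a * b + c - 1 \<in> I \<longrightarrow>
     (\<exists>w\<in>R. \<exists>d. d - 1 \<in> R \<and> d * (b + w * c) - 1 \<in> I))"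

text \<open>
  The element \<open>q\<close> is a left unit for \<open>f\<close>, and \<open>s\<close> moves \<open>g\<close> to a place where \<open>q\<close> vanishes, so that \<open>f + sg\<close>
  contains the full information about \<open>f\<close> and \<open>g\<close>: one has \<open>q(f + sg) = f\<close> and \<open>s'(f + sg) = g\<close>.
\<close>

definition absorbing :: "'r::ring_1 set \<Rightarrow> 'r set \<Rightarrow> bool" where
  "absorbing R I \<longleftrightarrow> (\<forall>f\<in>I. \<forall>g\<in>I. \<exists>q\<in>R. \<exists>s\<in>R. \<exists>s'\<in>R. q * f = f \<and> q * s = 0 \<and> s' * f = 0 \<and> s' * s * g = g)"

lemma subrngD:
  assumes "subrng R"
  shows "0 \<in> R" "x \<in> R \<Longrightarrow> y \<in> R \<Longrightarrow> x + y \<in> R" "x \<in> R \<Longrightarrow> y \<in> R \<Longrightarrow> x - y \<in> R"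
    "x \<in> R \<Longrightarrow> y \<in> R \<Longrightarrow> x * y \<in> R" "x \<in> R \<Longrightarrow> - x \<in> R"
  using assms unfolding subrng_def by (blast, blast, blast, blast, metis diff_0)

lemma subrng_sum: "subrng R \<Longrightarrow> (\<And>i. i \<in> A \<Longrightarrow> f i \<in> R) \<Longrightarrow> sum f A \<in> R"
  by (induction A rule: infinite_finite_induct) (auto simp: subrngD)

lemma ideal_inD:
  assumes "ideal_in R I"
  shows "x \<in> I \<Longrightarrow> x \<in> R" "0 \<in> I" "x \<in> I \<Longrightarrow> y \<in> I \<Longrightarrow> x + y \<in> I" "x \<in> I \<Longrightarrow> y \<in> I \<Longrightarrow> x - y \<in> I"
    "x \<in> I \<Longrightarrow> r \<in> R \<Longrightarrow> r * x \<in> I" "x \<in> I \<Longrightarrow> r \<in> R \<Longrightarrow> x * r \<in> I" "x \<in> I \<Longrightarrow> - x \<in> I"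
  using assms unfolding ideal_in_def by (blast, blast, blast, blast, blast, blast, metis diff_0)

lemma column_unimodular_1:
  "column_unimodular R 1 y \<longleftrightarrow> y 1 \<in> R \<and> (\<exists>x1\<in>R. x1 + y 1 + x1 * y 1 = 0)"
  unfolding column_unimodular_def by (auto intro: exI[of _ "\<lambda>_. _"])

lemma column_unimodular_2:
  "column_unimodular R 2 y \<longleftrightarrow> y 1 \<in> R \<and> y 2 \<in> R \<and>
    (\<exists>x1\<in>R. \<exists>x2\<in>R. x1 + y 1 + (x1 * y 1 + x2 * y 2) = 0)"
proof -
  have I: "{1..2} = {1, 2::nat}" by auto
  have "(\<exists>x. (x (1::nat) \<in> R \<and> x 2 \<in> R) \<and> x 1 + y 1 + (x 1 * y 1 + x 2 * y 2) = 0) \<longleftrightarrow>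
    (\<exists>x1\<in>R. \<exists>x2\<in>R. x1 + y 1 + (x1 * y 1 + x2 * y 2) = 0)" (is "?L \<longleftrightarrow> ?R")
  proof
    assume ?R
    then obtain x1 x2 where "x1 \<in> R" "x2 \<in> R" "x1 + y 1 + (x1 * y 1 + x2 * y 2) = 0" by blast
    then show ?L by (intro exI[of _ "\<lambda>i. if i = 1 then x1 else x2"]) auto
  qed blast
  then show ?thesis unfolding column_unimodular_def I by simp
qed

lemma column_unimodular_3:
  "column_unimodular R 3 y \<longleftrightarrow> y 1 \<in> R \<and> y 2 \<in> R \<and> y 3 \<in> R \<and>
    (\<exists>x1\<in>R. \<exists>x2\<in>R. \<exists>x3\<in>R. x1 + y 1 + (x1 * y 1 + x2 * y 2 + x3 * y 3) = 0)"
proof -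
  have I: "{1..3} = {1, 2, 3::nat}" by auto
  have "(\<exists>x. (x (1::nat) \<in> R \<and> x 2 \<in> R \<and> x 3 \<in> R) \<and> x 1 + y 1 + (x 1 * y 1 + x 2 * y 2 + x 3 * y 3) = 0) \<longleftrightarrow>
    (\<exists>x1\<in>R. \<exists>x2\<in>R. \<exists>x3\<in>R. x1 + y 1 + (x1 * y 1 + x2 * y 2 + x3 * y 3) = 0)" (is "?L \<longleftrightarrow> ?R")
  proof
    assume ?R
    then obtain x1 x2 x3 where "x1 \<in> R" "x2 \<in> R" "x3 \<in> R"
      "x1 + y 1 + (x1 * y 1 + x2 * y 2 + x3 * y 3) = 0" by blast
    then show ?L by (intro exI[of _ "\<lambda>i. if i = 1 then x1 else if i = 2 then x2 else x3"]) auto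
  qed blast
  then show ?thesis unfolding column_unimodular_def I by (simp add: add.assoc)
qed

lemma unit_coset_mult:
  assumes R: "subrng R" and "a - 1 \<in> R" "b - 1 \<in> R"
  shows "a * b - 1 \<in> (R::'r::ring_1 set)"
proof -
  have "a * b - 1 = (a - 1) * (b - 1) + (a - 1) + (b - 1)" by (simp add: algebra_simps)
  also have "\<dots> \<in> R" using assms by (auto intro!: subrngD(2,4))
  finally show ?thesis .
qed

lemma unit_coset_add:
  assumes R: "subrng R" and "a - 1 \<in> R" "x \<in> R"
  shows "a + x - 1 \<in> (R::'r::ring_1 set)"
  using subrngD(2)[OF assms] by (simp add: algebra_simps)

lemma unit_coset_act:
  assumes R: "subrng R" and "a - 1 \<in> R" "x \<in> (R::'r::ring_1 set)"
  shows "a * x \<in> R" "x * a \<in> R"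
proof -
  have "a * x = (a - 1) * x + x" "x * a = x * (a - 1) + x" by (auto simp: algebra_simps)
  then show "a * x \<in> R" "x * a \<in> R" using assms by (auto intro!: subrngD(2,4))
qed

lemma stable_range_one:
  assumes R: "subrng R" and A: "stable_rank_one_modulo R {0}"
  shows "stable_range_in R 1"
  unfolding stable_range_in_def
proof (intro conjI allI impI)
  fix y assume "column_unimodular R (1 + 1) y"
  then obtain x1 x2 where y: "y 1 \<in> R" "y 2 \<in> R" and x: "x1 \<in> R" "x2 \<in> R"
    and eq: "x1 + y 1 + (x1 * y 1 + x2 * y 2) = 0"
    unfolding one_add_one column_unimodular_2 by blast
  have "(1 + x1) * (1 + y 1) + x2 * y 2 - 1 = 0"
    using eq by (simp add: algebra_simps)
  with A[unfolded stable_rank_one_modulo_def, rule_format, of "1 + x1" "1 + y 1" "x2 * y 2"] x y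
  obtain w d where w: "w \<in> R" "d - 1 \<in> R" "d * (1 + y 1 + w * (x2 * y 2)) - 1 = 0"
    using subrngD(4)[OF R] by auto
  have "(d - 1) + (y 1 + w * x2 * y 2) + (d - 1) * (y 1 + w * x2 * y 2) = 0"
    using w(3) by (simp add: algebra_simps)
  then show "\<exists>v. (\<forall>i\<in>{1..1}. v i \<in> R) \<and> column_unimodular R 1 (\<lambda>i. y i + v i * y (1 + 1))"
    unfolding column_unimodular_1 one_add_one
    using w x y by (intro exI[of _ "\<lambda>_. w * x2"]) (auto intro!: subrngD(2,4)[OF R])
qed simp

text \<open>
  The estimate \<open>sr(R) \<le> 2\<close> for an extension of a ring of stable rank one by an absorbing ideal.  Once
  \<open>b\<^sub>1\<close> is left invertible modulo \<open>I\<close>, with \<open>db\<^sub>1 = 1 - t\<close>, subtracting \<open>b\<^sub>idb\<^sub>1\<close> from \<open>b\<^sub>i\<close> turns the other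
  entries into \<open>b\<^sub>it \<in> I\<close>, where the absorbing property applies.  The steps that are not of the form
  "add a multiple of the last entry" are elementary transformations of the first two entries or
  change the coefficients only, so they can be undone at the end.
\<close>

lemma stable_range_two:
  assumes R: "subrng R" and I: "ideal_in R I" and A: "stable_rank_one_modulo R I" and B: "absorbing R I"
  shows "stable_range_in R 2"
  unfolding stable_range_in_def
proof (intro conjI allI impI)
  have three: "2 + 1 = (3::nat)" by simp
  fix y assume "column_unimodular R (2 + 1) y"
  then obtain x1 x2' x3' where y: "y 1 \<in> R" "y 2 \<in> R" "y 3 \<in> R" and x: "x1 \<in> R" "x2' \<in> R" "x3' \<in> R"
    and eq: "x1 + y 1 + (x1 * y 1 + x2' * y 2 + x3' * y 3) = 0"
    unfolding three column_unimodular_3 by blast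
  note cl = subrngD(1-4)[OF R] unit_coset_add[OF R] unit_coset_act[OF R] unit_coset_mult[OF R]
  define b where "b = 1 + y 1"
  define a where "a = 1 + x1"
  define c where "c = x2' * y 2 + x3' * y 3"
  have b: "b - 1 \<in> R" and a: "a - 1 \<in> R" and c: "c \<in> R" using x y by (simp_all add: a_def b_def c_def cl)
  have uni: "a * b + c = 1"
    using eq by (simp add: algebra_simps a_def b_def c_def)
  obtain w d where w: "w \<in> R" and d: "d - 1 \<in> R" and "d * (b + w * c) - 1 \<in> I"
    using A[unfolded stable_rank_one_modulo_def, rule_format, of a b c] a b c uni ideal_inD(2)[OF I] by auto
  \<comment> \<open>The first entry, made left invertible modulo \<open>I\<close>; \<open>t\<close> is the error.\<close>
  define b' where "b' = b + w * c"
  define t where "t = 1 - d * b'"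
  have t: "t \<in> I"
    using ideal_inD(7)[OF I \<open>d * (b + w * c) - 1 \<in> I\<close>] by (simp add: t_def b'_def)
  obtain q s s' where qs: "q \<in> R" "s \<in> R" "s' \<in> R"
    and qf: "q * (y 2 * t) = y 2 * t" "q * s = 0" "s' * (y 2 * t) = 0" "s' * s * (y 3 * t) = y 3 * t"
    using B[unfolded absorbing_def, rule_format, of "y 2 * t" "y 3 * t"] ideal_inD(5)[OF I t] y by metis
  \<comment> \<open>The coefficients of the relation when \<open>b\<close> is replaced by \<open>b'\<close>.\<close>
  define x2 x3 where "x2 = x2' - a * w * x2'" and "x3 = x3' - a * w * x3'"
  define X where "X = x2 * q + x3 * s'"
  \<comment> \<open>The new second entry; \<open>X\<close> maps \<open>et\<close> to the combination of \<open>y\<^sub>2t\<close> and \<open>y\<^sub>3t\<close> in the relation.\<close>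
  define e where "e = y 2 + s * y 3"
  define A where "A = a + x2 * y 2 * d + x3 * y 3 * d - X * e * d"
  have xR: "x2 \<in> R" "x3 \<in> R" using x w a by (simp_all add: x2_def x3_def mult.assoc cl)
  have XR: "X \<in> R" "e \<in> R" using xR qs y by (simp_all add: X_def e_def cl)
  have "A - 1 = (a - 1) + (x2 * y 2 + x3 * y 3 - X * e) * d" by (simp add: A_def algebra_simps)
  also have "\<dots> \<in> R" using xR XR y a d by (simp add: cl)
  finally have AR: "A - 1 \<in> R" .
  have "X * (e * t) = x2 * (q * (y 2 * t)) + x2 * (q * s) * (y 3 * t) + x3 * (s' * (y 2 * t)) + x3 * (s' * s * (y 3 * t))"
    by (simp add: X_def e_def algebra_simps)
  also have "\<dots> = x2 * (y 2 * t) + x3 * (y 3 * t)" using qf by simp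
  finally have X: "X * (e * t) = (x2 * y 2 + x3 * y 3) * t" by (simp add: algebra_simps)
  have "A * b' + X * e = a * b' + (x2 * y 2 + x3 * y 3 - X * e) * (d * b') + X * e"
    by (simp add: A_def algebra_simps)
  also have "d * b' = 1 - t" by (simp add: t_def)
  also have "a * b' + (x2 * y 2 + x3 * y 3 - X * e) * (1 - t) + X * e
      = a * b' + (x2 * y 2 + x3 * y 3) - (x2 * y 2 + x3 * y 3) * t + X * (e * t)"
    by (simp add: algebra_simps)
  also have "\<dots> = a * b' + (x2 * y 2 + x3 * y 3)" by (simp only: X) simp
  also have "\<dots> = a * b + c" by (simp add: x2_def x3_def b'_def c_def algebra_simps)
  finally have 1: "A * b' + X * e = 1" by (simp add: uni)
  \<comment> \<open>This undoes the passage from \<open>b\<close> to \<open>b'\<close>, up to a multiple of the new second entry.\<close>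
  define v1 where "v1 = w * x3' - w * x2' * s"
  have v1: "v1 \<in> R" using w x qs by (simp add: v1_def cl)
  have "b' = (b + v1 * y 3) + w * x2' * e"
    by (simp add: b'_def v1_def e_def c_def algebra_simps)
  then have fin: "A * (b + v1 * y 3) + (X + A * w * x2') * e = 1"
    using 1 by (simp add: algebra_simps)
  have "(A - 1) + (y 1 + v1 * y 3) + ((A - 1) * (y 1 + v1 * y 3) + (X + A * (w * x2')) * (y 2 + s * y 3)) = 0"
    using fin by (simp add: b_def e_def algebra_simps)
  moreover have "X + A * (w * x2') \<in> R" using AR XR w x by (simp add: cl)
  ultimately show "\<exists>v. (\<forall>i\<in>{1..2}. v i \<in> R) \<and> column_unimodular R 2 (\<lambda>i. y i + v i * y (2 + 1))"
    unfolding three column_unimodular_2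
    using y v1 qs AR
    by (intro exI[of _ "\<lambda>i. if i = 1 then v1 else s"] conjI bexI[of _ "A - 1"] bexI[of _ "X + A * (w * x2')"])
      (simp_all add: cl)
qed simp

text \<open>
  With \<open>\<alpha> = 1 - V + c\<close> and \<open>\<beta> = 1 - V + c'\<close> one has \<open>\<beta>\<alpha> = 1\<close>, hence the column \<open>(\<beta>, 1 - \<alpha>\<beta>)\<close> is
  unimodular.  A reduction \<open>\<gamma> = \<beta> + v(1 - \<alpha>\<beta>)\<close> of it is left invertible and satisfies \<open>\<gamma>\<alpha> = 1\<close>, so \<open>\<alpha>\<close>
  is a unit and \<open>\<alpha>\<beta> = 1\<close>.
\<close>

lemma stable_range_one_imp_directly_finite:
  assumes R: "subrng R" and sr: "stable_range_in R 1"
    and in_R: "V \<in> R" "c \<in> R" "c' \<in> R" and "c' * c = V"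
    and V: "V * V = V" "V * c = c" "c * V = c" "V * c' = c'" "c' * V = c'"
  shows "c * c' = V"
proof -
  note cl = subrngD(1-5)[OF R]
  \<comment> \<open>The column \<open>(\<beta>, 1 - \<alpha>\<beta>)\<close>, without the unit in its first entry.\<close>
  define y where "y i = (if i = 1 then c' - V else V - c * c')" for i :: nat
  have cc: "c' * (c * z) = V * z" "c * (V * z) = c * z" "V * (c * z) = c * z" "V * (V * z) = V * z"
     "V * (c' * z) = c' * z" "c' * (V * z) = c' * z" for z
    using assms(6) V by (metis mult.assoc)+
  have "(c - V) + y 1 + ((c - V) * y 1 + V * y 2) = 0"
    using V assms(6) cc by (simp add: y_def algebra_simps)
  then have "column_unimodular R (1 + 1) y"
    unfolding one_add_one column_unimodular_2 using in_R
    by (intro conjI bexI[of _ "c - V"] bexI[of _ V]) (simp_all add: y_def cl)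
  then obtain v where v: "column_unimodular R 1 (\<lambda>i. y i + v i * y 2)"
    using sr unfolding stable_range_in_def one_add_one by blast
  define g where "g = y 1 + v 1 * y 2"
  obtain d where "d + g + d * g = 0"
    using v unfolding column_unimodular_1 g_def by blast
  then have left: "(1 + d) * (1 + g) = 1" by (simp add: algebra_simps)
  have "y 2 * (1 + (c - V)) = 0"
    using V assms(6) cc by (simp add: y_def algebra_simps)
  then have "(1 + g) * (1 + (c - V)) = (1 + y 1) * (1 + (c - V))"
    by (simp add: g_def distrib_right mult.assoc)
  also have "\<dots> = 1"
    using V assms(6) cc by (simp add: y_def algebra_simps)
  finally have right: "(1 + g) * (1 + (c - V)) = 1" .
  have "1 + d = (1 + d) * ((1 + g) * (1 + (c - V)))" using right by simp
  also have "\<dots> = 1 + (c - V)" using left by (simp add: mult.assoc[symmetric])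
  finally have inv: "(1 + (c - V)) * (1 + g) = 1" using left by simp
  have "(1 + (c' - V)) * (1 + (c - V)) = 1"
    using V assms(6) cc by (simp add: algebra_simps)
  then have "1 + (c' - V) = (1 + (c' - V)) * ((1 + (c - V)) * (1 + g))" using inv by simp
  also have "\<dots> = 1 + g" using \<open>(1 + (c' - V)) * (1 + (c - V)) = 1\<close> by (simp add: mult.assoc[symmetric])
  finally have "(1 + (c - V)) * (1 + (c' - V)) = 1" using inv by simp
  then show ?thesis using V assms(6) cc by (simp add: algebra_simps)
qed

text \<open>
  The column of the adjoints \<open>x'\<^sub>1, \<dots>, x'\<^sub>m\<^sub>+\<^sub>1\<close> describes a surjection of \<open>R\<close> onto \<open>R\<^sup>m\<^sup>+\<^sup>1\<close>.  The last
  entry is modified so that the column becomes unimodular, that is, injective.  After adding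
  multiples of the last entry to the others, the element \<open>z = x\<^sub>m\<^sub>+\<^sub>1 - \<Sum>x\<^sub>iv\<^sub>ix\<^sub>0\<close> is killed by the first
  \<open>m\<close> entries, although \<open>x'\<^sub>m\<^sub>+\<^sub>1z = Q \<noteq> 0\<close>.
\<close>

lemma isometries_imp_no_stable_range:
  fixes x x' :: "nat \<Rightarrow> 'r::ring_1"
  assumes R: "subrng R" and Q: "Q \<in> R" "\<And>r. r \<in> R \<Longrightarrow> Q * r = r" "\<And>r. r \<in> R \<Longrightarrow> r * Q = r" "Q \<noteq> 0"
    and x: "\<And>k. x k \<in> R" "\<And>k. x' k \<in> R" "\<And>k l. x' k * x l = (if k = l then Q else 0)"
  shows "\<not> stable_range_in R m"
proof
  assume sr: "stable_range_in R m"
  then have m: "m \<ge> 1" by (simp add: stable_range_in_def)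
  note cl = subrngD(1-4)[OF R]
  let ?m = "m + 1"
  define g where "g = Q - (\<Sum>i=1..?m. x i * x' i)"
  have g: "g \<in> R" using Q x by (simp add: g_def cl subrng_sum[OF R])
  have gx: "g * x j = 0" if "j \<in> {1..?m}" for j
  proof -
    have "(\<Sum>i=1..?m. x i * x' i) * x j = (\<Sum>i=1..?m. x i * (if i = j then Q else 0))"
      by (simp only: sum_distrib_right mult.assoc x)
    also have "\<dots> = (\<Sum>i=1..?m. if i = j then x j * Q else 0)" by (intro sum.cong) auto
    also have "\<dots> = x j * Q" by (subst sum.delta) (use that in auto)
    finally show ?thesis using Q x by (simp add: g_def left_diff_distrib)
  qed
  \<comment> \<open>Two isometries with orthogonal ranges let one entry carry both \<open>x'\<^sub>m\<^sub>+\<^sub>1\<close> and the defect \<open>g\<close>.\<close>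
  define bl where "bl = x 0 * x' ?m + x 1 * g"
  have bl: "bl \<in> R" using x g by (simp add: bl_def cl)
  define y where "y i = (if i = ?m then bl else if i = 1 then x' 1 - Q else x' i)" for i
  define a where "a i = (if i = ?m then x ?m * x' 0 + x' 1 else if i = 1 then x 1 - Q else x i)" for i
  have split: "{1..?m} = {1} \<union> {2..m} \<union> {?m}" using m by auto
  have "(\<Sum>i=1..?m. a i * y i) = a 1 * y 1 + (\<Sum>i=2..m. a i * y i) + a ?m * y ?m"
    unfolding split using m by (subst sum.union_disjoint; simp)+
  also have "a 1 * y 1 = x 1 * x' 1 - x 1 - x' 1 + Q"
    using m Q x by (simp add: a_def y_def algebra_simps)
  also have "a ?m * y ?m = x ?m * x' ?m + g"
  proof -
    have "a ?m * y ?m = x ?m * (x' 0 * x 0) * x' ?m + x ?m * (x' 0 * x 1) * g + (x' 1 * x 0) * x' ?m + (x' 1 * x 1) * g"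
      by (simp add: a_def y_def bl_def algebra_simps)
    then show ?thesis using Q x g by simp
  qed
  also have "(\<Sum>i=2..m. a i * y i) = (\<Sum>i=2..m. x i * x' i)"
    by (intro sum.cong) (auto simp: a_def y_def)
  also have "x 1 * x' 1 - x 1 - x' 1 + Q + (\<Sum>i=2..m. x i * x' i) + (x ?m * x' ?m + g) =
      (\<Sum>i=1..?m. x i * x' i) + g + Q - x 1 - x' 1"
    unfolding split using m by (subst sum.union_disjoint; simp)+
  also have "\<dots> = Q + Q - x 1 - x' 1" by (simp add: g_def)
  finally have "a 1 + y 1 + (\<Sum>i=1..?m. a i * y i) = 0"
    using m by (simp add: a_def y_def)
  moreover have "a i \<in> R" "y i \<in> R" for i using x bl Q by (simp_all add: a_def y_def cl)
  ultimately have "column_unimodular R ?m y" unfolding column_unimodular_def by auto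
  from sr[unfolded stable_range_in_def, THEN conjunct2, rule_format, OF this]
  obtain v where v: "\<And>i. i \<in> {1..m} \<Longrightarrow> v i \<in> R"
    and red: "column_unimodular R m (\<lambda>i. y i + v i * y ?m)"
    by blast
  from red[unfolded column_unimodular_def, THEN conjunct2]
  obtain c where c: "\<And>i. i \<in> {1..m} \<Longrightarrow> c i \<in> R"
    and eq: "c 1 + (y 1 + v 1 * y ?m) + (\<Sum>i=1..m. c i * (y i + v i * y ?m)) = 0"
    by blast
  define z where "z = x ?m - (\<Sum>i=1..m. x i * v i * x 0)"
  have "(\<Sum>i=1..m. x i * v i * x 0) \<in> R"
    by (rule subrng_sum[OF R]) (rule cl(4)[OF cl(4)[OF x(1) v] x(1)])
  then have z: "z \<in> R" using x by (simp add: z_def cl)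
  have xz: "x' j * z = (if j = ?m then Q else - (v j * x 0))" if "j \<in> {1..?m}" for j
  proof -
    have "x' j * (\<Sum>i=1..m. x i * v i * x 0) = (\<Sum>i=1..m. if i = j then Q * (v i * x 0) else 0)"
      unfolding sum_distrib_left by (intro sum.cong) (auto simp: x mult.assoc[symmetric])
    also have "\<dots> = (if j \<in> {1..m} then v j * x 0 else 0)"
      using Q v x by (simp add: sum.delta cl)
    finally show ?thesis using that by (auto simp: z_def right_diff_distrib x)
  qed
  have "g * (\<Sum>i=1..m. x i * v i * x 0) = 0"
    unfolding sum_distrib_left by (intro sum.neutral) (simp add: mult.assoc[symmetric] gx)
  then have "g * z = 0" using gx[of ?m] by (simp add: z_def right_diff_distrib)
  then have blz: "bl * z = x 0"
    using xz[of ?m] Q x by (simp add: bl_def distrib_right mult.assoc)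
  have kill: "(x' i + v i * bl) * z = 0" if "i \<in> {1..m}" for i
    using xz[of i] that by (simp add: distrib_right mult.assoc blz)
  have 1: "(y 1 + v 1 * y ?m) * z = - z"
    using kill[of 1] m Q(2)[OF z] by (simp add: y_def algebra_simps)
  have "c i * (y i + v i * y ?m) * z = (if i = 1 then - (c 1 * z) else 0)" if "i \<in> {1..m}" for i
    using 1 kill[of i] that by (auto simp: mult.assoc) (auto simp: y_def)
  then have "(\<Sum>i=1..m. c i * (y i + v i * y ?m)) * z = (\<Sum>i=1..m. if i = 1 then - (c 1 * z) else 0)"
    by (simp add: sum_distrib_right)
  also have "\<dots> = - (c 1 * z)" using m by (simp add: sum.delta)
  finally have "(c 1 + (y 1 + v 1 * y ?m) + (\<Sum>i=1..m. c i * (y i + v i * y ?m))) * z = - z"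
    using 1 by (simp add: distrib_right)
  then have "z = 0" using eq by simp
  then show False using xz[of ?m] Q by simp
qed

section \<open>Block matrices over a field\<close>

text \<open>
  Stable rank one for square matrices.  The relation says that the rows of \<open>B\<close> and \<open>C\<close> together span
  the whole space.  Keep the rows of \<open>B\<close> that form a basis of the row space of \<open>B\<close> and complete them to
  a basis by rows of \<open>C\<close>: there are at most as many of these as rows of \<open>B\<close> that were not kept, so
  each can be added to a different one of the latter.  The rows of \<open>B + WC\<close> then span.
\<close>

lemma left_invertible_by_adding_rows:
  fixes A B C :: "'p \<Rightarrow> 'p \<Rightarrow> 'k::field"
  assumes P: "finite P"
    and inv: "\<And>\<alpha> \<beta>. \<alpha> \<in> P \<Longrightarrow> \<beta> \<in> P \<Longrightarrow>
      (\<Sum>\<gamma>\<in>P. A \<alpha> \<gamma> * B \<gamma> \<beta>) + C \<alpha> \<beta> = (if \<alpha> = \<beta> then 1 else 0)"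
  shows "\<exists>W D. \<forall>\<alpha>\<in>P. \<forall>\<beta>\<in>P.
    (\<Sum>\<gamma>\<in>P. D \<alpha> \<gamma> * (B \<gamma> \<beta> + (\<Sum>\<delta>\<in>P. W \<gamma> \<delta> * C \<delta> \<beta>))) = (if \<alpha> = \<beta> then 1 else 0)"
proof -
  define sc where "sc = (\<lambda>(c::'k) (f::'p \<Rightarrow> 'k) x. c * f x)"
  interpret vector_space sc
    by unfold_locales (auto simp: sc_def fun_eq_iff algebra_simps)
  define row where "row M \<alpha> = (\<lambda>\<beta>. if \<beta> \<in> P then M \<alpha> \<beta> else 0)" for M :: "'p \<Rightarrow> 'p \<Rightarrow> 'k" and \<alpha>
  define un where "un = row (\<lambda>\<alpha> \<beta>. if \<alpha> = \<beta> then 1 else 0)"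
  have sum_app: "sum f S x = (\<Sum>i\<in>S. f i x)" for f :: "'p \<Rightarrow> 'p \<Rightarrow> 'k" and S x
    by (induction S rule: infinite_finite_induct) auto
  have row_span: "row M \<alpha> \<in> span (un ` P)" for M \<alpha>
  proof -
    have "row M \<alpha> = (\<Sum>\<beta>\<in>P. sc (M \<alpha> \<beta>) (un \<beta>))"
    proof
      fix x
      have "(\<Sum>\<beta>\<in>P. sc (M \<alpha> \<beta>) (un \<beta>)) x = (\<Sum>\<beta>\<in>P. if \<beta> = x then row M \<alpha> x else 0)"
        by (auto simp: sum_app sc_def un_def row_def intro!: sum.cong)
      then show "row M \<alpha> x = (\<Sum>\<beta>\<in>P. sc (M \<alpha> \<beta>) (un \<beta>)) x"
        using P by (simp add: row_def)
    qed
    then show ?thesis by (simp only:) (intro span_sum span_scale span_base imageI)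
  qed
  \<comment> \<open>\<open>Q\<close> indexes the rows of \<open>B\<close> that are kept, \<open>Z\<close> is the completed basis.\<close>
  obtain B0 where B0: "B0 \<subseteq> row B ` P" "independent B0" "row B ` P \<subseteq> span B0"
    using maximal_independent_subset[of "row B ` P"] by blast
  then obtain Q where Q: "Q \<subseteq> P" "inj_on (row B) Q" "B0 = row B ` Q"
    by (meson subset_image_inj)
  obtain Z where Z: "B0 \<subseteq> Z" "Z \<subseteq> B0 \<union> row C ` P" "independent Z" "B0 \<union> row C ` P \<subseteq> span Z"
    using maximal_independent_subset_extend[of B0 "B0 \<union> row C ` P"] B0 by blast
  have "Z \<subseteq> span (un ` P)" using Z(2) B0(1) row_span by blast
  then have "finite Z" "card Z \<le> card (un ` P)"
    using independent_span_bound[of "un ` P" Z] P Z by auto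
  then have cZ: "card Z \<le> card P" using card_image_le[OF P, of un] by linarith
  have "card (Z - B0) \<le> card (P - Q)"
  proof -
    have "card B0 = card Q" using Q by (simp add: card_image)
    then show ?thesis using \<open>finite Z\<close> cZ Z(1) P Q(1)
      by (simp add: card_Diff_subset finite_subset)
  qed
  then obtain h where h: "inj_on h (Z - B0)" "h ` (Z - B0) \<subseteq> P - Q"
    using card_le_inj[of "Z - B0" "P - Q"] P \<open>finite Z\<close> by auto
  have "\<forall>z\<in>Z - B0. \<exists>\<delta>. \<delta> \<in> P \<and> row C \<delta> = z" using Z(2) by blast
  from bchoice[OF this] obtain ci
    where ci: "\<And>z. z \<in> Z - B0 \<Longrightarrow> ci z \<in> P \<and> row C (ci z) = z" by blast
  \<comment> \<open>\<open>h\<close> selects the row of \<open>B\<close> to which a basis vector is added, \<open>ci\<close> the row of \<open>C\<close> that it is.\<close>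
  define W where "W \<alpha> \<delta> = (if \<alpha> \<in> h ` (Z - B0) \<and> \<delta> = ci (inv_into (Z - B0) h \<alpha>) then 1 else 0 :: 'k)" for \<alpha> \<delta>
  define N where "N \<gamma> \<beta> = B \<gamma> \<beta> + (\<Sum>\<delta>\<in>P. W \<gamma> \<delta> * C \<delta> \<beta>)" for \<gamma> \<beta>
  have N1: "row N \<alpha> = row B \<alpha>" if "\<alpha> \<notin> h ` (Z - B0)" for \<alpha>
    using that by (auto simp: row_def N_def W_def)
  have N2: "row N (h z) = row B (h z) + z" if z: "z \<in> Z - B0" for z
  proof
    fix x
    have "W (h z) \<delta> = (if \<delta> = ci z then 1 else 0)" for \<delta>
      using z h(1) by (simp add: W_def)
    then have "(\<Sum>\<delta>\<in>P. W (h z) \<delta> * C \<delta> x) = (\<Sum>\<delta>\<in>P. if \<delta> = ci z then C \<delta> x else 0)"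
      by (intro sum.cong) auto
    then have "(\<Sum>\<delta>\<in>P. W (h z) \<delta> * C \<delta> x) = C (ci z) x"
      using ci[OF z] P by simp
    moreover have "z x = row C (ci z) x" using ci[OF z] by simp
    ultimately show "row N (h z) x = (row B (h z) + z) x"
      by (simp add: row_def N_def)
  qed
  have B0N: "B0 \<subseteq> span (row N ` P)"
  proof
    fix b assume "b \<in> B0"
    then obtain \<alpha> where "\<alpha> \<in> Q" "b = row B \<alpha>" using Q by blast
    moreover have "\<alpha> \<notin> h ` (Z - B0)" using h(2) \<open>\<alpha> \<in> Q\<close> by blast
    ultimately have "b = row N \<alpha>" "\<alpha> \<in> P" using N1 Q(1) by auto
    then show "b \<in> span (row N ` P)" by (auto intro: span_base)
  qed
  have BN: "row B ` P \<subseteq> span (row N ` P)"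
    using B0(3) span_mono[OF B0N] unfolding span_span by (rule subset_trans)
  have "Z \<subseteq> span (row N ` P)"
  proof
    fix z assume "z \<in> Z"
    show "z \<in> span (row N ` P)"
    proof (cases "z \<in> B0")
      case False
      then have z: "z \<in> Z - B0" using \<open>z \<in> Z\<close> by blast
      then have "h z \<in> P" using h(2) by blast
      then have "row N (h z) - row B (h z) \<in> span (row N ` P)"
        using BN by (intro span_diff) (auto intro: span_base)
      then show ?thesis using N2[OF z] by simp
    qed (use B0N in blast)
  qed
  then have "span Z \<subseteq> span (row N ` P)" using span_mono[of Z "span (row N ` P)"] unfolding span_span by blast
  then have CN: "row C ` P \<subseteq> span (row N ` P)" using Z(4) by blast
  have un_span: "un \<alpha> \<in> span (row N ` P)" if "\<alpha> \<in> P" for \<alpha>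
  proof -
    have "un \<alpha> = (\<Sum>\<gamma>\<in>P. sc (A \<alpha> \<gamma>) (row B \<gamma>)) + row C \<alpha>"
    proof
      fix x show "un \<alpha> x = ((\<Sum>\<gamma>\<in>P. sc (A \<alpha> \<gamma>) (row B \<gamma>)) + row C \<alpha>) x"
        using inv[OF that, of x] by (simp add: un_def row_def sum_app sc_def)
    qed
    moreover have "(\<Sum>\<gamma>\<in>P. sc (A \<alpha> \<gamma>) (row B \<gamma>)) \<in> span (row N ` P)"
      using BN by (intro span_sum span_scale) auto
    ultimately show ?thesis using CN that by (auto intro!: span_add)
  qed
  have "span (row N ` P) \<subseteq> {x. \<exists>d. x = (\<Sum>\<gamma>\<in>P. sc (d \<gamma>) (row N \<gamma>))}"
  proof (rule span_minimal)
    show "row N ` P \<subseteq> {x. \<exists>d. x = (\<Sum>\<gamma>\<in>P. sc (d \<gamma>) (row N \<gamma>))}"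
    proof clarify
      fix \<alpha> assume "\<alpha> \<in> P"
      then have "row N \<alpha> = (\<Sum>\<gamma>\<in>P. if \<gamma> = \<alpha> then row N \<alpha> else 0)" using P by simp
      also have "\<dots> = (\<Sum>\<gamma>\<in>P. sc (if \<gamma> = \<alpha> then 1 else 0) (row N \<gamma>))"
        by (intro sum.cong) (auto simp: sc_def zero_fun_def)
      finally show "\<exists>d. row N \<alpha> = (\<Sum>\<gamma>\<in>P. sc (d \<gamma>) (row N \<gamma>))"
        by (rule exI[of _ "\<lambda>\<gamma>. if \<gamma> = \<alpha> then 1 else 0"])
    qed
    show "subspace {x. \<exists>d. x = (\<Sum>\<gamma>\<in>P. sc (d \<gamma>) (row N \<gamma>))}"
    proof (rule subspaceI, goal_cases)
      case 1 show ?case by (auto intro!: exI[of _ "\<lambda>_. 0"])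
    next
      case (2 x y)
      then obtain d e where "x = (\<Sum>\<gamma>\<in>P. sc (d \<gamma>) (row N \<gamma>))" "y = (\<Sum>\<gamma>\<in>P. sc (e \<gamma>) (row N \<gamma>))" by blast
      then show ?case
        by (auto intro!: exI[of _ "\<lambda>\<gamma>. d \<gamma> + e \<gamma>"] simp: scale_left_distrib sum.distrib)
    next
      case (3 c x)
      then obtain d where "x = (\<Sum>\<gamma>\<in>P. sc (d \<gamma>) (row N \<gamma>))" by blast
      then show ?case
        by (auto intro!: exI[of _ "\<lambda>\<gamma>. c * d \<gamma>"] simp: scale_sum_right)
    qed
  qed
  then have "\<forall>\<alpha>\<in>P. \<exists>d. un \<alpha> = (\<Sum>\<gamma>\<in>P. sc (d \<gamma>) (row N \<gamma>))" using un_span by blast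
  from bchoice[OF this] obtain D
    where D: "\<And>\<alpha>. \<alpha> \<in> P \<Longrightarrow> un \<alpha> = (\<Sum>\<gamma>\<in>P. sc (D \<alpha> \<gamma>) (row N \<gamma>))" by blast
  have "(\<Sum>\<gamma>\<in>P. D \<alpha> \<gamma> * N \<gamma> \<beta>) = (if \<alpha> = \<beta> then 1 else 0)" if "\<alpha> \<in> P" "\<beta> \<in> P" for \<alpha> \<beta>
    using fun_cong[OF D[OF that(1)], of \<beta>] that by (simp add: sum_app sc_def un_def row_def)
  then show ?thesis unfolding N_def by blast
qed

text \<open>
  The scalars of a \<open>K\<close>-algebra as central elements of a ring with unit.
\<close>

locale central_scalars =
  fixes \<kappa> :: "'k::field \<Rightarrow> 'r::ring_1"
  assumes \<kappa>_add: "\<kappa> (a + b) = \<kappa> a + \<kappa> b"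
    and \<kappa>_mult: "\<kappa> (a * b) = \<kappa> a * \<kappa> b"
    and \<kappa>_one: "\<kappa> 1 = 1"
    and \<kappa>_central: "x * \<kappa> a = \<kappa> a * x"
begin

lemma \<kappa>_zero: "\<kappa> 0 = 0"
  using \<kappa>_add[of 0 0] by simp

lemma \<kappa>_minus: "\<kappa> (- a) = - \<kappa> a"
  using \<kappa>_add[of a "- a"] \<kappa>_zero by (simp add: minus_unique)

lemma \<kappa>_sum: "\<kappa> (sum f A) = (\<Sum>i\<in>A. \<kappa> (f i))"
  by (induction A rule: infinite_finite_induct) (auto simp: \<kappa>_zero \<kappa>_add)

lemma \<kappa>_left_commute: "x * (\<kappa> a * y) = \<kappa> a * (x * y)"
  by (simp only: mult.assoc[symmetric] \<kappa>_central[of x])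

end

text \<open>
  Only entries \<open>(\<alpha>, \<beta>)\<close> with \<open>\<alpha>\<close> and \<open>\<beta>\<close> in the same block belong to the algebra spanned by the matrix
  units, which is a finite product of full matrix algebras.
\<close>

locale block_matrix_units = central_scalars \<kappa> for \<kappa> :: "'k::field \<Rightarrow> 'r::ring_1" +
  fixes P :: "'p set" and block :: "'p \<Rightarrow> 'v" and E :: "'p \<Rightarrow> 'p \<Rightarrow> 'r"
  assumes finite_P: "finite P"
    and E_mult: "\<lbrakk>\<alpha> \<in> P; \<beta> \<in> P; \<gamma> \<in> P; \<delta> \<in> P; block \<alpha> = block \<beta>; block \<gamma> = block \<delta>\<rbrakk> \<Longrightarrow>
      E \<alpha> \<beta> * E \<gamma> \<delta> = (if \<beta> = \<gamma> then E \<alpha> \<delta> else 0)"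
begin

definition same_block where "same_block \<alpha> = {\<beta> \<in> P. block \<beta> = block \<alpha>}"

definition mat :: "('p \<Rightarrow> 'p \<Rightarrow> 'k) \<Rightarrow> 'r" where
  "mat M = (\<Sum>\<alpha>\<in>P. \<Sum>\<beta>\<in>same_block \<alpha>. \<kappa> (M \<alpha> \<beta>) * E \<alpha> \<beta>)"

lemma finite_same_block: "finite (same_block \<alpha>)" using finite_P by (simp add: same_block_def)

lemma same_block_P: "\<beta> \<in> same_block \<alpha> \<Longrightarrow> \<beta> \<in> P" by (simp add: same_block_def)
lemma same_block_eq: "\<beta> \<in> same_block \<alpha> \<Longrightarrow> same_block \<beta> = same_block \<alpha>" by (simp add: same_block_def)
lemma same_block_self: "\<alpha> \<in> P \<Longrightarrow> \<alpha> \<in> same_block \<alpha>" by (simp add: same_block_def)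

lemma mat_cong: "(\<And>\<alpha> \<beta>. \<alpha> \<in> P \<Longrightarrow> \<beta> \<in> same_block \<alpha> \<Longrightarrow> M \<alpha> \<beta> = N \<alpha> \<beta>) \<Longrightarrow> mat M = mat N"
  by (simp add: mat_def cong: sum.cong)

lemma mat_add: "mat M + mat N = mat (\<lambda>\<alpha> \<beta>. M \<alpha> \<beta> + N \<alpha> \<beta>)"
  by (simp add: mat_def \<kappa>_add distrib_right sum.distrib)

lemma mat_zero: "mat (\<lambda>_ _. 0) = 0"
  by (simp add: mat_def \<kappa>_zero)

lemma mat_scale: "\<kappa> c * mat M = mat (\<lambda>\<alpha> \<beta>. c * M \<alpha> \<beta>)"
  by (simp add: mat_def \<kappa>_mult sum_distrib_left mult.assoc)

lemma E_mat:
  assumes "\<alpha> \<in> P" "\<beta> \<in> same_block \<alpha>"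
  shows "E \<alpha> \<beta> * mat N = (\<Sum>\<delta>\<in>same_block \<alpha>. \<kappa> (N \<beta> \<delta>) * E \<alpha> \<delta>)"
proof -
  have "E \<alpha> \<beta> * mat N = (\<Sum>\<gamma>\<in>P. \<Sum>\<delta>\<in>same_block \<gamma>. \<kappa> (N \<gamma> \<delta>) * (E \<alpha> \<beta> * E \<gamma> \<delta>))"
    by (simp add: mat_def sum_distrib_left \<kappa>_left_commute)
  also have "\<dots> = (\<Sum>\<gamma>\<in>P. if \<gamma> = \<beta> then (\<Sum>\<delta>\<in>same_block \<gamma>. \<kappa> (N \<gamma> \<delta>) * E \<alpha> \<delta>) else 0)"
    using assms by (intro sum.cong refl) (auto simp: E_mult same_block_def intro!: sum.neutral sum.cong)
  also have "\<dots> = (\<Sum>\<delta>\<in>same_block \<beta>. \<kappa> (N \<beta> \<delta>) * E \<alpha> \<delta>)"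
    using assms finite_P by (simp add: same_block_P)
  finally show ?thesis using same_block_eq[OF assms(2)] by simp
qed

lemma mat_mult: "mat M * mat N = mat (\<lambda>\<alpha> \<beta>. \<Sum>\<gamma>\<in>same_block \<alpha>. M \<alpha> \<gamma> * N \<gamma> \<beta>)"
proof -
  have "mat M * mat N = (\<Sum>\<alpha>\<in>P. \<Sum>\<beta>\<in>same_block \<alpha>. \<kappa> (M \<alpha> \<beta>) * (E \<alpha> \<beta> * mat N))"
    by (subst mat_def) (simp add: sum_distrib_right mult.assoc)
  also have "\<dots> = (\<Sum>\<alpha>\<in>P. \<Sum>\<beta>\<in>same_block \<alpha>. \<Sum>\<delta>\<in>same_block \<alpha>. \<kappa> (M \<alpha> \<beta> * N \<beta> \<delta>) * E \<alpha> \<delta>)"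
    by (intro sum.cong refl) (simp add: E_mat sum_distrib_left \<kappa>_mult mult.assoc)
  also have "\<dots> = (\<Sum>\<alpha>\<in>P. \<Sum>\<delta>\<in>same_block \<alpha>. \<Sum>\<beta>\<in>same_block \<alpha>. \<kappa> (M \<alpha> \<beta> * N \<beta> \<delta>) * E \<alpha> \<delta>)"
    by (intro sum.cong refl sum.swap)
  also have "\<dots> = mat (\<lambda>\<alpha> \<beta>. \<Sum>\<gamma>\<in>same_block \<alpha>. M \<alpha> \<gamma> * N \<gamma> \<beta>)"
    by (simp add: mat_def \<kappa>_sum sum_distrib_right)
  finally show ?thesis .
qed

lemma mat_single:
  assumes "\<alpha> \<in> P" "\<beta> \<in> same_block \<alpha>"
  shows "mat (\<lambda>\<gamma> \<delta>. if \<gamma> = \<alpha> \<and> \<delta> = \<beta> then c else 0) = \<kappa> c * E \<alpha> \<beta>"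
proof -
  have "mat (\<lambda>\<gamma> \<delta>. if \<gamma> = \<alpha> \<and> \<delta> = \<beta> then c else 0) =
      (\<Sum>\<gamma>\<in>P. if \<gamma> = \<alpha> then (\<Sum>\<delta>\<in>same_block \<gamma>. if \<delta> = \<beta> then \<kappa> c * E \<gamma> \<delta> else 0) else 0)"
    unfolding mat_def by (intro sum.cong refl) (auto simp: \<kappa>_zero intro!: sum.cong sum.neutral)
  then show ?thesis using assms finite_P finite_same_block by simp
qed

text \<open>
  The matrices are treated block by block, so that \<open>W\<close> and \<open>D\<close> respect the blocks.
\<close>

lemma block_left_invertible_by_adding_rows:
  fixes A B C :: "'p \<Rightarrow> 'p \<Rightarrow> 'k"
  assumes inv: "\<And>\<alpha> \<beta>. \<alpha> \<in> P \<Longrightarrow> \<beta> \<in> same_block \<alpha> \<Longrightarrow>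
      (\<Sum>\<gamma>\<in>same_block \<alpha>. A \<alpha> \<gamma> * B \<gamma> \<beta>) + C \<alpha> \<beta> = (if \<alpha> = \<beta> then 1 else 0)"
  shows "\<exists>W D. \<forall>\<alpha>\<in>P. \<forall>\<beta>\<in>same_block \<alpha>.
    (\<Sum>\<gamma>\<in>same_block \<alpha>. D \<alpha> \<gamma> * (B \<gamma> \<beta> + (\<Sum>\<delta>\<in>same_block \<gamma>. W \<gamma> \<delta> * C \<delta> \<beta>))) = (if \<alpha> = \<beta> then 1 else 0)"
proof -
  let ?same_block = "\<lambda>v. {\<beta> \<in> P. block \<beta> = v}"
  have "\<forall>v. \<exists>WD. \<forall>\<alpha>\<in>?same_block v. \<forall>\<beta>\<in>?same_block v.
    (\<Sum>\<gamma>\<in>?same_block v. snd WD \<alpha> \<gamma> * (B \<gamma> \<beta> + (\<Sum>\<delta>\<in>?same_block v. fst WD \<gamma> \<delta> * C \<delta> \<beta>))) = (if \<alpha> = \<beta> then 1 else 0)"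
  proof
    fix v
    have "finite (?same_block v)" using finite_P by simp
    have "\<exists>W D. \<forall>\<alpha>\<in>?same_block v. \<forall>\<beta>\<in>?same_block v.
      (\<Sum>\<gamma>\<in>?same_block v. D \<alpha> \<gamma> * (B \<gamma> \<beta> + (\<Sum>\<delta>\<in>?same_block v. W \<gamma> \<delta> * C \<delta> \<beta>))) = (if \<alpha> = \<beta> then 1 else 0)"
    proof (rule left_invertible_by_adding_rows[OF \<open>finite (?same_block v)\<close>])
      fix \<alpha> \<beta> assume "\<alpha> \<in> ?same_block v" "\<beta> \<in> ?same_block v"
      then have "\<alpha> \<in> P" "\<beta> \<in> same_block \<alpha>" "same_block \<alpha> = ?same_block v" by (auto simp: same_block_def)
      then show "(\<Sum>\<gamma>\<in>?same_block v. A \<alpha> \<gamma> * B \<gamma> \<beta>) + C \<alpha> \<beta> = (if \<alpha> = \<beta> then 1 else 0)"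
        using inv[of \<alpha> \<beta>] by simp
    qed
    then obtain W D where "\<forall>\<alpha>\<in>?same_block v. \<forall>\<beta>\<in>?same_block v.
      (\<Sum>\<gamma>\<in>?same_block v. D \<alpha> \<gamma> * (B \<gamma> \<beta> + (\<Sum>\<delta>\<in>?same_block v. W \<gamma> \<delta> * C \<delta> \<beta>))) = (if \<alpha> = \<beta> then 1 else 0)"
      by blast
    then show "\<exists>WD. \<forall>\<alpha>\<in>?same_block v. \<forall>\<beta>\<in>?same_block v.
      (\<Sum>\<gamma>\<in>?same_block v. snd WD \<alpha> \<gamma> * (B \<gamma> \<beta> + (\<Sum>\<delta>\<in>?same_block v. fst WD \<gamma> \<delta> * C \<delta> \<beta>))) = (if \<alpha> = \<beta> then 1 else 0)"
      by (intro exI[of _ "(W, D)"]) simp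
  qed
  from choice[OF this] obtain WD where WD: "\<And>v \<alpha> \<beta>. \<alpha> \<in> ?same_block v \<Longrightarrow> \<beta> \<in> ?same_block v \<Longrightarrow>
    (\<Sum>\<gamma>\<in>?same_block v. snd (WD v) \<alpha> \<gamma> * (B \<gamma> \<beta> + (\<Sum>\<delta>\<in>?same_block v. fst (WD v) \<gamma> \<delta> * C \<delta> \<beta>))) = (if \<alpha> = \<beta> then 1 else 0)"
    by blast
  show ?thesis
  proof (rule exI[of _ "\<lambda>\<alpha>. fst (WD (block \<alpha>)) \<alpha>"], rule exI[of _ "\<lambda>\<alpha>. snd (WD (block \<alpha>)) \<alpha>"], intro ballI)
    fix \<alpha> \<beta> assume "\<alpha> \<in> P" "\<beta> \<in> same_block \<alpha>"
    then have "\<alpha> \<in> ?same_block (block \<alpha>)" "\<beta> \<in> ?same_block (block \<alpha>)" by (auto simp: same_block_def)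
    note WD[OF this]
    moreover have "?same_block (block \<alpha>) = same_block \<alpha>" by (simp add: same_block_def)
    moreover have "same_block \<gamma> = same_block \<alpha>" "block \<gamma> = block \<alpha>" if "\<gamma> \<in> same_block \<alpha>" for \<gamma>
      using that by (auto simp: same_block_def)
    ultimately show "(\<Sum>\<gamma>\<in>same_block \<alpha>. snd (WD (block \<alpha>)) \<alpha> \<gamma> * (B \<gamma> \<beta> + (\<Sum>\<delta>\<in>same_block \<gamma>. fst (WD (block \<gamma>)) \<gamma> \<delta> * C \<delta> \<beta>))) =
        (if \<alpha> = \<beta> then 1 else 0)"
      by simp
  qed
qed

text \<open>
  The matrix units are linearly independent modulo an ideal that contains none of the diagonal ones:
  multiplication by matrix units isolates a single entry, and a nonzero scalar is invertible.
\<close>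

lemma mat_in_ideal_imp_zero:
  assumes I: "ideal_in R I" and scal: "\<And>c x. x \<in> I \<Longrightarrow> \<kappa> c * x \<in> I"
    and E_R: "\<And>\<alpha> \<beta>. \<alpha> \<in> P \<Longrightarrow> \<beta> \<in> same_block \<alpha> \<Longrightarrow> E \<alpha> \<beta> \<in> R" and notin: "\<And>\<alpha>. \<alpha> \<in> P \<Longrightarrow> E \<alpha> \<alpha> \<notin> I"
    and "mat M \<in> I" and \<alpha>: "\<alpha> \<in> P" and \<beta>: "\<beta> \<in> same_block \<alpha>"
  shows "M \<alpha> \<beta> = 0"
proof (rule ccontr)
  assume nz: "M \<alpha> \<beta> \<noteq> 0"
  have \<beta>': "\<beta> \<in> P" "\<alpha> \<in> same_block \<beta>" "\<beta> \<in> same_block \<beta>" "\<alpha> \<in> same_block \<alpha>" using \<alpha> \<beta> by (auto simp: same_block_def)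
  have "E \<beta> \<alpha> * mat M * E \<beta> \<beta> = (\<Sum>\<delta>\<in>same_block \<beta>. \<kappa> (M \<alpha> \<delta>) * (E \<beta> \<delta> * E \<beta> \<beta>))"
    by (simp add: E_mat[OF \<beta>'(1,2)] sum_distrib_right mult.assoc)
  also have "\<dots> = (\<Sum>\<delta>\<in>same_block \<beta>. if \<delta> = \<beta> then \<kappa> (M \<alpha> \<beta>) * E \<beta> \<beta> else 0)"
    using \<beta>' by (intro sum.cong refl) (auto simp: E_mult same_block_def)
  also have "\<dots> = \<kappa> (M \<alpha> \<beta>) * E \<beta> \<beta>" using \<beta>' finite_same_block by simp
  finally have "\<kappa> (M \<alpha> \<beta>) * E \<beta> \<beta> \<in> I"
    using ideal_inD(6)[OF I ideal_inD(5)[OF I \<open>mat M \<in> I\<close> E_R[OF \<beta>'(1,2)]] E_R[OF \<beta>'(1,3)]] by simp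
  then have "\<kappa> (inverse (M \<alpha> \<beta>)) * (\<kappa> (M \<alpha> \<beta>) * E \<beta> \<beta>) \<in> I" by (rule scal)
  also have "\<kappa> (inverse (M \<alpha> \<beta>)) * (\<kappa> (M \<alpha> \<beta>) * E \<beta> \<beta>) = E \<beta> \<beta>"
    using nz by (simp add: mult.assoc[symmetric] \<kappa>_mult[symmetric] \<kappa>_one)
  finally show False using notin \<beta>' by blast
qed

text \<open>
  Representing \<open>a - 1\<close>, \<open>b - 1\<close> and \<open>c\<close> by matrices modulo \<open>I\<close> turns the relation into the matrix
  identity \<open>(1 + X)(1 + Y) + C = 1\<close>, because a matrix that lies in \<open>I\<close> vanishes.
\<close>

lemma matrix_stable_rank_one_modulo:
  assumes R: "subrng R" and I: "ideal_in R I" and scal: "\<And>c x. x \<in> I \<Longrightarrow> \<kappa> c * x \<in> I"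
    and scalR: "\<And>c x. x \<in> R \<Longrightarrow> \<kappa> c * x \<in> R"
    and E_R: "\<And>\<alpha> \<beta>. \<alpha> \<in> P \<Longrightarrow> \<beta> \<in> same_block \<alpha> \<Longrightarrow> E \<alpha> \<beta> \<in> R" and notin: "\<And>\<alpha>. \<alpha> \<in> P \<Longrightarrow> E \<alpha> \<alpha> \<notin> I"
    and abc: "a - 1 \<in> R" "b - 1 \<in> R" "c \<in> R" "a * b + c - 1 \<in> I"
    and X: "a - 1 - mat X \<in> I" and Y: "b - 1 - mat Y \<in> I" and C: "c - mat C \<in> I"
  shows "\<exists>w\<in>R. \<exists>d. d - 1 \<in> R \<and> d * (b + w * c) - 1 \<in> I"
proof -
  have mat_R: "mat M \<in> R" for M
    unfolding mat_def by (intro subrng_sum[OF R] scalR E_R)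
  define M where "M \<alpha> \<beta> = (\<Sum>\<gamma>\<in>same_block \<alpha>. X \<alpha> \<gamma> * Y \<gamma> \<beta>) + X \<alpha> \<beta> + Y \<alpha> \<beta> + C \<alpha> \<beta>" for \<alpha> \<beta>
  have "mat M = mat X * mat Y + mat X + mat Y + mat C"
    by (simp only: mat_mult mat_add M_def[abs_def])
  also have "\<dots> = (a * b + c - 1) - (a - 1 - mat X) * mat Y - (a - 1) * (b - 1 - mat Y) -
      (a - 1 - mat X) - (b - 1 - mat Y) - (c - mat C)"
    by (simp add: algebra_simps)
  also have "\<dots> \<in> I"
    by (rule ideal_inD(4)[OF I ideal_inD(4)[OF I ideal_inD(4)[OF I ideal_inD(4)[OF I ideal_inD(4)[OF I
      abc(4) ideal_inD(6)[OF I X mat_R]] ideal_inD(5)[OF I Y abc(1)]] X] Y] C])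
  finally have "mat M \<in> I" .
  then have M0: "M \<alpha> \<beta> = 0" if "\<alpha> \<in> P" "\<beta> \<in> same_block \<alpha>" for \<alpha> \<beta>
    using mat_in_ideal_imp_zero[OF I scal E_R notin] that by blast
  define one where "one \<alpha> \<beta> = (if \<alpha> = \<beta> then 1 else 0 :: 'k)" for \<alpha> \<beta> :: 'p
  have one_left: "(\<Sum>\<gamma>\<in>same_block \<alpha>. one \<alpha> \<gamma> * N \<gamma>) = N \<alpha>" if "\<alpha> \<in> P" for \<alpha> N
    using that finite_same_block by (simp add: one_def same_block_self if_distrib if_distribR cong: if_cong)
  have one_right: "(\<Sum>\<gamma>\<in>same_block \<alpha>. N \<gamma> * one \<gamma> \<beta>) = N \<beta>" if "\<beta> \<in> same_block \<alpha>" for \<alpha> \<beta> N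
    using that finite_same_block by (simp add: one_def if_distrib if_distribR cong: if_cong)
  have "(\<Sum>\<gamma>\<in>same_block \<alpha>. (one \<alpha> \<gamma> + X \<alpha> \<gamma>) * (one \<gamma> \<beta> + Y \<gamma> \<beta>)) + C \<alpha> \<beta> = (if \<alpha> = \<beta> then 1 else 0)"
    if "\<alpha> \<in> P" "\<beta> \<in> same_block \<alpha>" for \<alpha> \<beta>
  proof -
    have "(\<Sum>\<gamma>\<in>same_block \<alpha>. (one \<alpha> \<gamma> + X \<alpha> \<gamma>) * (one \<gamma> \<beta> + Y \<gamma> \<beta>)) + C \<alpha> \<beta> = one \<alpha> \<beta> + M \<alpha> \<beta>"
      using one_left[OF that(1), of "\<lambda>\<gamma>. one \<gamma> \<beta>"] one_left[OF that(1), of "\<lambda>\<gamma>. Y \<gamma> \<beta>"]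
        one_right[OF that(2), of "X \<alpha>"]
      by (simp add: distrib_left distrib_right sum.distrib M_def)
    then show ?thesis using M0[OF that] by (simp add: one_def)
  qed
  from block_left_invertible_by_adding_rows[OF this]
  obtain W D1 where WD: "\<And>\<alpha> \<beta>. \<alpha> \<in> P \<Longrightarrow> \<beta> \<in> same_block \<alpha> \<Longrightarrow>
    (\<Sum>\<gamma>\<in>same_block \<alpha>. D1 \<alpha> \<gamma> * (one \<gamma> \<beta> + Y \<gamma> \<beta> + (\<Sum>\<delta>\<in>same_block \<gamma>. W \<gamma> \<delta> * C \<delta> \<beta>))) = (if \<alpha> = \<beta> then 1 else 0)"
    by blast
  \<comment> \<open>The unit of the surrounding ring is not a matrix, hence \<open>D\<close> describes \<open>d - 1\<close>.\<close>
  define D where "D \<alpha> \<beta> = D1 \<alpha> \<beta> - one \<alpha> \<beta>" for \<alpha> \<beta>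
  define U where "U \<gamma> \<beta> = Y \<gamma> \<beta> + (\<Sum>\<delta>\<in>same_block \<gamma>. W \<gamma> \<delta> * C \<delta> \<beta>)" for \<gamma> \<beta>
  have "D \<alpha> \<beta> + U \<alpha> \<beta> + (\<Sum>\<gamma>\<in>same_block \<alpha>. D \<alpha> \<gamma> * U \<gamma> \<beta>) = 0" if "\<alpha> \<in> P" "\<beta> \<in> same_block \<alpha>" for \<alpha> \<beta>
  proof -
    have "(\<Sum>\<gamma>\<in>same_block \<alpha>. D1 \<alpha> \<gamma> * (one \<gamma> \<beta> + U \<gamma> \<beta>)) = one \<alpha> \<beta>"
      using WD[OF that] by (simp add: U_def one_def add.assoc)
    then show ?thesis
      using one_left[OF that(1), of "\<lambda>\<gamma>. U \<gamma> \<beta>"] one_right[OF that(2), of "D1 \<alpha>"]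
      by (simp add: D_def distrib_left left_diff_distrib sum.distrib sum_subtractf add_diff_eq)
  qed
  then have "mat (\<lambda>\<alpha> \<beta>. D \<alpha> \<beta> + U \<alpha> \<beta> + (\<Sum>\<gamma>\<in>same_block \<alpha>. D \<alpha> \<gamma> * U \<gamma> \<beta>)) = 0"
    using mat_cong[of _ "\<lambda>_ _. 0"] mat_zero by simp
  then have 0: "mat D + mat U + mat D * mat U = 0"
    by (simp add: mat_add mat_mult)
  have U: "mat U = mat Y + mat W * mat C"
    by (simp add: mat_add mat_mult U_def[abs_def])
  define z where "z = (b - 1 - mat Y) + mat W * (c - mat C)"
  have z: "z \<in> I" unfolding z_def by (rule ideal_inD(3)[OF I Y ideal_inD(5)[OF I C mat_R]])
  have bw: "b + mat W * c = 1 + mat U + z" by (simp add: z_def U algebra_simps)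
  have "(1 + mat D) * (b + mat W * c) - 1 = (mat D + mat U + mat D * mat U) + (z + mat D * z)"
    unfolding bw by (simp add: algebra_simps)
  also have "\<dots> \<in> I" unfolding 0 using ideal_inD(3)[OF I z ideal_inD(5)[OF I z mat_R]] by simp
  finally show ?thesis
    using mat_R by (intro bexI[of _ "mat W"] exI[of _ "1 + mat D"]) auto
qed

end

section \<open>Monomials in the generators\<close>

context central_scalars
begin

text \<open>
  The linear span, generated by adding one scalar multiple at a time.
\<close>

inductive_set lin_span :: "'r set \<Rightarrow> 'r set" for B :: "'r set" where
  lin_span_zero: "0 \<in> lin_span B"
| lin_span_step: "b \<in> B \<Longrightarrow> x \<in> lin_span B \<Longrightarrow> \<kappa> c * b + x \<in> lin_span B"

lemma lin_span_base: "b \<in> B \<Longrightarrow> b \<in> lin_span B"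
  using lin_span_step[of b B 0 1] lin_span_zero[of B] by (simp add: \<kappa>_one)

lemma lin_span_add: "x \<in> lin_span B \<Longrightarrow> y \<in> lin_span B \<Longrightarrow> x + y \<in> lin_span B"
  by (induction rule: lin_span.induct) (auto simp: add.assoc intro: lin_span_step)

lemma lin_span_scale: "x \<in> lin_span B \<Longrightarrow> \<kappa> c * x \<in> lin_span B"
proof (induction rule: lin_span.induct)
  case (lin_span_step b x d)
  then show ?case using lin_span.lin_span_step[of b B "\<kappa> c * x" "c * d"]
    by (simp add: distrib_left \<kappa>_mult mult.assoc)
qed (simp add: lin_span_zero)

lemma lin_span_minus: "x \<in> lin_span B \<Longrightarrow> - x \<in> lin_span B"
  using lin_span_scale[of x B "- 1"] by (simp add: \<kappa>_minus \<kappa>_one)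

lemma lin_span_diff: "x \<in> lin_span B \<Longrightarrow> y \<in> lin_span B \<Longrightarrow> x - y \<in> lin_span B"
  using lin_span_add[of x B "- y"] lin_span_minus[of y B] by simp

lemma lin_span_mono: "x \<in> lin_span A \<Longrightarrow> A \<subseteq> B \<Longrightarrow> x \<in> lin_span B"
  by (induction rule: lin_span.induct) (auto intro: lin_span.intros)

lemma lin_span_sum: "(\<And>i. i \<in> S \<Longrightarrow> f i \<in> lin_span B) \<Longrightarrow> sum f S \<in> lin_span B"
  by (induction S rule: infinite_finite_induct) (auto intro: lin_span_zero lin_span_add)

lemma lin_span_mult:
  assumes "x \<in> lin_span A" "y \<in> lin_span B" and AB: "\<And>a b. a \<in> A \<Longrightarrow> b \<in> B \<Longrightarrow> a * b \<in> lin_span C"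
  shows "x * y \<in> lin_span C"
proof -
  have *: "a * y \<in> lin_span C" if "a \<in> A" for a
    using \<open>y \<in> lin_span B\<close>
  proof (induction rule: lin_span.induct)
    case (lin_span_step b x c)
    then have "\<kappa> c * (a * b) + a * x \<in> lin_span C" using that AB by (intro lin_span_add lin_span_scale)
    then show ?case by (simp add: distrib_left \<kappa>_left_commute)
  qed (simp add: lin_span_zero)
  show ?thesis
    using \<open>x \<in> lin_span A\<close>
  proof (induction rule: lin_span.induct)
    case (lin_span_step a x c)
    then have "\<kappa> c * (a * y) + x * y \<in> lin_span C" using * by (intro lin_span_add lin_span_scale)
    then show ?case by (simp add: distrib_right mult.assoc)
  qed (simp add: lin_span_zero)
qed

lemma lin_span_finite: "x \<in> lin_span B \<Longrightarrow> \<exists>T. finite T \<and> T \<subseteq> B \<and> x \<in> lin_span T"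
proof (induction rule: lin_span.induct)
  case lin_span_zero
  show ?case by (intro exI[of _ "{}"]) (auto intro: lin_span.lin_span_zero)
next
  case (lin_span_step b x c)
  then obtain T where "finite T" "T \<subseteq> B" "x \<in> lin_span T" by blast
  then show ?case using lin_span_step
    by (intro exI[of _ "insert b T"]) (auto intro!: lin_span.lin_span_step intro: lin_span_mono)
qed

end

text \<open>
  A homomorphic image of \<open>L(E)\<close>, given by the images of the generators.  In a ring class the relations
  are equations between elements, and computations with cosets are avoided.
\<close>

locale leavitt_family = row_finite_graph E + central_scalars \<kappa>
  for E :: "('v, 'e) pre_digraph" (structure) and \<kappa> :: "'k::field \<Rightarrow> 'r::ring_1" +
  fixes V :: "'v \<Rightarrow> 'r" and Ed Gh :: "'e \<Rightarrow> 'r"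
  assumes V_mult: "\<lbrakk>v \<in> verts E; w \<in> verts E\<rbrakk> \<Longrightarrow> V v * V w = (if v = w then V v else 0)"
    and V_Ed: "e \<in> arcs E \<Longrightarrow> V (tail E e) * Ed e = Ed e"
    and Ed_V: "e \<in> arcs E \<Longrightarrow> Ed e * V (head E e) = Ed e"
    and V_Gh: "e \<in> arcs E \<Longrightarrow> V (head E e) * Gh e = Gh e"
    and Gh_V: "e \<in> arcs E \<Longrightarrow> Gh e * V (tail E e) = Gh e"
    and Gh_Ed: "\<lbrakk>e \<in> arcs E; e' \<in> arcs E\<rbrakk> \<Longrightarrow> Gh e * Ed e' = (if e = e' then V (head E e) else 0)"
    and V_sum: "\<lbrakk>v \<in> verts E; out_arcs E v \<noteq> {}\<rbrakk> \<Longrightarrow> V v = (\<Sum>e\<in>out_arcs E v. Ed e * Gh e)"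
begin

primrec ed :: "'v \<Rightarrow> 'e list \<Rightarrow> 'r" where
  "ed u [] = V u"
| "ed u (e # p) = Ed e * ed (head E e) p"

primrec gh :: "'v \<Rightarrow> 'e list \<Rightarrow> 'r" where
  "gh u [] = V u"
| "gh u (e # p) = gh (head E e) p * Gh e"

lemma V_idem: "v \<in> verts E \<Longrightarrow> V v * V v = V v"
  by (simp add: V_mult)

lemma V_ed: "awalk u p w \<Longrightarrow> V u * ed u p = ed u p"
  by (cases p) (auto simp: awalk_simps V_idem V_Ed mult.assoc[symmetric])

lemma gh_V: "awalk u p w \<Longrightarrow> gh u p * V u = gh u p"
  by (cases p) (auto simp: awalk_simps V_idem Gh_V mult.assoc)

lemma ed_V: "awalk u p w \<Longrightarrow> ed u p * V w = ed u p"
  by (induction p arbitrary: u) (auto simp: awalk_simps V_idem mult.assoc)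

lemma V_gh: "awalk u p w \<Longrightarrow> V w * gh u p = gh u p"
  by (induction p arbitrary: u) (auto simp: awalk_simps V_idem mult.assoc[symmetric])

lemma ed_append: "awalk u p w \<Longrightarrow> awalk w q z \<Longrightarrow> ed u (p @ q) = ed u p * ed w q"
  by (induction p arbitrary: u) (auto simp: awalk_simps V_ed mult.assoc)

lemma gh_append: "awalk u p w \<Longrightarrow> awalk w q z \<Longrightarrow> gh u (p @ q) = gh w q * gh u p"
  by (induction p arbitrary: u) (auto simp: awalk_simps gh_V mult.assoc)

lemma gh_ed_self: "awalk u p w \<Longrightarrow> gh u p * ed u p = V w"
proof (induction p arbitrary: u)
  case (Cons e p)
  then have e: "e \<in> arcs E" "awalk (head E e) p w" by (auto simp: awalk_simps)
  have "gh u (e # p) * ed u (e # p) = gh (head E e) p * (Gh e * Ed e) * ed (head E e) p"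
    by (simp add: mult.assoc)
  then show ?case using Cons.IH[OF e(2)] e by (simp add: Gh_Ed gh_V)
qed (auto simp: awalk_simps V_idem)

lemma gh_ed_start:
  assumes "awalk u p w" "awalk u' q w'" "u \<noteq> u'"
  shows "gh u p * ed u' q = 0"
proof -
  have "gh u p * ed u' q = gh u p * (V u * V u') * ed u' q"
    by (simp only: mult.assoc V_ed[OF assms(2)]) (simp only: mult.assoc[symmetric] gh_V[OF assms(1)])
  moreover have "u \<in> verts E" "u' \<in> verts E" using assms by (auto dest: awalk_hd_in_verts)
  ultimately show ?thesis using assms(3) by (simp add: V_mult)
qed

lemma gh_ed_prefix:
  assumes "awalk u p w" "awalk w q z"
  shows "gh u p * ed u (p @ q) = ed w q" "gh u (p @ q) * ed u p = gh w q"
proof -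
  show "gh u p * ed u (p @ q) = ed w q"
    using assms by (simp add: ed_append mult.assoc[symmetric] gh_ed_self V_ed)
  show "gh u (p @ q) * ed u p = gh w q"
    using assms by (simp add: gh_append mult.assoc gh_ed_self gh_V)
qed

lemma gh_ed_incomparable:
  "\<lbrakk>awalk u p w; awalk u q z; \<not> prefix p q; \<not> prefix q p\<rbrakk> \<Longrightarrow> gh u p * ed u q = 0"
proof (induction p arbitrary: u q)
  case (Cons e p)
  then obtain e' q' where q: "q = e' # q'" by (cases q) auto
  have e: "e \<in> arcs E" "e' \<in> arcs E" "awalk (head E e) p w" "awalk (head E e') q' z"
    using Cons.prems q by (auto simp: awalk_simps)
  have eq: "gh u (e # p) * ed u q = gh (head E e) p * (Gh e * Ed e') * ed (head E e') q'"
    by (simp add: q mult.assoc)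
  show ?case
  proof (cases "e = e'")
    case True
    then have "gh (head E e) p * ed (head E e) q' = 0"
      using Cons.prems q e by (intro Cons.IH) auto
    then show ?thesis using eq e True by (simp add: Gh_Ed gh_V)
  qed (use eq e in \<open>simp add: Gh_Ed\<close>)
qed simp

definition monomials :: "'v set \<Rightarrow> 'r set" where
  "monomials Z = {ed u p * gh v q | u p v q w. awalk u p w \<and> awalk v q w \<and> w \<in> Z}"

lemma monomialsI: "awalk u p w \<Longrightarrow> awalk v q w \<Longrightarrow> w \<in> Z \<Longrightarrow> ed u p * gh v q \<in> monomials Z"
  unfolding monomials_def by blast

lemma monomials_mono: "Z \<subseteq> Z' \<Longrightarrow> monomials Z \<subseteq> monomials Z'"
  unfolding monomials_def by blast

text \<open>
  In \<open>\<alpha>\<beta>\<^sup>*\<gamma>\<delta>\<^sup>*\<close> the middle factor \<open>\<beta>\<^sup>*\<gamma>\<close> vanishes or is the rest of the longer path, real or ghost.  The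
  end of the resulting monomial is the end of the longer path, which can be reached from that of the
  shorter one.
\<close>

lemma monomials_mult:
  assumes Z: "hereditary E Z" "hereditary E Z'" and "m \<in> monomials Z" "n \<in> monomials Z'"
  shows "m * n \<in> insert 0 (monomials (Z \<inter> Z'))"
proof -
  obtain u p v q w where m: "m = ed u p * gh v q" "awalk u p w" "awalk v q w" "w \<in> Z"
    using assms(3) unfolding monomials_def by blast
  obtain v' q' u' p' w' where n: "n = ed v' q' * gh u' p'" "awalk v' q' w'" "awalk u' p' w'" "w' \<in> Z'"
    using assms(4) unfolding monomials_def by blast
  have mn: "m * n = ed u p * (gh v q * ed v' q') * gh u' p'" by (simp add: m n mult.assoc)
  consider "v \<noteq> v'" | "v = v'" "\<not> prefix q q'" "\<not> prefix q' q"
    | r where "v = v'" "q' = q @ r" | r where "v = v'" "q = q' @ r"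
    by (auto simp: prefix_def)
  then show ?thesis
  proof cases
    case 1
    then show ?thesis using mn gh_ed_start[OF m(3) n(2)] by simp
  next
    case 2
    then show ?thesis using mn gh_ed_incomparable[OF m(3)] n(2) by simp
  next
    case 3
    then have r: "awalk w r w'" using n(2) m(3) by auto
    then have "m * n = ed u (p @ r) * gh u' p'"
      using mn 3 gh_ed_prefix(1)[OF m(3) r] ed_append[OF m(2) r] by simp
    moreover have "w' \<in> Z" using Z(1) m(4) r unfolding hereditary_def by (meson reachable_awalk)
    ultimately show ?thesis using m(2) r n(3,4) by (auto intro!: monomialsI awalk_appendI)
  next
    case 4
    then have r: "awalk w' r w" using n(2) m(3) by auto
    then have "m * n = ed u p * gh u' (p' @ r)"
      using mn 4 gh_ed_prefix(2)[OF n(2) r] gh_append[OF n(3) r] by (simp add: mult.assoc)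
    moreover have "w \<in> Z'" using Z(2) n(4) r unfolding hereditary_def by (meson reachable_awalk)
    ultimately show ?thesis using m(2,4) r n(3) by (auto intro!: monomialsI awalk_appendI)
  qed
qed

text \<open>
  The subalgebra generated by the family.
\<close>

abbreviation R where "R \<equiv> lin_span (monomials (verts E))"

lemma hereditary_verts: "hereditary E (verts E)"
  by (auto simp: hereditary_def reachable_in_verts)

lemma subrng_R: "subrng R"
proof -
  have "x * y \<in> R" if "x \<in> R" "y \<in> R" for x y
    using that
  proof (rule lin_span_mult)
    fix a b assume "a \<in> monomials (verts E)" "b \<in> monomials (verts E)"
    from monomials_mult[OF hereditary_verts hereditary_verts this] show "a * b \<in> R"
      by (auto intro: lin_span_base lin_span_zero)
  qed
  then show ?thesis unfolding subrng_def by (auto intro: lin_span_zero lin_span_add lin_span_diff)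
qed

lemma ideal_in_span_monomials:
  assumes Z: "hereditary E Z"
  shows "ideal_in R (lin_span (monomials Z))"
proof -
  have sub: "Z \<subseteq> verts E" using Z by (simp add: hereditary_def)
  have eq: "Z \<inter> verts E = Z" "verts E \<inter> Z = Z" using sub by auto
  have "x * y \<in> lin_span (monomials Z)" if "x \<in> lin_span (monomials Z)" "y \<in> R" for x y
    using that
  proof (rule lin_span_mult)
    fix a b assume "a \<in> monomials Z" "b \<in> monomials (verts E)"
    from monomials_mult[OF Z hereditary_verts this] show "a * b \<in> lin_span (monomials Z)"
      by (auto simp: eq intro: lin_span_base lin_span_zero)
  qed
  moreover have "y * x \<in> lin_span (monomials Z)" if "x \<in> lin_span (monomials Z)" "y \<in> R" for x y
    using that(2,1)
  proof (rule lin_span_mult)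
    fix a b assume "a \<in> monomials (verts E)" "b \<in> monomials Z"
    from monomials_mult[OF hereditary_verts Z this] show "a * b \<in> lin_span (monomials Z)"
      by (auto simp: eq intro: lin_span_base lin_span_zero)
  qed
  moreover have "x \<in> R" if "x \<in> lin_span (monomials Z)" for x
    using lin_span_mono[OF that monomials_mono[OF sub]] .
  ultimately show ?thesis
    unfolding ideal_in_def by (auto intro: lin_span_zero lin_span_add lin_span_diff)
qed

lemma ed_in_monomials: "awalk u p w \<Longrightarrow> w \<in> Z \<Longrightarrow> ed u p \<in> monomials Z"
  using monomialsI[of u p w w "[]" Z] ed_V[of u p w] by (auto simp: awalk_Nil_iff awalk_last_in_verts)

lemma gh_in_monomials: "awalk u p w \<Longrightarrow> w \<in> Z \<Longrightarrow> gh u p \<in> monomials Z"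
  using monomialsI[of w "[]" w u p Z] V_gh[of u p w] by (auto simp: awalk_Nil_iff awalk_last_in_verts)

lemma V_in_monomials: "v \<in> verts E \<Longrightarrow> v \<in> Z \<Longrightarrow> V v \<in> monomials Z"
  using ed_in_monomials[of v "[]" v Z] by (simp add: awalk_Nil_iff)

lemma Ed_in_monomials: "e \<in> arcs E \<Longrightarrow> head E e \<in> Z \<Longrightarrow> Ed e \<in> monomials Z"
  using ed_in_monomials[of "tail E e" "[e]" "head E e" Z] by (simp add: awalk_simps Ed_V)

lemma Gh_in_monomials: "e \<in> arcs E \<Longrightarrow> head E e \<in> Z \<Longrightarrow> Gh e \<in> monomials Z"
  using gh_in_monomials[of "tail E e" "[e]" "head E e" Z] by (simp add: awalk_simps V_Gh)

lemma path_in_R: "awalk u p w \<Longrightarrow> ed u p \<in> R" "awalk u p w \<Longrightarrow> gh u p \<in> R"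
  by (auto intro!: lin_span_base ed_in_monomials gh_in_monomials dest: awalk_last_in_verts)

lemma gens_in_R: "v \<in> verts E \<Longrightarrow> V v \<in> R" "e \<in> arcs E \<Longrightarrow> Ed e \<in> R" "e \<in> arcs E \<Longrightarrow> Gh e \<in> R"
  by (auto intro!: lin_span_base V_in_monomials Ed_in_monomials Gh_in_monomials)

text \<open>
  A sum of finitely many vertices fixes all monomials that start in them.
\<close>

lemma local_left_unit:
  assumes "x \<in> R"
  shows "\<exists>\<epsilon>\<in>R. \<epsilon> * x = x"
proof -
  have "\<exists>U. finite U \<and> U \<subseteq> verts E \<and>
      (\<forall>U'. finite U' \<and> U \<subseteq> U' \<and> U' \<subseteq> verts E \<longrightarrow> (\<Sum>u\<in>U'. V u) * x = x)"
    using assms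
  proof (induction rule: lin_span.induct)
    case lin_span_zero
    then show ?case by auto
  next
    case (lin_span_step b x c)
    from lin_span_step(3) obtain U where U: "finite U" "U \<subseteq> verts E"
      "\<forall>U'. finite U' \<and> U \<subseteq> U' \<and> U' \<subseteq> verts E \<longrightarrow> (\<Sum>u\<in>U'. V u) * x = x" by blast
    obtain u p v q w where b: "b = ed u p * gh v q" "awalk u p w"
      using lin_span_step(1) unfolding monomials_def by blast
    note u = awalk_hd_in_verts[OF b(2)]
    have "(\<Sum>u'\<in>U'. V u') * b = b" if "finite U'" "u \<in> U'" "U' \<subseteq> verts E" for U'
    proof -
      have "(\<Sum>u'\<in>U'. V u') * V u = (\<Sum>u'\<in>U'. if u' = u then V u else 0)"
        unfolding sum_distrib_right using that u by (intro sum.cong) (auto simp: V_mult)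
      then have *: "(\<Sum>u'\<in>U'. V u') * V u = V u" using that by simp
      have Vb: "V u * b = b" using V_ed[OF b(2)] by (simp add: b(1) mult.assoc[symmetric])
      have "(\<Sum>u'\<in>U'. V u') * b = (\<Sum>u'\<in>U'. V u') * V u * b"
        by (simp add: mult.assoc Vb)
      then show ?thesis by (simp only: * Vb)
    qed
    then show ?case
      using U u by (intro exI[of _ "insert u U"]) (auto simp: distrib_left \<kappa>_left_commute)
  qed
  then obtain U where "finite U" "U \<subseteq> verts E"
    "\<forall>U'. finite U' \<and> U \<subseteq> U' \<and> U' \<subseteq> verts E \<longrightarrow> (\<Sum>u\<in>U'. V u) * x = x" by blast
  then have U: "U \<subseteq> verts E" "(\<Sum>u\<in>U. V u) * x = x" by simp_all
  then show ?thesis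
    by (intro bexI[of _ "\<Sum>u\<in>U. V u"] lin_span_sum gens_in_R) auto
qed

end

section \<open>Maximal paths and ideals spanned by monomials\<close>

lemma distinct_representatives:
  assumes "finite \<Gamma>" "\<And>\<gamma>. \<gamma> \<in> \<Gamma> \<Longrightarrow> infinite (A \<gamma>)" "finite S"
  shows "\<exists>w. inj_on w \<Gamma> \<and> (\<forall>\<gamma>\<in>\<Gamma>. w \<gamma> \<in> A \<gamma> - S)"
  using assms(1,2)
proof (induction \<Gamma> rule: finite_induct)
  case (insert \<gamma> \<Gamma>)
  then obtain w where w: "inj_on w \<Gamma>" "\<forall>\<gamma>\<in>\<Gamma>. w \<gamma> \<in> A \<gamma> - S" by auto
  have "infinite (A \<gamma> - (S \<union> w ` \<Gamma>))"
    using insert assms(3) by (intro Diff_infinite_finite) auto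
  then have "A \<gamma> - (S \<union> w ` \<Gamma>) \<noteq> {}" by (rule infinite_imp_nonempty)
  then obtain x where "x \<in> A \<gamma> - (S \<union> w ` \<Gamma>)" by (meson ex_in_conv)
  then show ?case using w insert(2)
    by (intro exI[of _ "w(\<gamma> := x)"]) (auto simp: inj_on_def)
qed simp

context wf_digraph
begin

definition paths_through :: "'a set \<Rightarrow> 'a \<Rightarrow> 'b list set" where
  "paths_through W u = {p. \<exists>w. awalk u p w \<and> (\<forall>e\<in>set p. tail G e \<in> W)}"

text \<open>
  The paths from \<open>u\<close> that stop as soon as they leave \<open>W\<close>.
\<close>

definition maximal_paths :: "'a set \<Rightarrow> 'a \<Rightarrow> 'b list set" where
  "maximal_paths W u = {p. \<exists>w. awalk u p w \<and> w \<notin> W \<and> (\<forall>e\<in>set p. tail G e \<in> W)}"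

lemma distinct_tails:
  assumes "\<And>v. v \<in> W \<Longrightarrow> \<not> v \<rightarrow>\<^sup>+ v" "awalk u p w" "\<forall>e\<in>set p. tail G e \<in> W"
  shows "distinct (map (tail G) p)"
  using assms(2,3)
proof (induction p arbitrary: u)
  case (Cons e p)
  then have e: "e \<in> arcs G" "awalk (head G e) p w" by (auto simp: awalk_simps)
  have "tail G e \<noteq> tail G e'" if "e' \<in> set p" for e'
  proof
    assume eq: "tail G e = tail G e'"
    have "tail G e' \<in> set (awalk_verts (head G e) p)" using that by (rule awalk_verts_arc1)
    from awalk_decomp[OF e(2) this] obtain q where "awalk (head G e) q (tail G e')" by blast
    then have "awalk (tail G e) (e # q) (tail G e)" using e(1) eq by (simp add: awalk_simps)
    then have "tail G e \<rightarrow>\<^sup>+ tail G e" unfolding reachable1_awalk by blast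
    then show False using assms(1) Cons.prems by auto
  qed
  then show ?case using Cons e by auto
qed simp

text \<open>
  A path cannot return to a vertex that lies on no closed path.
\<close>

lemma length_paths_through:
  assumes "finite W" "\<And>v. v \<in> W \<Longrightarrow> \<not> v \<rightarrow>\<^sup>+ v" "p \<in> paths_through W u"
  shows "length p \<le> card W"
proof -
  have "distinct (map (tail G) p)" "set (map (tail G) p) \<subseteq> W"
    using assms(3) distinct_tails[OF assms(2)] by (auto simp: paths_through_def)
  then show ?thesis using card_mono[OF assms(1)] distinct_card by (metis length_map)
qed

lemma maximal_paths_prefix:
  assumes "p \<in> maximal_paths W u" "q \<in> maximal_paths W u" "prefix p q"
  shows "p = q"
proof -
  obtain r where r: "q = p @ r" using assms(3) by (auto simp: prefix_def)
  obtain w where w: "awalk u p w" "w \<notin> W" using assms(1) by (auto simp: maximal_paths_def)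
  obtain z where z: "awalk u q z" "\<forall>e\<in>set q. tail G e \<in> W" using assms(2) by (auto simp: maximal_paths_def)
  have "awalk w r z" using z(1) w(1) r by auto
  then show ?thesis using w(2) z(2) r by (cases r) (auto simp: awalk_simps)
qed

lemma maximal_paths_outside: "u \<in> verts G \<Longrightarrow> u \<notin> W \<Longrightarrow> maximal_paths W u = {[]}"
proof -
  assume u: "u \<in> verts G" "u \<notin> W"
  have "p = []" if "p \<in> maximal_paths W u" for p
    using that u by (cases p) (auto simp: maximal_paths_def awalk_simps)
  moreover have "[] \<in> maximal_paths W u" using u by (auto simp: maximal_paths_def awalk_simps)
  ultimately show ?thesis by blast
qed

lemma maximal_paths_inside:
  assumes "u \<in> W"
  shows "maximal_paths W u = (\<lambda>(e, p). e # p) ` (SIGMA e:out_arcs G u. maximal_paths W (head G e))"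
proof
  show "maximal_paths W u \<subseteq> (\<lambda>(e, p). e # p) ` (SIGMA e:out_arcs G u. maximal_paths W (head G e))"
  proof
    fix p assume p: "p \<in> maximal_paths W u"
    then obtain e q where eq: "p = e # q" using assms
      by (cases p) (auto simp: maximal_paths_def awalk_simps)
    then have "(e, q) \<in> (SIGMA e:out_arcs G u. maximal_paths W (head G e))"
      using p by (auto simp: maximal_paths_def awalk_simps)
    then show "p \<in> (\<lambda>(e, p). e # p) ` (SIGMA e:out_arcs G u. maximal_paths W (head G e))"
      using eq by force
  qed
qed (use assms in \<open>auto simp: maximal_paths_def awalk_simps\<close>)

end

lemma (in row_finite_graph) finite_maximal_paths:
  assumes "finite W" "W \<subseteq> verts E" "\<And>v. v \<in> W \<Longrightarrow> \<not> v \<rightarrow>\<^sup>+ v"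
  shows "finite (maximal_paths W u)"
proof (rule finite_subset)
  have sub: "maximal_paths W u \<subseteq> paths_through W u"
    by (auto simp: maximal_paths_def paths_through_def)
  show "maximal_paths W u \<subseteq> {p. set p \<subseteq> (\<Union>v\<in>W. out_arcs E v) \<and> length p \<le> card W}"
  proof
    fix p assume p: "p \<in> maximal_paths W u"
    then obtain w where "awalk u p w" "\<forall>e\<in>set p. tail E e \<in> W" by (auto simp: maximal_paths_def)
    then have "set p \<subseteq> (\<Union>v\<in>W. out_arcs E v)" by (auto simp: awalk_def)
    then show "p \<in> {p. set p \<subseteq> (\<Union>v\<in>W. out_arcs E v) \<and> length p \<le> card W}"
      using p sub length_paths_through[OF assms(1,3)] by auto
  qed
  show "finite {p. set p \<subseteq> (\<Union>v\<in>W. out_arcs E v) \<and> length p \<le> card W}"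
    using assms row_finite by (intro finite_lists_length_le) auto
qed

context leavitt_family
begin

text \<open>
  Repeated use of \<open>v = \<Sum>ee\<^sup>*\<close> at the vertices of \<open>W\<close>.  The process ends since the lengths of the paths
  through \<open>W\<close> are bounded.
\<close>

lemma V_eq_sum_maximal_paths:
  assumes W: "finite W" "W \<subseteq> verts E" "\<And>v. v \<in> W \<Longrightarrow> \<not> v \<rightarrow>\<^sup>+ v" "\<And>v. v \<in> W \<Longrightarrow> out_arcs E v \<noteq> {}"
    and u: "u \<in> verts E"
  shows "V u = (\<Sum>p\<in>maximal_paths W u. ed u p * gh u p)"
proof -
  have "V u = (\<Sum>p\<in>maximal_paths W u. ed u p * gh u p)"
    if "\<forall>p\<in>paths_through W u. length p \<le> n" "u \<in> verts E" for n u
    using that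
  proof (induction n arbitrary: u)
    case (0 u)
    have "u \<notin> W"
    proof
      assume "u \<in> W"
      then obtain e where "e \<in> out_arcs E u" using W(4) by blast
      then have "[e] \<in> paths_through W u" using \<open>u \<in> W\<close> by (auto simp: paths_through_def awalk_simps)
      then show False using 0 by auto
    qed
    then show ?case using 0 by (simp add: maximal_paths_outside V_idem)
  next
    case (Suc n u)
    show ?case
    proof (cases "u \<in> W")
      case False
      then show ?thesis using Suc by (simp add: maximal_paths_outside V_idem)
    next
      case True
      have inj: "inj_on (\<lambda>(e, p). e # p) A" for A :: "('e \<times> 'e list) set" by (auto simp: inj_on_def)
      have "V (head E e) = (\<Sum>p\<in>maximal_paths W (head E e). ed (head E e) p * gh (head E e) p)"
        if e: "e \<in> out_arcs E u" for e
      proof (rule Suc.IH)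
        show "\<forall>p\<in>paths_through W (head E e). length p \<le> n"
        proof
          fix p assume "p \<in> paths_through W (head E e)"
          then have "e # p \<in> paths_through W u" using e True by (auto simp: paths_through_def awalk_simps)
          then show "length p \<le> n" using Suc.prems(1) by auto
        qed
      qed (use e in auto)
      moreover have "V u = (\<Sum>e\<in>out_arcs E u. Ed e * V (head E e) * Gh e)"
        using True W(4) Suc.prems(2) by (simp add: V_sum Ed_V)
      ultimately have "V u = (\<Sum>e\<in>out_arcs E u. \<Sum>p\<in>maximal_paths W (head E e).
          ed u (e # p) * gh u (e # p))"
        by (simp add: sum_distrib_left sum_distrib_right mult.assoc)
      also have "\<dots> = (\<Sum>p\<in>maximal_paths W u. ed u p * gh u p)"
        unfolding maximal_paths_inside[OF True] sum.reindex[OF inj]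
        using row_finite[OF Suc.prems(2)] finite_maximal_paths[OF W(1-3)]
        by (subst sum.Sigma) (auto simp: split_beta)
      finally show ?thesis .
    qed
  qed
  then show ?thesis using length_paths_through[OF W(1,3)] u by blast
qed

lemma path_in_ideal:
  assumes I: "ideal_in R I" and p: "awalk u p w" "e \<in> set p" "V (tail E e) \<in> I"
  shows "ed u p \<in> I" "gh u p \<in> I"
proof -
  obtain q r where qr: "p = q @ e # r" using p(2) by (meson split_list)
  then have a: "awalk u q (tail E e)" "awalk (tail E e) (e # r) w"
    using p(1) by (auto simp: awalk_simps)
  have "ed u p = ed u q * V (tail E e) * ed (tail E e) (e # r)"
    using a by (simp add: qr ed_append ed_V del: ed.simps)
  then show "ed u p \<in> I"
    using ideal_inD(6)[OF I ideal_inD(5)[OF I p(3)]] path_in_R a by metis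
  have "gh u p = gh (tail E e) (e # r) * V (tail E e) * gh u q"
    using a by (simp add: qr gh_append gh_V del: gh.simps)
  then show "gh u p \<in> I"
    using ideal_inD(6)[OF I ideal_inD(5)[OF I p(3)]] path_in_R a by metis
qed

text \<open>
  Monomials are referred to by their pairs of paths, since different pairs might give equal elements.
\<close>

definition monomial_of :: "'v \<times> 'e list \<times> 'v \<times> 'e list \<Rightarrow> 'r" where
  "monomial_of = (\<lambda>(u, p, v, q). ed u p * gh v q)"

definition monomial_indices :: "'v set \<Rightarrow> ('v \<times> 'e list \<times> 'v \<times> 'e list) set" where
  "monomial_indices Z = {(u, p, v, q). \<exists>w\<in>Z. awalk u p w \<and> awalk v q w}"

lemma monomials_eq: "monomials Z = monomial_of ` monomial_indices Z"
proof (intro equalityI subsetI)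
  fix x assume "x \<in> monomials Z"
  then obtain u p v q w where "x = ed u p * gh v q" "awalk u p w" "awalk v q w" "w \<in> Z"
    unfolding monomials_def by blast
  then have "x = monomial_of (u, p, v, q)" "(u, p, v, q) \<in> monomial_indices Z"
    by (auto simp: monomial_of_def monomial_indices_def)
  then show "x \<in> monomial_of ` monomial_indices Z" by blast
next
  fix x assume "x \<in> monomial_of ` monomial_indices Z"
  then obtain u p v q where "x = monomial_of (u, p, v, q)" "(u, p, v, q) \<in> monomial_indices Z" by force
  then obtain w where "x = ed u p * gh v q" "awalk u p w" "awalk v q w" "w \<in> Z"
    unfolding monomial_of_def monomial_indices_def by auto
  then show "x \<in> monomials Z" by (auto intro: monomialsI)
qed

lemma finite_monomial_indices:
  assumes "finite F" "F \<subseteq> lin_span (monomials Z)"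
  shows "\<exists>X. finite X \<and> X \<subseteq> monomial_indices Z \<and> F \<subseteq> lin_span (monomial_of ` X)"
  using assms
proof (induction F rule: finite_induct)
  case (insert f F)
  then obtain X where X: "finite X" "X \<subseteq> monomial_indices Z" "F \<subseteq> lin_span (monomial_of ` X)" by auto
  obtain T where T: "finite T" "T \<subseteq> monomial_of ` monomial_indices Z" "f \<in> lin_span T"
    using lin_span_finite[of f "monomials Z"] insert by (auto simp: monomials_eq)
  then obtain Y where "finite Y" "Y \<subseteq> monomial_indices Z" "T = monomial_of ` Y"
    by (meson finite_subset_image)
  then show ?case using X T
    by (intro exI[of _ "X \<union> Y"]) (auto simp: image_Un intro: lin_span_mono)
qed auto

text \<open>
  Let \<open>\<Gamma>\<close> be the finite set of paths \<open>\<alpha>\<close> in the monomials \<open>\<alpha>\<beta>\<^sup>*\<close> of \<open>f\<close> and \<open>g\<close>, and \<open>\<Delta>\<close> its subset of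
  paths without a proper prefix in \<open>\<Gamma>\<close>.  Then \<open>q = \<Sum>\<gamma>\<gamma>\<^sup>*\<close>, with \<open>\<gamma> \<in> \<Delta>\<close>, fixes all of \<open>\<Gamma>\<close>.  Since the ends
  have infinitely many ancestors, there are paths to them from distinct vertices that are not the
  source of any path in \<open>\<Gamma>\<close>.  Paths with different sources are orthogonal, and this gives all
  required identities for \<open>s = \<Sum>\<sigma>\<^sub>\<gamma>\<gamma>\<^sup>*\<close> and \<open>s' = \<Sum>\<gamma>\<sigma>\<^sub>\<gamma>\<^sup>*\<close>.
\<close>

lemma absorbing_span_monomials:
  assumes Z: "hereditary E Z" and inf: "\<And>z. z \<in> Z \<Longrightarrow> infinite {w. w \<rightarrow>\<^sup>* z}"
  shows "absorbing R (lin_span (monomials Z))"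
  unfolding absorbing_def
proof (intro ballI)
  fix f g assume fg: "f \<in> lin_span (monomials Z)" "g \<in> lin_span (monomials Z)"
  then obtain X where X: "finite X" "X \<subseteq> monomial_indices Z" "f \<in> lin_span (monomial_of ` X)" "g \<in> lin_span (monomial_of ` X)"
    using finite_monomial_indices[of "{f, g}" Z] by auto
  define \<Gamma> where "\<Gamma> = (\<lambda>(u, p, v, q). (u, p)) ` X"
  define \<Delta> where "\<Delta> = {(u, p) \<in> \<Gamma>. \<forall>p'. (u, p') \<in> \<Gamma> \<and> prefix p' p \<longrightarrow> p' = p}"
  have fin: "finite \<Gamma>" "finite \<Delta>"
  proof -
    show "finite \<Gamma>" using X(1) by (simp add: \<Gamma>_def)
    then show "finite \<Delta>" by (rule finite_subset[rotated]) (auto simp: \<Delta>_def)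
  qed
  define en where "en = (\<lambda>(u, p). awlast u p)"
  have \<Gamma>: "awalk u p (en (u, p)) \<and> en (u, p) \<in> Z" if "(u, p) \<in> \<Gamma>" for u p
    using that X(2) by (auto simp: \<Gamma>_def monomial_indices_def en_def)
  have ex_prefix: "\<exists>p'. (u, p') \<in> \<Delta> \<and> prefix p' p" if "(u, p) \<in> \<Gamma>" for u p
    using that
  proof (induction "length p" arbitrary: p rule: less_induct)
    case less
    show ?case
    proof (cases "(u, p) \<in> \<Delta>")
      case False
      then obtain p' where p': "(u, p') \<in> \<Gamma>" "prefix p' p" "p' \<noteq> p" using less.prems by (auto simp: \<Delta>_def)
      then have "length p' < length p" by (metis prefix_length_less prefix_order.le_neq_trans strict_prefixI)
      then show ?thesis using less.hyps p' prefix_order.trans by blast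
    qed auto
  qed
  obtain s0 where s0: "inj_on s0 \<Delta>" "\<And>\<gamma>. \<gamma> \<in> \<Delta> \<Longrightarrow> s0 \<gamma> \<in> {w. w \<rightarrow>\<^sup>* en \<gamma>} - fst ` \<Gamma>"
  proof -
    have "infinite {w. w \<rightarrow>\<^sup>* en \<gamma>}" if "\<gamma> \<in> \<Delta>" for \<gamma>
      using that \<Gamma> by (intro inf) (auto simp: \<Delta>_def)
    then show ?thesis
      using distinct_representatives[OF fin(2), of "\<lambda>\<gamma>. {w. w \<rightarrow>\<^sup>* en \<gamma>}" "fst ` \<Gamma>"] fin(1) that by blast
  qed
  have "\<forall>\<gamma>\<in>\<Delta>. \<exists>t. awalk (s0 \<gamma>) t (en \<gamma>)"
    using s0(2) by (auto simp: reachable_awalk)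
  then obtain t where t: "\<And>\<gamma>. \<gamma> \<in> \<Delta> \<Longrightarrow> awalk (s0 \<gamma>) (t \<gamma>) (en \<gamma>)" by metis
  \<comment> \<open>The paths \<open>\<gamma>\<close>, \<open>\<gamma>\<^sup>*\<close>, \<open>\<sigma>\<^sub>\<gamma>\<close> and \<open>\<sigma>\<^sub>\<gamma>\<^sup>*\<close> as elements of the algebra.\<close>
  define a a' b b' where "a = (\<lambda>\<gamma>. ed (fst \<gamma>) (snd \<gamma>))" and "a' = (\<lambda>\<gamma>. gh (fst \<gamma>) (snd \<gamma>))"
    and "b = (\<lambda>\<gamma>. ed (s0 \<gamma>) (t \<gamma>))" and "b' = (\<lambda>\<gamma>. gh (s0 \<gamma>) (t \<gamma>))"
  have \<Delta>: "awalk (fst \<gamma>) (snd \<gamma>) (en \<gamma>)" if "\<gamma> \<in> \<Delta>" for \<gamma>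
    using that \<Gamma> by (auto simp: \<Delta>_def)
  have a'a: "a' \<gamma> * a \<delta> = (if \<gamma> = \<delta> then V (en \<gamma>) else 0)" if "\<gamma> \<in> \<Delta>" "\<delta> \<in> \<Delta>" for \<gamma> \<delta>
  proof (cases "\<gamma> = \<delta>")
    case True
    then show ?thesis using gh_ed_self[OF \<Delta>[OF that(1)]] by (simp add: a_def a'_def)
  next
    case False
    show ?thesis
    proof (cases "fst \<gamma> = fst \<delta>")
      case True
      then have "\<not> prefix (snd \<gamma>) (snd \<delta>)" "\<not> prefix (snd \<delta>) (snd \<gamma>)"
        using that False by (auto simp: \<Delta>_def)
      then show ?thesis
        using gh_ed_incomparable[OF \<Delta>[OF that(1)]] \<Delta>[OF that(2)] True False by (auto simp: a_def a'_def)
    next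
      case neq: False
      then show ?thesis using gh_ed_start[OF \<Delta>[OF that(1)] \<Delta>[OF that(2)]] False by (simp add: a_def a'_def)
    qed
  qed
  have b'b: "b' \<gamma> * b \<delta> = (if \<gamma> = \<delta> then V (en \<gamma>) else 0)" if "\<gamma> \<in> \<Delta>" "\<delta> \<in> \<Delta>" for \<gamma> \<delta>
  proof (cases "\<gamma> = \<delta>")
    case False
    then have "s0 \<gamma> \<noteq> s0 \<delta>" using s0(1) that by (auto dest: inj_onD)
    then show ?thesis using gh_ed_start[OF t[OF that(1)] t[OF that(2)]] False by (simp add: b_def b'_def)
  qed (use gh_ed_self[OF t[OF that(1)]] in \<open>simp add: b_def b'_def\<close>)
  have ne: "fst \<gamma> \<noteq> s0 \<delta>" if "\<gamma> \<in> \<Delta>" "\<delta> \<in> \<Delta>" for \<gamma> \<delta>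
    using s0(2)[OF that(2)] that(1) by (auto simp: \<Delta>_def image_iff)
  have a'b: "a' \<gamma> * b \<delta> = 0" and b'a: "b' \<delta> * a \<gamma> = 0" if "\<gamma> \<in> \<Delta>" "\<delta> \<in> \<Delta>" for \<gamma> \<delta>
    using gh_ed_start[OF \<Delta>[OF that(1)] t[OF that(2)]] gh_ed_start[OF t[OF that(2)] \<Delta>[OF that(1)]] ne[OF that]
    by (auto simp: a_def a'_def b_def b'_def)
  have sums: "(\<Sum>\<gamma>\<in>\<Delta>. x \<gamma> * y \<gamma>) * (\<Sum>\<gamma>\<in>\<Delta>. x' \<gamma> * y' \<gamma>) =
      (\<Sum>\<gamma>\<in>\<Delta>. \<Sum>\<delta>\<in>\<Delta>. x \<gamma> * (y \<gamma> * x' \<delta>) * y' \<delta>)" for x y x' y' :: "_ \<Rightarrow> 'r"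
    by (simp add: sum_product mult.assoc)
  define q where "q = (\<Sum>\<gamma>\<in>\<Delta>. a \<gamma> * a' \<gamma>)"
  define s where "s = (\<Sum>\<gamma>\<in>\<Delta>. b \<gamma> * a' \<gamma>)"
  define s' where "s' = (\<Sum>\<gamma>\<in>\<Delta>. a \<gamma> * b' \<gamma>)"
  have qs: "q * s = 0" and s'q: "s' * q = 0"
    unfolding q_def s_def s'_def sums by (simp_all add: a'b b'a)
  have "s' * s = (\<Sum>\<gamma>\<in>\<Delta>. \<Sum>\<delta>\<in>\<Delta>. if \<delta> = \<gamma> then a \<gamma> * V (en \<gamma>) * a' \<gamma> else 0)"
    unfolding s_def s'_def sums by (intro sum.cong refl) (auto simp: b'b)
  also have "\<dots> = (\<Sum>\<gamma>\<in>\<Delta>. a \<gamma> * V (en \<gamma>) * a' \<gamma>)" using fin by simp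
  also have "\<dots> = q" unfolding q_def using ed_V[OF \<Delta>] by (intro sum.cong refl) (simp add: a_def)
  finally have s's: "s' * s = q" .
  have qa: "q * a \<delta> = a \<delta>" if "\<delta> \<in> \<Delta>" for \<delta>
  proof -
    have "q * a \<delta> = (\<Sum>\<gamma>\<in>\<Delta>. if \<gamma> = \<delta> then a \<delta> * V (en \<delta>) else 0)"
      unfolding q_def sum_distrib_right mult.assoc by (intro sum.cong refl) (auto simp: a'a that)
    then show ?thesis using fin that ed_V[OF \<Delta>[OF that]] by (simp add: a_def)
  qed
  have qm: "q * m = m" if "m \<in> monomial_of ` X" for m
  proof -
    obtain u p v r where m: "(u, p, v, r) \<in> X" "m = ed u p * gh v r" using \<open>m \<in> monomial_of ` X\<close> by (auto simp: monomial_of_def)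
    then have "(u, p) \<in> \<Gamma>" by (force simp: \<Gamma>_def)
    then obtain p' r' where p': "(u, p') \<in> \<Delta>" "p = p' @ r'" using ex_prefix[of u p] by (auto simp: prefix_def)
    have "awalk (en (u, p')) r' (en (u, p))"
      using \<Gamma>[OF \<open>(u, p) \<in> \<Gamma>\<close>] p'(2) by (auto simp: en_def)
    then have "ed u p = a (u, p') * ed (en (u, p')) r'"
      using \<Delta>[OF p'(1)] p'(2) ed_append by (auto simp: a_def)
    then have "q * ed u p = ed u p" using qa[OF p'(1)] by (simp add: mult.assoc[symmetric])
    then show ?thesis by (simp add: m(2) mult.assoc[symmetric])
  qed
  have qx: "q * x = x" if "x \<in> lin_span (monomial_of ` X)" for x
    using that by (induction rule: lin_span.induct) (auto simp: distrib_left \<kappa>_left_commute qm)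
  have aR: "a \<gamma> \<in> R" "a' \<gamma> \<in> R" "b \<gamma> \<in> R" "b' \<gamma> \<in> R" if "\<gamma> \<in> \<Delta>" for \<gamma>
    using path_in_R[OF \<Delta>[OF that]] path_in_R[OF t[OF that]] by (auto simp: a_def a'_def b_def b'_def)
  have "q \<in> R" "s \<in> R" "s' \<in> R"
    unfolding q_def s_def s'_def using aR by (auto intro!: lin_span_sum subrngD(4)[OF subrng_R])
  moreover have "s' * f = 0" using s'q qx[OF X(3)] by (metis mult.assoc mult_zero_left)
  ultimately show "\<exists>q\<in>R. \<exists>s\<in>R. \<exists>s'\<in>R. q * f = f \<and> q * s = 0 \<and> s' * f = 0 \<and> s' * s * g = g"
    using qx X qs s's by auto
qed

text \<open>
  Let \<open>W\<close> be the finite set of sources of the edges that occur in the given elements, except those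
  that lie in the ideal as elements.  No vertex of \<open>W\<close> is on a closed path, so the maximal paths
  through \<open>W\<close> are finite in number.  Any two of them with the same source are incomparable, hence they
  give matrix units, with one block for each end.  A monomial either passes through a vertex of the
  ideal or is a sum of products \<open>\<alpha>\<beta>\<^sup>*\<close> of such maximal paths, by expanding its end.  Paths whose end lies in the ideal are
  left out, which makes the matrix units independent modulo the ideal.
\<close>

lemma stable_rank_one_modulo_span_monomials:
  assumes Z: "hereditary E Z" and cyc: "\<And>u. u \<rightarrow>\<^sup>+ u \<Longrightarrow> u \<in> Z"
  shows "stable_rank_one_modulo R (lin_span (monomials Z))"
  unfolding stable_rank_one_modulo_def
proof (intro allI impI, elim conjE)
  let ?I = "lin_span (monomials Z)"
  fix a b c assume abc: "a - 1 \<in> R" "b - 1 \<in> R" "c \<in> R" "a * b + c - 1 \<in> ?I"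
  note I = ideal_in_span_monomials[OF Z]
  obtain X where X: "finite X" "X \<subseteq> monomial_indices (verts E)"
    "a - 1 \<in> lin_span (monomial_of ` X)" "b - 1 \<in> lin_span (monomial_of ` X)" "c \<in> lin_span (monomial_of ` X)"
    using finite_monomial_indices[of "{a - 1, b - 1, c}" "verts E"] abc(1-3) by auto
  define edges where "edges = (\<Union>(u, p, v, q)\<in>X. set p \<union> set q)"
  define W where "W = {x \<in> tail E ` edges. V x \<notin> ?I}"
  define U where "U = (\<Union>(u, p, v, q)\<in>X. {u, v})"
  have fin: "finite edges" "finite U" using X(1) by (auto simp: edges_def U_def)
  then have "finite W" unfolding W_def by simp
  have edges: "edges \<subseteq> arcs E"
  proof
    fix e assume "e \<in> edges"
    then obtain u p v q where t: "(u, p, v, q) \<in> X" "e \<in> set p \<union> set q" by (auto simp: edges_def)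
    then obtain w where "awalk u p w" "awalk v q w" using X(2) unfolding monomial_indices_def by blast
    then show "e \<in> arcs E" using t(2) by (auto simp: awalk_def)
  qed
  have W: "W \<subseteq> verts E" "\<And>v. v \<in> W \<Longrightarrow> out_arcs E v \<noteq> {}"
    using edges by (auto simp: W_def out_arcs_def)
  have Wc: "\<not> v \<rightarrow>\<^sup>+ v" if "v \<in> W" for v
  proof
    assume "v \<rightarrow>\<^sup>+ v"
    then have "v \<in> Z" by (rule cyc)
    then have "V v \<in> ?I" using that W(1) by (auto intro: lin_span_base V_in_monomials)
    then show False using that by (simp add: W_def)
  qed
  define P where "P = {(u, p). u \<in> U \<and> p \<in> maximal_paths W u \<and> V (awlast u p) \<notin> ?I}"
  define block where "block = (\<lambda>(u, p). awlast u p)"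
  define EE where "EE = (\<lambda>(u, p) (v, q). ed u p * gh v q)"
  have P: "awalk (fst \<alpha>) (snd \<alpha>) (block \<alpha>)" "V (block \<alpha>) \<notin> ?I" "snd \<alpha> \<in> maximal_paths W (fst \<alpha>)"
    if "\<alpha> \<in> P" for \<alpha>
    using that by (auto simp: P_def block_def maximal_paths_def)
  have gh_ed: "gh (fst \<alpha>) (snd \<alpha>) * ed (fst \<beta>) (snd \<beta>) = (if \<alpha> = \<beta> then V (block \<alpha>) else 0)"
    if "\<alpha> \<in> P" "\<beta> \<in> P" for \<alpha> \<beta>
  proof (cases "\<alpha> = \<beta>")
    case True
    then show ?thesis using gh_ed_self[OF P(1)[OF that(1)]] by simp
  next
    case False
    show ?thesis
    proof (cases "fst \<alpha> = fst \<beta>")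
      case True
      then have "\<not> prefix (snd \<alpha>) (snd \<beta>)" "\<not> prefix (snd \<beta>) (snd \<alpha>)"
        using P(3)[OF that(1)] P(3)[OF that(2)] maximal_paths_prefix False by (metis prod.expand)+
      then show ?thesis
        using gh_ed_incomparable[OF P(1)[OF that(1)]] P(1)[OF that(2)] True False by simp
    next
      case neq: False
      then show ?thesis using gh_ed_start[OF P(1)[OF that(1)] P(1)[OF that(2)]] False by simp
    qed
  qed
  have EE: "EE \<alpha> \<beta> = ed (fst \<alpha>) (snd \<alpha>) * gh (fst \<beta>) (snd \<beta>)" for \<alpha> \<beta>
    by (simp add: EE_def split_beta)
  interpret BM: block_matrix_units \<kappa> P block EE
  proof
    have "P \<subseteq> (SIGMA u:U. maximal_paths W u)" by (auto simp: P_def)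
    then show "finite P"
      using fin finite_maximal_paths[OF \<open>finite W\<close> W(1) Wc] by (meson finite_SigmaI finite_subset)
    fix \<alpha> \<beta> \<gamma> \<delta>
    assume P4: "\<alpha> \<in> P" "\<beta> \<in> P" "\<gamma> \<in> P" "\<delta> \<in> P" "block \<alpha> = block \<beta>" "block \<gamma> = block \<delta>"
    have "EE \<alpha> \<beta> * EE \<gamma> \<delta> = ed (fst \<alpha>) (snd \<alpha>) * (gh (fst \<beta>) (snd \<beta>) * ed (fst \<gamma>) (snd \<gamma>)) * gh (fst \<delta>) (snd \<delta>)"
      by (simp add: EE mult.assoc)
    also have "\<dots> = (if \<beta> = \<gamma> then ed (fst \<alpha>) (snd \<alpha>) * V (block \<alpha>) * gh (fst \<delta>) (snd \<delta>) else 0)"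
      using P4 by (simp add: gh_ed)
    finally show "EE \<alpha> \<beta> * EE \<gamma> \<delta> = (if \<beta> = \<gamma> then EE \<alpha> \<delta> else 0)"
      using ed_V[OF P(1)[OF P4(1)]] by (simp add: EE)
  qed
  \<comment> \<open>\<open>rep\<close> holds for the elements that are congruent to a matrix modulo the ideal.\<close>
  define rep where "rep x \<longleftrightarrow> (\<exists>M. x - BM.mat M \<in> ?I)" for x
  have rep_I: "rep x" if "x \<in> ?I" for x
    unfolding rep_def using that BM.mat_zero by (intro exI[of _ "\<lambda>_ _. 0"]) simp
  have rep_add: "rep (x + y)" if "rep x" "rep y" for x y
  proof -
    from that obtain M N where "x - BM.mat M \<in> ?I" "y - BM.mat N \<in> ?I" unfolding rep_def by blast
    then have "(x - BM.mat M) + (y - BM.mat N) \<in> ?I" by (rule lin_span_add)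
    then show ?thesis unfolding rep_def
      by (intro exI[of _ "\<lambda>\<alpha> \<beta>. M \<alpha> \<beta> + N \<alpha> \<beta>"]) (simp add: BM.mat_add[symmetric] algebra_simps)
  qed
  have rep_scale: "rep (\<kappa> k * x)" if "rep x" for k x
  proof -
    from that obtain M where "x - BM.mat M \<in> ?I" unfolding rep_def by blast
    then have "\<kappa> k * (x - BM.mat M) \<in> ?I" by (rule lin_span_scale)
    then show ?thesis unfolding rep_def
      by (intro exI[of _ "\<lambda>\<alpha> \<beta>. k * M \<alpha> \<beta>"]) (simp add: BM.mat_scale[symmetric] algebra_simps)
  qed
  have rep_sum: "rep (sum h S)" if "\<And>i. i \<in> S \<Longrightarrow> rep (h i)" for h :: "_ \<Rightarrow> 'r" and S
    using that by (induction S rule: infinite_finite_induct) (auto intro: rep_I lin_span_zero rep_add)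
  have rep_monomial: "rep (monomial_of t)" if "t \<in> X" for t
  proof -
    obtain u p v q where t: "t = (u, p, v, q)" by (cases t)
    have "(u, p, v, q) \<in> monomial_indices (verts E)" using that t X(2) by blast
    then obtain w where w: "awalk u p w" "awalk v q w" "w \<in> verts E" by (auto simp: monomial_indices_def)
    have uv: "u \<in> U" "v \<in> U" using that t by (auto simp: U_def)
    show ?thesis
    proof (cases "\<forall>e\<in>set p \<union> set q. tail E e \<in> W")
      case False
      then obtain e where e: "e \<in> set p \<union> set q" "tail E e \<notin> W" by blast
      moreover have "tail E e \<in> tail E ` edges" using e that t by (force simp: edges_def)
      ultimately have Ve: "V (tail E e) \<in> ?I" by (simp add: W_def)
      have "ed u p * gh v q \<in> ?I"
      proof (cases "e \<in> set p")
        case True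
        then show ?thesis using ideal_inD(6)[OF I path_in_ideal(1)[OF I w(1) _ Ve]] path_in_R[OF w(2)] by blast
      next
        case False
        then show ?thesis using e(1) ideal_inD(5)[OF I path_in_ideal(2)[OF I w(2) _ Ve]] path_in_R[OF w(1)] by blast
      qed
      then show ?thesis by (simp add: t monomial_of_def rep_I)
    next
      case True
      have Vw: "V w = (\<Sum>\<mu>\<in>maximal_paths W w. ed w \<mu> * gh w \<mu>)"
        using \<open>finite W\<close> W Wc w(3) by (intro V_eq_sum_maximal_paths)
      have "monomial_of t = ed u p * V w * gh v q" using ed_V[OF w(1)] by (simp add: t monomial_of_def)
      also have "\<dots> = (\<Sum>\<mu>\<in>maximal_paths W w. ed u (p @ \<mu>) * gh v (q @ \<mu>))"
        unfolding Vw sum_distrib_left sum_distrib_right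
      proof (intro sum.cong refl)
        fix \<mu> assume "\<mu> \<in> maximal_paths W w"
        then obtain z where "awalk w \<mu> z" by (auto simp: maximal_paths_def)
        then show "ed u p * (ed w \<mu> * gh w \<mu>) * gh v q = ed u (p @ \<mu>) * gh v (q @ \<mu>)"
          using w by (simp add: ed_append gh_append mult.assoc)
      qed
      finally have eq: "monomial_of t = (\<Sum>\<mu>\<in>maximal_paths W w. ed u (p @ \<mu>) * gh v (q @ \<mu>))" .
      have "rep (ed u (p @ \<mu>) * gh v (q @ \<mu>))" if \<mu>: "\<mu> \<in> maximal_paths W w" for \<mu>
      proof -
        obtain z where z: "awalk w \<mu> z" "z \<notin> W" "\<forall>e\<in>set \<mu>. tail E e \<in> W" using \<mu> by (auto simp: maximal_paths_def)
        have a: "awalk u (p @ \<mu>) z" "awalk v (q @ \<mu>) z" using w z(1) by (auto intro: awalk_appendI)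
        have m: "p @ \<mu> \<in> maximal_paths W u" "q @ \<mu> \<in> maximal_paths W v"
          using a z True unfolding maximal_paths_def by (auto simp del: awalk_append_iff)
        have la: "awlast u (p @ \<mu>) = z" "awlast v (q @ \<mu>) = z" using a awlast_of_awalk by auto
        show ?thesis
        proof (cases "V z \<in> ?I")
          case True
          have "ed u (p @ \<mu>) * gh v (q @ \<mu>) = ed u (p @ \<mu>) * V z * gh v (q @ \<mu>)" using ed_V[OF a(1)] by simp
          also have "\<dots> \<in> ?I"
            using ideal_inD(6)[OF I ideal_inD(5)[OF I True]] path_in_R[OF a(1)] path_in_R[OF a(2)] by blast
          finally show ?thesis by (rule rep_I)
        next
          case False
          then have inP: "(u, p @ \<mu>) \<in> P" "(v, q @ \<mu>) \<in> P"
            using uv m la by (auto simp: P_def)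
          have "block (u, p @ \<mu>) = z" "block (v, q @ \<mu>) = z" using la by (simp_all add: block_def)
          then have "(v, q @ \<mu>) \<in> BM.same_block (u, p @ \<mu>)" using inP by (simp add: BM.same_block_def)
          from BM.mat_single[OF inP(1) this, of 1]
          have "ed u (p @ \<mu>) * gh v (q @ \<mu>) = BM.mat (\<lambda>\<gamma> \<delta>. if \<gamma> = (u, p @ \<mu>) \<and> \<delta> = (v, q @ \<mu>) then 1 else 0)"
            by (simp add: EE \<kappa>_one)
          then show ?thesis unfolding rep_def using lin_span_zero by (metis diff_self)
        qed
      qed
      then show ?thesis unfolding eq by (rule rep_sum)
    qed
  qed
  have rep: "rep x" if "x \<in> lin_span (monomial_of ` X)" for x
    using that by (induction rule: lin_span.induct) (auto intro: rep_I lin_span_zero intro!: rep_add rep_scale rep_monomial)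
  obtain M1 M2 M3 where M: "a - 1 - BM.mat M1 \<in> ?I" "b - 1 - BM.mat M2 \<in> ?I" "c - BM.mat M3 \<in> ?I"
    using rep[OF X(3)] rep[OF X(4)] rep[OF X(5)] unfolding rep_def by blast
  show "\<exists>w\<in>R. \<exists>d. d - 1 \<in> R \<and> d * (b + w * c) - 1 \<in> ?I"
  proof (rule BM.matrix_stable_rank_one_modulo[OF subrng_R I _ _ _ _ abc M])
    fix \<alpha> \<beta> assume "\<alpha> \<in> P" "\<beta> \<in> BM.same_block \<alpha>"
    then show "EE \<alpha> \<beta> \<in> R"
      using path_in_R[OF P(1)] subrngD(4)[OF subrng_R] by (simp add: EE BM.same_block_P)
  next
    fix \<alpha> assume \<alpha>: "\<alpha> \<in> P"
    have "gh (fst \<alpha>) (snd \<alpha>) * EE \<alpha> \<alpha> * ed (fst \<alpha>) (snd \<alpha>) =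
        (gh (fst \<alpha>) (snd \<alpha>) * ed (fst \<alpha>) (snd \<alpha>)) * (gh (fst \<alpha>) (snd \<alpha>) * ed (fst \<alpha>) (snd \<alpha>))"
      by (simp add: EE mult.assoc)
    also have "\<dots> = V (block \<alpha>)"
      using gh_ed[OF \<alpha> \<alpha>] V_idem awalk_last_in_verts[OF P(1)[OF \<alpha>]] by simp
    finally show "EE \<alpha> \<alpha> \<notin> ?I"
      using P(2)[OF \<alpha>] ideal_inD(6)[OF I ideal_inD(5)[OF I]] path_in_R[OF P(1)[OF \<alpha>]] by metis
  qed (auto intro: lin_span_scale)
qed

end

section \<open>Closed paths and lower bounds for the stable rank\<close>

context wf_digraph
begin

text \<open>
  A closed path at \<open>u\<close> of minimal length does not return to \<open>u\<close> earlier.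
\<close>

lemma closed_simple_path_exists:
  assumes "u \<rightarrow>\<^sup>+ u"
  shows "\<exists>p. closed_simple_path G u p"
proof -
  define S where "S = {p. awalk u p u \<and> p \<noteq> []}"
  have "S \<noteq> {}" using assms unfolding S_def reachable1_awalk by blast
  then obtain p where p: "p \<in> S" "\<And>q. q \<in> S \<Longrightarrow> length p \<le> length q"
    using arg_min_natI[of "\<lambda>p. p \<in> S" _ length] arg_min_nat_le[of "\<lambda>p. p \<in> S" _ length] by blast
  have "tail G e \<noteq> u" if "e \<in> set (tl p)" for e
  proof
    assume eq: "tail G e = u"
    obtain e0 p0 where p0: "p = e0 # p0" using p(1) by (cases p) (auto simp: S_def)
    then have "e \<in> set p0" using that by simp
    then obtain q r where qr: "p0 = q @ e # r" by (meson split_list)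
    have "awalk u (e # r) u" using p(1) p0 qr eq by (auto simp: S_def awalk_simps)
    then have "length p \<le> length (e # r)" by (intro p(2)) (simp add: S_def)
    then show False by (simp add: p0 qr)
  qed
  then show ?thesis using p(1) by (auto simp: closed_simple_path_def S_def)
qed

text \<open>
  A proper prefix of a closed simple path never ends at its base.
\<close>

lemma two_closed_simple_paths:
  assumes "condition_K G" "u \<rightarrow>\<^sup>+ u"
  shows "\<exists>p q. closed_simple_path G u p \<and> closed_simple_path G u q \<and> \<not> prefix p q \<and> \<not> prefix q p"
proof -
  obtain p where p: "closed_simple_path G u p" using closed_simple_path_exists[OF assms(2)] by blast
  then have "u \<in> set (awalk_verts u p)" unfolding closed_simple_path_def by (blast intro: hd_in_awalk_verts)
  then obtain p q where pq: "closed_simple_path G u p" "closed_simple_path G u q" "p \<noteq> q"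
    using assms(1) p unfolding condition_K_def by blast
  have "\<not> prefix p q" if p: "closed_simple_path G u p" and q: "closed_simple_path G u q" and "p \<noteq> q" for p q
  proof
    assume "prefix p q"
    then obtain r0 where r0: "q = p @ r0" by (auto simp: prefix_def)
    then obtain e r where "r0 = e # r" using \<open>p \<noteq> q\<close> by (cases r0) auto
    then have r: "q = p @ e # r" using r0 by simp
    have "awlast u p = u" "p \<noteq> []" using p by (auto simp: closed_simple_path_def)
    then have "tail G e = u" "e \<in> set (tl q)" using q r by (auto simp: closed_simple_path_def awalk_simps)
    then show False using q by (simp add: closed_simple_path_def)
  qed
  then show ?thesis using pq by metis
qed

lemma acyclic_graph_iff: "acyclic_graph G \<longleftrightarrow> (\<forall>u. \<not> u \<rightarrow>\<^sup>+ u)"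
proof
  assume ac: "acyclic_graph G"
  show "\<forall>u. \<not> u \<rightarrow>\<^sup>+ u"
  proof (intro allI notI)
    fix u assume "u \<rightarrow>\<^sup>+ u"
    then obtain p where "closed_w p" unfolding reachable1_awalk closed_w_def by blast
    then show False using ac closed_w_imp_cycle unfolding acyclic_graph_def by blast
  qed
next
  assume "\<forall>u. \<not> u \<rightarrow>\<^sup>+ u"
  then show "acyclic_graph G" unfolding acyclic_graph_def reachable1_awalk cycle_def by blast
qed

lemma exists_closed_path:
  assumes fin: "finite (verts G)" and ne: "verts G \<noteq> {}" and ns: "\<not> (\<exists>v. sink G v)"
  shows "\<exists>u. u \<rightarrow>\<^sup>+ u"
proof (rule ccontr)
  assume "\<not> ?thesis"
  then have "acyclic (arcs_ends G)" by (simp add: acyclic_def)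
  moreover have "arcs_ends G \<subseteq> verts G \<times> verts G" by (auto simp: arcs_ends_conv)
  then have "finite (arcs_ends G)" using fin finite_subset by blast
  ultimately have "wf ((arcs_ends G)\<inverse>)" by (simp add: finite_acyclic_wf_converse)
  then obtain v where v: "v \<in> verts G" "\<And>w. (w, v) \<in> (arcs_ends G)\<inverse> \<Longrightarrow> w \<notin> verts G"
    using ne by (metis wfE_min all_not_in_conv)
  have "out_arcs G v = {}"
  proof (rule ccontr)
    assume "out_arcs G v \<noteq> {}"
    then obtain e where "e \<in> out_arcs G v" by blast
    then have e: "e \<in> arcs G" "tail G e = v" by auto
    then have "(v, head G e) \<in> arcs_ends G" by (auto simp: arcs_ends_conv)
    then show False using v(2)[of "head G e"] e by auto
  qed
  then show False using ns v(1) by (auto simp: sink_def)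
qed

lemma wf_digraph_quotient_graph:
  assumes "hereditary G H"
  shows "wf_digraph (quotient_graph G H)"
proof
  fix e assume e: "e \<in> arcs (quotient_graph G H)"
  then have e': "e \<in> arcs G" "head G e \<notin> H" by (auto simp: quotient_graph_def)
  then have "tail G e \<rightarrow>\<^sup>* head G e" by (auto intro!: reachable_adjI simp: arcs_ends_conv)
  then show "tail (quotient_graph G H) e \<in> verts (quotient_graph G H)"
    using assms e' by (auto simp: quotient_graph_def hereditary_def)
  show "head (quotient_graph G H) e \<in> verts (quotient_graph G H)"
    using e' by (auto simp: quotient_graph_def)
qed

lemma quotient_graph_reachable1: "u \<rightarrow>\<^sup>+\<^bsub>quotient_graph G H\<^esub> w \<Longrightarrow> u \<rightarrow>\<^sup>+ w"
  by (rule trancl_mono[of "(u, w)" "arcs_ends (quotient_graph G H)"])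
     (auto simp: arcs_ends_conv quotient_graph_def)

lemma quotient_graph_reachable: "u \<rightarrow>\<^sup>*\<^bsub>quotient_graph G H\<^esub> w \<Longrightarrow> u \<rightarrow>\<^sup>* w"
  unfolding reachable_def
proof (induction rule: rtrancl_on.induct)
  case (rtrancl_on_refl a)
  then show ?case by (auto simp: quotient_graph_def)
next
  case (rtrancl_on_into_rtrancl_on a b c)
  have "(b, c) \<in> arcs_ends G" using rtrancl_on_into_rtrancl_on(2) by (auto simp: arcs_ends_conv quotient_graph_def)
  moreover have "c \<in> verts G" using rtrancl_on_into_rtrancl_on(3) by (auto simp: quotient_graph_def)
  ultimately show ?case using rtrancl_on_into_rtrancl_on by (auto intro: rtrancl_on.rtrancl_on_into_rtrancl_on)
qed

text \<open>
  Among the vertices on closed paths with finitely many ancestors choose \<open>u\<close> with the fewest, and let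
  \<open>H\<close> be the set of the other vertices, those that are not ancestors of \<open>u\<close>.  An infinite path outside
  \<open>H\<close> stays in a finite set, so it repeats a vertex \<open>t\<close>, which lies on a closed path.  The ancestors of
  \<open>t\<close> are ancestors of \<open>u\<close>; by minimality they are the same, so \<open>u\<close> itself is an ancestor of \<open>t\<close>.  Thus
  every vertex outside \<open>H\<close> reaches the path.
\<close>

lemma finite_ancestors_imp_quotient:
  assumes "u0 \<rightarrow>\<^sup>+ u0" "finite {w. w \<rightarrow>\<^sup>* u0}"
  shows "\<exists>H. hereditary G H \<and> saturated G H \<and>
          verts (quotient_graph G H) \<noteq> {} \<and> finite (verts (quotient_graph G H)) \<and>
          cofinal_graph (quotient_graph G H) \<and> \<not> (\<exists>v. sink (quotient_graph G H) v)"
proof -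
  define anc where "anc u = {w. w \<rightarrow>\<^sup>* u}" for u
  define S where "S = {u. u \<rightarrow>\<^sup>+ u \<and> finite (anc u)}"
  have "u0 \<in> S" using assms by (simp add: S_def anc_def)
  then obtain u where u: "u \<in> S" "\<And>t. t \<in> S \<Longrightarrow> card (anc u) \<le> card (anc t)"
    using arg_min_natI[of "\<lambda>u. u \<in> S" _ "\<lambda>u. card (anc u)"] arg_min_nat_le[of "\<lambda>u. u \<in> S" _ "\<lambda>u. card (anc u)"] by blast
  have uu: "u \<rightarrow>\<^sup>+ u" and fin: "finite (anc u)" using u(1) by (auto simp: S_def)
  have uV: "u \<in> verts G" using uu by (auto dest: reachable1_in_verts)
  have anc_sub: "anc u \<subseteq> verts G" by (auto simp: anc_def dest: reachable_in_verts)
  define H where "H = verts G - anc u"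
  let ?Q = "quotient_graph G H"
  have vQ: "verts ?Q = anc u" using anc_sub by (auto simp: quotient_graph_def H_def)
  have plus: "v \<rightarrow>\<^sup>+ u" if "v \<in> anc u" for v
    using that uu by (auto simp: anc_def intro: reachable_reachable1_trans)
  have step: "\<exists>e\<in>out_arcs G v. head G e \<in> anc u" if v: "v \<in> anc u" for v
  proof -
    obtain p where "awalk v p u" "p \<noteq> []" using plus[OF v] unfolding reachable1_awalk by blast
    then obtain e q where "e \<in> arcs G" "tail G e = v" "awalk (head G e) q u"
      by (cases p) (auto simp: awalk_simps)
    then show ?thesis by (auto simp: anc_def reachable_awalk)
  qed
  have her: "hereditary G H"
    unfolding hereditary_def H_def
  proof (intro conjI allI impI, blast)
    fix v w assume "v \<in> verts G - anc u \<and> v \<rightarrow>\<^sup>* w"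
    then show "w \<in> verts G - anc u"
      using reachable_trans[of v w u] by (auto simp: anc_def dest: reachable_in_verts)
  qed
  have sat: "saturated G H"
    unfolding saturated_def H_def using step by fastforce
  have nosink: "\<not> sink ?Q v" for v
  proof
    assume "sink ?Q v"
    then have "v \<in> anc u" "out_arcs ?Q v = {}" by (auto simp: sink_def vQ)
    moreover obtain e where "e \<in> out_arcs G v" "head G e \<in> anc u" using step[OF \<open>v \<in> anc u\<close>] by blast
    ultimately show False by (auto simp: out_arcs_def quotient_graph_def H_def)
  qed
  interpret Q: wf_digraph ?Q by (rule wf_digraph_quotient_graph[OF her])
  have arcQ: "e \<in> arcs ?Q" if "e \<in> arcs G" "head G e \<in> anc u" for e
    using that by (auto simp: quotient_graph_def H_def)
  have reachQ: "v \<rightarrow>\<^sup>*\<^bsub>?Q\<^esub> t" if "v \<rightarrow>\<^sup>* t" "t \<in> anc u" for v t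
  proof -
    obtain p where "awalk v p t" using \<open>v \<rightarrow>\<^sup>* t\<close> by (auto simp: reachable_awalk)
    then show ?thesis
    proof (induction p arbitrary: v)
      case Nil
      then show ?case using that(2) by (auto simp: awalk_simps vQ)
    next
      case (Cons e p)
      then have e: "e \<in> arcs G" "tail G e = v" "awalk (head G e) p t" by (auto simp: awalk_simps)
      have "head G e \<rightarrow>\<^sup>* u" using e(3) that(2) by (auto simp: anc_def reachable_awalk intro: awalk_appendI)
      then have "e \<in> arcs ?Q" using e by (intro arcQ) (auto simp: anc_def)
      then have "v \<rightarrow>\<^bsub>?Q\<^esub> head G e" using e(2) by (auto simp: arcs_ends_conv quotient_graph_def)
      then show ?case using Cons.IH[OF e(3)] by (rule Q.adj_reachable_trans)
    qed
  qed
  have cof: "cofinal_graph ?Q"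
    unfolding cofinal_graph_def cofinal_vertex_def
  proof (intro ballI)
    fix v W assume v: "v \<in> verts ?Q" and W: "W \<in> maximal_path_vertex_sets ?Q"
    then obtain \<gamma> where \<gamma>: "W = range (\<lambda>i. tail ?Q (\<gamma> i))" "infinite_path ?Q \<gamma>"
      using nosink by (auto simp: maximal_path_vertex_sets_def)
    define x where "x i = tail G (\<gamma> i)" for i
    have W_eq: "W = range x" using \<gamma>(1) by (simp add: x_def[abs_def] quotient_graph_def)
    have g: "\<gamma> i \<in> arcs ?Q" for i
      using \<gamma>(2) unfolding infinite_path_def by blast
    have hx: "head G (\<gamma> i) = x (Suc i)" for i
    proof -
      have "head ?Q (\<gamma> i) = tail ?Q (\<gamma> (Suc i))" using \<gamma>(2) unfolding infinite_path_def by blast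
      then show ?thesis by (simp add: x_def quotient_graph_def)
    qed
    have x: "x i \<in> anc u" for i using Q.tail_in_verts[OF g[of i]] unfolding vQ by (simp add: x_def quotient_graph_def)
    have adj: "x i \<rightarrow> x (Suc i)" for i
    proof -
      have "\<gamma> i \<in> arcs G" using g[of i] by (simp add: quotient_graph_def)
      then show ?thesis using hx[of i] in_arcs_imp_in_arcs_ends by (metis x_def)
    qed
    have plus_x: "x i \<rightarrow>\<^sup>+ x (i + Suc k)" for i k
      by (induction k) (use adj in \<open>auto intro: trancl_into_trancl\<close>)
    have "range x \<subseteq> anc u" using x by blast
    then have "finite (range x)" using fin finite_subset by blast
    then have "\<not> inj x" using finite_imageD[of x UNIV] by auto
    then obtain i j where ij: "i < j" "x i = x j" unfolding inj_on_def by (metis linorder_neqE_nat)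
    then have "x i \<rightarrow>\<^sup>+ x i" using plus_x[of i "j - Suc i"] by simp
    moreover have anc_x: "anc (x i) \<subseteq> anc u"
      using x[of i] by (auto simp: anc_def intro: reachable_trans)
    ultimately have "x i \<in> S" using fin finite_subset by (auto simp: S_def)
    then have "anc (x i) = anc u" using u(2) anc_x fin by (meson card_seteq)
    then have "u \<rightarrow>\<^sup>* x i" using uV by (auto simp: anc_def)
    then have "v \<rightarrow>\<^sup>* x i" using v vQ by (auto simp: anc_def intro: reachable_trans)
    then have "v \<rightarrow>\<^sup>*\<^bsub>?Q\<^esub> x i" using x by (intro reachQ)
    then show "\<exists>w\<in>W. v \<rightarrow>\<^sup>*\<^bsub>?Q\<^esub> w" unfolding W_eq by blast
  qed
  have "u \<in> anc u" using uV by (auto simp: anc_def)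
  then show ?thesis using her sat cof nosink fin vQ by (intro exI[of _ H]) auto
qed

end

context leavitt_family
begin

text \<open>
  Here \<open>c'\<close> and \<open>d'\<close> play the role of the adjoints of \<open>c\<close> and \<open>d\<close>.
\<close>

definition orthogonal_isometries :: "'v \<Rightarrow> 'r \<Rightarrow> 'r \<Rightarrow> 'r \<Rightarrow> 'r \<Rightarrow> bool" where
  "orthogonal_isometries u c c' d d' \<longleftrightarrow> c \<in> R \<and> c' \<in> R \<and> d \<in> R \<and> d' \<in> R \<and>
     c' * c = V u \<and> d' * d = V u \<and> c' * d = 0 \<and> d' * c = 0 \<and>
     V u * c = c \<and> c * V u = c \<and> V u * c' = c' \<and> c' * V u = c' \<and>
     V u * d = d \<and> d * V u = d \<and> V u * d' = d' \<and> d' * V u = d'"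

lemma closed_path_isometries:
  assumes "condition_K E" "u \<rightarrow>\<^sup>+ u"
  shows "\<exists>c c' d d'. orthogonal_isometries u c c' d d'"
proof -
  obtain p q where pq: "closed_simple_path E u p" "closed_simple_path E u q" "\<not> prefix p q" "\<not> prefix q p"
    using two_closed_simple_paths[OF assms] by blast
  then have w: "awalk u p u" "awalk u q u" by (auto simp: closed_simple_path_def)
  have "orthogonal_isometries u (ed u p) (gh u p) (ed u q) (gh u q)"
    unfolding orthogonal_isometries_def
    using path_in_R[OF w(1)] path_in_R[OF w(2)]
      gh_ed_self[OF w(1)] gh_ed_self[OF w(2)] gh_ed_incomparable[OF w pq(3,4)] gh_ed_incomparable[OF w(2,1) pq(4,3)]
      V_ed[OF w(1)] V_ed[OF w(2)] ed_V[OF w(1)] ed_V[OF w(2)] V_gh[OF w(1)] V_gh[OF w(2)] gh_V[OF w(1)] gh_V[OF w(2)]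
    by (intro conjI)
  then show ?thesis by blast
qed

lemma cycle_imp_not_stable_range_one:
  assumes "condition_K E" and u: "u \<rightarrow>\<^sup>+ u" "V u \<noteq> 0"
  shows "\<not> stable_range_in R 1"
proof
  assume sr: "stable_range_in R 1"
  have uV: "u \<in> verts E" using u(1) by (auto dest: reachable1_in_verts)
  obtain c c' d d' where "orthogonal_isometries u c c' d d'"
    using closed_path_isometries[OF assms(1) u(1)] by blast
  then have c: "c \<in> R" "c' \<in> R" "d' * d = V u" "c' * c = V u" "d' * c = 0" "V u * c = c" "c * V u = c"
     "V u * c' = c'" "c' * V u = c'" "V u * d = d"
    by (simp_all add: orthogonal_isometries_def)
  have "c * c' = V u"
    by (rule stable_range_one_imp_directly_finite[OF subrng_R sr gens_in_R(1)[OF uV] c(1,2,4) V_idem[OF uV] c(6-9)])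
  then have "d' * (c * c') * d = V u" using c by (simp add: mult.assoc)
  also have "d' * (c * c') * d = (d' * c) * (c' * d)" by (simp only: mult.assoc)
  finally show False using c(5) u(2) by simp
qed

text \<open>
  For an idempotent \<open>x\<close> this says that \<open>x\<close> is equivalent to an idempotent below \<open>V u\<close>.
\<close>

definition embeds_at :: "'v \<Rightarrow> 'r \<Rightarrow> bool" where
  "embeds_at u x \<longleftrightarrow> (\<exists>s\<in>R. \<exists>s'\<in>R. s' * s = x \<and> V u * s = s \<and> s' * V u = s')"

lemma embeds_at_zero: "embeds_at u 0"
  unfolding embeds_at_def by (intro bexI[of _ 0]) (auto simp: lin_span_zero)

text \<open>
  The isometries \<open>c\<close>, \<open>d\<close> put two copies of \<open>V u\<close> inside \<open>V u\<close>, so there is room for a sum, orthogonal or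
  not.
\<close>

lemma embeds_at_add:
  assumes K: "condition_K E" "u \<rightarrow>\<^sup>+ u" and "embeds_at u x" "embeds_at u y"
  shows "embeds_at u (x + y)"
proof -
  obtain c c' d d' where "orthogonal_isometries u c c' d d'"
    using closed_path_isometries[OF K] by blast
  then have c: "c \<in> R" "c' \<in> R" "d \<in> R" "d' \<in> R" "c' * c = V u" "d' * d = V u" "c' * d = 0" "d' * c = 0"
    "V u * c = c" "V u * d = d" "c' * V u = c'" "d' * V u = d'"
    by (simp_all add: orthogonal_isometries_def)
  obtain s s' where s: "s \<in> R" "s' \<in> R" "s' * s = x" "V u * s = s" "s' * V u = s'"
    using assms(3) unfolding embeds_at_def by blast
  obtain t t' where t: "t \<in> R" "t' \<in> R" "t' * t = y" "V u * t = t" "t' * V u = t'"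
    using assms(4) unfolding embeds_at_def by blast
  have "(s' * c' + t' * d') * (c * s + d * t) =
      s' * (c' * c) * s + s' * (c' * d) * t + t' * (d' * c) * s + t' * (d' * d) * t"
    by (simp add: algebra_simps)
  also have "\<dots> = x + y" using c s t by simp
  finally have "(s' * c' + t' * d') * (c * s + d * t) = x + y" .
  moreover have "V u * (c * s + d * t) = c * s + d * t" "(s' * c' + t' * d') * V u = s' * c' + t' * d'"
    using c by (auto simp: distrib_left distrib_right mult.assoc) (auto simp: mult.assoc[symmetric])
  moreover have "c * s + d * t \<in> R" "s' * c' + t' * d' \<in> R"
    using c s t by (auto intro!: lin_span_add subrngD(4)[OF subrng_R])
  ultimately show ?thesis unfolding embeds_at_def by blast
qed

lemma embeds_at_sum:
  assumes K: "condition_K E" "u \<rightarrow>\<^sup>+ u" and "\<And>i. i \<in> S \<Longrightarrow> embeds_at u (f i)"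
  shows "embeds_at u (sum f S)"
  using assms(3) by (induction S rule: infinite_finite_induct) (auto intro: embeds_at_zero embeds_at_add[OF K])

lemma embeds_at_mult:
  assumes "embeds_at u x" "a \<in> R" "b \<in> R"
  shows "embeds_at u (a * x * b)"
proof -
  obtain s s' where s: "s \<in> R" "s' \<in> R" "s' * s = x" "V u * s = s" "s' * V u = s'"
    using assms(1) unfolding embeds_at_def by blast
  have "(a * s') * (s * b) = a * x * b" using s(3) by (metis mult.assoc)
  moreover have "V u * (s * b) = s * b" "(a * s') * V u = a * s'" using s(4,5) by (metis mult.assoc)+
  ultimately show ?thesis unfolding embeds_at_def
    using assms s subrngD(4)[OF subrng_R] by (intro bexI[of _ "s * b"] bexI[of _ "a * s'"]) auto
qed

lemma embeds_at_reachable: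
  assumes "u \<rightarrow>\<^sup>* w"
  shows "embeds_at u (V w)"
proof -
  obtain p where p: "awalk u p w" using assms by (auto simp: reachable_awalk)
  show ?thesis unfolding embeds_at_def
    using path_in_R[OF p] gh_ed_self[OF p] V_ed[OF p] gh_V[OF p] by blast
qed

text \<open>
  The family describes \<open>L(E/H)\<close>, since the vertices of \<open>H\<close> are zero.  Take \<open>u\<close> on a closed path outside
  \<open>H\<close>.  If some vertex did not embed at \<open>u\<close>, then neither would the end of some edge leaving it, by
  \<open>v = \<Sum>ee\<^sup>*\<close>, and so on; this yields an infinite path of such vertices.  By cofinality \<open>u\<close> reaches one of
  them, which therefore does embed.  So the unit \<open>q\<close>, the sum of all vertices, embeds at \<open>u\<close>, say
  \<open>q = s's\<close>, and the elements \<open>c\<^sup>kds\<close> are isometries with orthogonal ranges.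
\<close>

lemma simple_quotient_imp_no_stable_range:
  assumes K: "condition_K E" and H: "hereditary E H"
    and fin: "finite (verts (quotient_graph E H))" and ne: "verts (quotient_graph E H) \<noteq> {}"
    and cof: "cofinal_graph (quotient_graph E H)" and ns: "\<not> (\<exists>v. sink (quotient_graph E H) v)"
    and V0: "\<And>v. v \<in> H \<Longrightarrow> V v = 0" and V1: "\<And>v. v \<in> verts E - H \<Longrightarrow> V v \<noteq> 0"
  shows "\<not> stable_range_in R m"
proof -
  let ?Q = "quotient_graph E H"
  interpret Q: wf_digraph ?Q by (rule wf_digraph_quotient_graph[OF H])
  have vQ: "verts ?Q = verts E - H" by (simp add: quotient_graph_def)
  obtain u where uQ: "u \<rightarrow>\<^sup>+\<^bsub>?Q\<^esub> u" using Q.exists_closed_path[OF fin ne ns] by blast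
  then have uu: "u \<rightarrow>\<^sup>+ u" and uV: "u \<in> verts ?Q"
    using quotient_graph_reachable1 Q.reachable1_in_verts by auto
  have emb: "embeds_at u (V v)" if v: "v \<in> verts E" for v
  proof (rule ccontr)
    define D where "D = {v \<in> verts E. \<not> embeds_at u (V v)}"
    assume "\<not> embeds_at u (V v)"
    then have vD: "v \<in> D" using v by (simp add: D_def)
    have DH: "D \<inter> H = {}" using V0 embeds_at_zero by (auto simp: D_def)
    have next_edge: "\<exists>e. e \<in> out_arcs E w \<and> head E e \<in> D" if w: "w \<in> D" for w
    proof (rule ccontr)
      assume no: "\<not> ?thesis"
      have wV: "w \<in> verts E" "w \<notin> H" using w DH by (auto simp: D_def)
      then have "out_arcs ?Q w \<noteq> {}" using ns vQ by (auto simp: sink_def)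
      then have ne: "out_arcs E w \<noteq> {}" by (auto simp: out_arcs_def quotient_graph_def)
      have "embeds_at u (Ed e * V (head E e) * Gh e)" if e: "e \<in> out_arcs E w" for e
        using e no by (intro embeds_at_mult gens_in_R) (auto simp: D_def)
      then have "embeds_at u (\<Sum>e\<in>out_arcs E w. Ed e * V (head E e) * Gh e)"
        by (rule embeds_at_sum[OF K uu])
      moreover have "V w = (\<Sum>e\<in>out_arcs E w. Ed e * V (head E e) * Gh e)"
        using V_sum[OF wV(1) ne] by (simp add: Ed_V)
      ultimately show False using w by (simp add: D_def)
    qed
    define f where "f w = (SOME e. e \<in> out_arcs E w \<and> head E e \<in> D)" for w
    have f: "f w \<in> out_arcs E w" "head E (f w) \<in> D" if "w \<in> D" for w
      using someI_ex[OF next_edge[OF that]] by (auto simp: f_def)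
    define x where "x i = ((\<lambda>w. head E (f w)) ^^ i) v" for i
    have xD: "x i \<in> D" for i by (induction i) (use vD f in \<open>auto simp: x_def\<close>)
    have xS: "x (Suc i) = head E (f (x i))" for i by (simp add: x_def)
    have fx: "f (x i) \<in> arcs E" "tail E (f (x i)) = x i" "head E (f (x i)) \<notin> H" for i
      using f[OF xD[of i]] DH by (auto simp: out_arcs_def)
    have "infinite_path ?Q (\<lambda>i. f (x i))"
      unfolding infinite_path_def
    proof
      fix i show "f (x i) \<in> arcs ?Q \<and> head ?Q (f (x i)) = tail ?Q (f (x (Suc i)))"
        using fx[of i] fx(2)[of "Suc i"] by (simp add: quotient_graph_def xS)
    qed
    then have W: "range (\<lambda>i. tail ?Q (f (x i))) \<in> maximal_path_vertex_sets ?Q"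
      unfolding maximal_path_vertex_sets_def by (intro UnI1 CollectI exI[of _ "\<lambda>i. f (x i)"]) simp
    have "cofinal_vertex ?Q u" using cof uV by (simp add: cofinal_graph_def)
    from bspec[OF this[unfolded cofinal_vertex_def] W]
    obtain i where "u \<rightarrow>\<^sup>*\<^bsub>?Q\<^esub> tail ?Q (f (x i))"
      by (elim bexE rangeE) simp
    then have "u \<rightarrow>\<^sup>* x i" using quotient_graph_reachable fx(2)[of i] by (simp add: quotient_graph_def)
    then show False using embeds_at_reachable xD[of i] by (auto simp: D_def)
  qed
  define q where "q = (\<Sum>v\<in>verts E - H. V v)"
  have fin': "finite (verts E - H)" using fin vQ by simp
  have qR: "q \<in> R" unfolding q_def by (intro lin_span_sum gens_in_R) auto
  have qV: "q * V v = V v" "V v * q = V v" if "v \<in> verts E" for v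
  proof -
    have "q * V v = (\<Sum>w\<in>verts E - H. if w = v then V v else 0)" "V v * q = (\<Sum>w\<in>verts E - H. if w = v then V v else 0)"
      unfolding q_def sum_distrib_left sum_distrib_right using that by (auto intro!: sum.cong simp: V_mult)
    then show "q * V v = V v" "V v * q = V v" using fin' V0 that by auto
  qed
  have q_left: "q * m = m" and q_right: "m * q = m" if mM: "m \<in> monomials (verts E)" for m
  proof -
    obtain w p v r z where m: "m = ed w p * gh v r" "awalk w p z" "awalk v r z" using mM unfolding monomials_def by blast
    have wv: "w \<in> verts E" "v \<in> verts E" using m by (auto dest: awalk_hd_in_verts)
    have Vm: "V w * m = m" using V_ed[OF m(2)] by (simp add: m(1) mult.assoc[symmetric])
    have mV: "m * V v = m" using gh_V[OF m(3)] by (simp add: m(1) mult.assoc)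
    have "q * (V w * m) = V w * m" "m * V v * q = m * V v"
      using qV wv by (simp_all only: mult.assoc[symmetric], simp_all only: mult.assoc)
    then show "q * m = m" "m * q = m" by (simp_all only: Vm mV)
  qed
  have qx: "q * x = x" "x * q = x" if "x \<in> R" for x
    using that by (induction rule: lin_span.induct) (auto simp: distrib_left distrib_right \<kappa>_left_commute mult.assoc q_left q_right)
  have "q \<noteq> 0"
  proof
    assume "q = 0"
    then have "V u = 0" using qV[of u] uV vQ by auto
    then show False using V1 uV vQ by auto
  qed
  have "embeds_at u q" unfolding q_def by (intro embeds_at_sum[OF K uu] emb) auto
  then obtain s s' where s: "s \<in> R" "s' \<in> R" "s' * s = q" "V u * s = s" "s' * V u = s'"
    unfolding embeds_at_def by blast
  obtain c c' d d' where "orthogonal_isometries u c c' d d'"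
    using closed_path_isometries[OF K uu] by blast
  then have c: "c \<in> R" "c' \<in> R" "d \<in> R" "d' \<in> R" "c' * c = V u" "d' * d = V u" "c' * d = 0" "d' * c = 0"
    "V u * c = c" "V u * d = d" "c' * V u = c'" "d' * V u = d'"
    by (simp_all add: orthogonal_isometries_def)
  have Vpow: "V u * (c ^ l * d) = c ^ l * d" for l
    using c by (cases l) (auto simp: mult.assoc[symmetric])
  have pow: "d' * (c' ^ k * (c ^ l * d)) = (if k = l then V u else 0)" for k l
  proof (induction k arbitrary: l)
    case 0
    show ?case
    proof (cases l)
      case (Suc l')
      have "d' * (c * (c ^ l' * d)) = (d' * c) * (c ^ l' * d)" by (simp only: mult.assoc)
      then show ?thesis using c Suc by (simp add: mult.assoc)
    qed (use c in simp)
  next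
    case (Suc k)
    have "c' ^ Suc k * z = c' ^ k * (c' * z)" for z by (simp only: power_Suc2 mult.assoc)
    moreover have "c' * (c ^ l * d) = (if l = 0 then 0 else c ^ (l - 1) * d)"
    proof (cases l)
      case (Suc l')
      have "c' * (c * (c ^ l' * d)) = (c' * c) * (c ^ l' * d)" by (simp only: mult.assoc)
      then show ?thesis using Suc c Vpow by (simp add: mult.assoc)
    qed (use c in simp)
    ultimately show ?case using Suc[of "l - 1"] by (cases l) auto
  qed
  define x x' where "x k = c ^ k * d * s" and "x' k = s' * d' * c' ^ k" for k :: nat
  have powR: "c ^ k * d \<in> R" "d' * c' ^ k \<in> R" for k
  proof -
    show "c ^ k * d \<in> R"
      by (induction k) (use c subrngD(4)[OF subrng_R] in \<open>auto simp: mult.assoc\<close>)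
    show "d' * c' ^ k \<in> R"
    proof (induction k)
      case (Suc k)
      have "d' * c' ^ Suc k = d' * c' ^ k * c'" by (simp only: power_Suc2 mult.assoc)
      then show ?case using Suc c subrngD(4)[OF subrng_R] by metis
    qed (use c in simp)
  qed
  show ?thesis
  proof (rule isometries_imp_no_stable_range[OF subrng_R qR qx(1) qx(2) \<open>q \<noteq> 0\<close>])
    fix k l
    show "x k \<in> R" "x' k \<in> R"
      using powR[of k] s by (auto simp: x_def x'_def mult.assoc[of s'] intro!: subrngD(4)[OF subrng_R])
    have "x' k * x l = s' * (d' * (c' ^ k * (c ^ l * d))) * s" by (simp add: x_def x'_def mult.assoc)
    then show "x' k * x l = (if k = l then q else 0)" using pow[of k l] s by simp
  qed
qed

end

section \<open>Stable range conditions and ring homomorphisms\<close>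

lemma column_unimodular_cong:
  assumes "n \<ge> 1" "\<And>i. i \<in> {1..n} \<Longrightarrow> y i = z i" "column_unimodular S n y"
  shows "column_unimodular S n z"
proof -
  obtain x where x: "\<forall>i\<in>{1..n}. y i \<in> S" "\<forall>i\<in>{1..n}. x i \<in> S" "x 1 + y 1 + (\<Sum>i=1..n. x i * y i) = 0"
    using assms(3) unfolding column_unimodular_def by blast
  have "(\<Sum>i=1..n. x i * y i) = (\<Sum>i=1..n. x i * z i)" using assms(2) by (intro sum.cong) auto
  moreover have "y 1 = z 1" using assms(1,2) by auto
  ultimately have "x 1 + z 1 + (\<Sum>i=1..n. x i * z i) = 0" using x(3) by simp
  moreover have "\<forall>i\<in>{1..n}. z i \<in> S" using x(1) assms(2) by auto
  ultimately show ?thesis unfolding column_unimodular_def using x(2) by blast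
qed

locale nonunital_ring_hom = nonunital_ring R for R :: "('a, 'm) ring_scheme" (structure) +
  fixes h :: "'a \<Rightarrow> 'r::ring_1"
  assumes h_add: "\<lbrakk>x \<in> carrier R; y \<in> carrier R\<rbrakk> \<Longrightarrow> h (x \<oplus> y) = h x + h y"
    and h_mult: "\<lbrakk>x \<in> carrier R; y \<in> carrier R\<rbrakk> \<Longrightarrow> h (x \<otimes> y) = h x * h y"
begin

lemma h_zero: "h \<zero> = 0"
  using h_add[of \<zero> \<zero>] by simp

lemma h_uminus: "x \<in> carrier R \<Longrightarrow> h (\<ominus> x) = - h x"
  using h_add[of x "\<ominus> x"] by (simp add: h_zero r_neg eq_neg_iff_add_eq_0 add.commute)

lemma h_minus: "\<lbrakk>x \<in> carrier R; y \<in> carrier R\<rbrakk> \<Longrightarrow> h (x \<ominus> y) = h x - h y"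
  by (simp add: a_minus_def h_add h_uminus)

lemma h_finsum: "(\<And>i. i \<in> A \<Longrightarrow> f i \<in> carrier R) \<Longrightarrow> finite A \<Longrightarrow> h (finsum R f A) = (\<Sum>i\<in>A. h (f i))"
proof (induction A rule: infinite_finite_induct)
  case (insert a A)
  have "f \<in> A \<rightarrow> carrier R" "f a \<in> carrier R" using insert.prems by auto
  then show ?case using insert by (simp add: h_add)
qed (auto simp: h_zero)

definition relation_sum :: "nat \<Rightarrow> (nat \<Rightarrow> 'a) \<Rightarrow> (nat \<Rightarrow> 'a) \<Rightarrow> 'a" where
  "relation_sum n x y = x 1 \<oplus> y 1 \<oplus> (\<Oplus>i \<in> {1..n}. x i \<otimes> y i)"

lemma h_relation_sum:
  assumes "n \<ge> 1" "\<forall>i\<in>{1..n}. x i \<in> carrier R" "\<forall>i\<in>{1..n}. y i \<in> carrier R"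
  shows "relation_sum n x y \<in> carrier R"
    "h (relation_sum n x y) = h (x 1) + h (y 1) + (\<Sum>i=1..n. h (x i) * h (y i))"
proof -
  have 1: "x 1 \<in> carrier R" "y 1 \<in> carrier R" using assms by auto
  have fc: "(\<Oplus>i \<in> {1..n}. x i \<otimes> y i) \<in> carrier R"
    using assms by (intro finsum_closed) (auto intro: mult_closed)
  have "h (\<Oplus>i \<in> {1..n}. x i \<otimes> y i) = (\<Sum>i=1..n. h (x i \<otimes> y i))"
    using assms by (intro h_finsum) (auto intro: mult_closed)
  also have "\<dots> = (\<Sum>i=1..n. h (x i) * h (y i))" using assms by (intro sum.cong) (auto simp: h_mult)
  finally show "h (relation_sum n x y) = h (x 1) + h (y 1) + (\<Sum>i=1..n. h (x i) * h (y i))"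
    using 1 fc by (simp add: relation_sum_def h_add)
  show "relation_sum n x y \<in> carrier R" using 1 fc by (simp add: relation_sum_def)
qed

lemma umod_image:
  assumes "n \<ge> 1" "umod n y"
  shows "column_unimodular (h ` carrier R) n (\<lambda>i. h (y i))"
proof -
  obtain x where x: "\<forall>i\<in>{1..n}. y i \<in> carrier R" "\<forall>i\<in>{1..n}. x i \<in> carrier R" "relation_sum n x y = \<zero>"
    using assms(2) unfolding umod_def relation_sum_def by blast
  then show ?thesis
    using h_relation_sum(2)[OF assms(1) x(2,1)] h_zero
    unfolding column_unimodular_def by (intro conjI exI[of _ "\<lambda>i. h (x i)"]) auto
qed

lemma lift_family:
  assumes "\<forall>i\<in>A. v i \<in> h ` carrier R"
  shows "\<exists>w. (\<forall>i\<in>A. w i \<in> carrier R) \<and> (\<forall>i\<in>A. v i = h (w i))"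
proof -
  have "\<forall>i\<in>A. \<exists>z. z \<in> carrier R \<and> v i = h z" using assms by blast
  from bchoice[OF this] show ?thesis by blast
qed

lemma umod_of_image:
  assumes inj: "inj_on h (carrier R)" and "n \<ge> 1" and y: "\<forall>i\<in>{1..n}. y i \<in> carrier R"
    and uni: "column_unimodular (h ` carrier R) n (\<lambda>i. h (y i))"
  shows "umod n y"
proof -
  obtain x' where x': "\<forall>i\<in>{1..n}. x' i \<in> h ` carrier R" "x' 1 + h (y 1) + (\<Sum>i=1..n. x' i * h (y i)) = 0"
    using uni unfolding column_unimodular_def by blast
  obtain x where x: "\<forall>i\<in>{1..n}. x i \<in> carrier R" "\<forall>i\<in>{1..n}. x' i = h (x i)"
    using lift_family[OF x'(1)] by blast
  have "(\<Sum>i=1..n. x' i * h (y i)) = (\<Sum>i=1..n. h (x i) * h (y i))" using x by (intro sum.cong) auto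
  moreover have "x' 1 = h (x 1)" using x assms(2) by auto
  ultimately have "h (relation_sum n x y) = h \<zero>"
    using x'(2) h_relation_sum(2)[OF assms(2) x(1) y] h_zero by simp
  then have "relation_sum n x y = \<zero>"
    using inj_onD[OF inj] h_relation_sum(1)[OF assms(2) x(1) y] by simp
  then show ?thesis unfolding umod_def relation_sum_def using y x(1) by blast
qed

text \<open>
  An injective homomorphism identifies \<open>R\<close> with its image.
\<close>

lemma srange_of_image:
  assumes inj: "inj_on h (carrier R)" and sr: "stable_range_in (h ` carrier R) m"
  shows "srange m"
  unfolding srange_def
proof (intro conjI allI impI)
  show m: "m \<ge> 1" using sr by (simp add: stable_range_in_def)
  fix y assume y: "umod (m + 1) y"
  then have yc: "\<forall>i\<in>{1..m + 1}. y i \<in> carrier R" by (simp add: umod_def)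
  have "column_unimodular (h ` carrier R) (m + 1) (\<lambda>i. h (y i))" using umod_image[OF _ y] by simp
  from sr[unfolded stable_range_in_def, THEN conjunct2, rule_format, OF this]
  obtain v where v: "\<forall>i\<in>{1..m}. v i \<in> h ` carrier R"
    "column_unimodular (h ` carrier R) m (\<lambda>i. h (y i) + v i * h (y (m + 1)))" by blast
  obtain w where w: "\<forall>i\<in>{1..m}. w i \<in> carrier R" "\<forall>i\<in>{1..m}. v i = h (w i)"
    using lift_family[OF v(1)] by blast
  have c: "y i \<in> carrier R" "w i \<in> carrier R" "y (m + 1) \<in> carrier R" if "i \<in> {1..m}" for i
    using yc w that by auto
  have "column_unimodular (h ` carrier R) m (\<lambda>i. h (y i \<oplus> w i \<otimes> y (m + 1)))"
  proof (rule column_unimodular_cong[OF m _ v(2)])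
    fix i assume i: "i \<in> {1..m}"
    show "h (y i) + v i * h (y (m + 1)) = h (y i \<oplus> w i \<otimes> y (m + 1))"
      using c[OF i] w(2) i by (simp add: h_add h_mult mult_closed)
  qed
  moreover have "\<forall>i\<in>{1..m}. y i \<oplus> w i \<otimes> y (m + 1) \<in> carrier R"
    by (intro ballI a_closed mult_closed c)
  ultimately have "umod m (\<lambda>i. y i \<oplus> w i \<otimes> y (m + 1))"
    by (intro umod_of_image[OF inj m])
  then show "\<exists>v. (\<forall>i\<in>{1..m}. v i \<in> carrier R) \<and> umod m (\<lambda>i. y i \<oplus> v i \<otimes> y (m + 1))"
    using w(1) by blast
qed

text \<open>
  Lift a unimodular column and its coefficients.  The relation then holds up to an element \<open>t\<close> of the
  kernel, and the column becomes unimodular when its last entry \<open>y\<^sub>m\<^sub>+\<^sub>1\<close> is replaced by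
  \<open>z = x\<^sub>m\<^sub>+\<^sub>1y\<^sub>m\<^sub>+\<^sub>1 + t\<close>.  Its new coefficient should be \<open>1\<close>, which need not be in \<open>R\<close>; a local left unit
  does as well.
\<close>

lemma stable_range_in_image:
  assumes unit: "\<And>x. x \<in> carrier R \<Longrightarrow> \<exists>\<epsilon>\<in>carrier R. \<epsilon> \<otimes> x = x" and sr: "srange m"
  shows "stable_range_in (h ` carrier R) m"
  unfolding stable_range_in_def
proof (intro conjI allI impI)
  show m: "m \<ge> 1" using sr by (simp add: srange_def)
  have m1: "m + 1 \<ge> 1" by simp
  fix y' assume "column_unimodular (h ` carrier R) (m + 1) y'"
  then obtain x' where y': "\<forall>i\<in>{1..m + 1}. y' i \<in> h ` carrier R" and x': "\<forall>i\<in>{1..m + 1}. x' i \<in> h ` carrier R"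
    and eq: "x' 1 + y' 1 + (\<Sum>i=1..m + 1. x' i * y' i) = 0"
    unfolding column_unimodular_def by blast
  obtain y where y: "\<forall>i\<in>{1..m + 1}. y i \<in> carrier R" "\<forall>i\<in>{1..m + 1}. y' i = h (y i)"
    using lift_family[OF y'] by blast
  obtain x where x: "\<forall>i\<in>{1..m + 1}. x i \<in> carrier R" "\<forall>i\<in>{1..m + 1}. x' i = h (x i)"
    using lift_family[OF x'] by blast
  have last: "x (m + 1) \<in> carrier R" "y (m + 1) \<in> carrier R" "x 1 \<in> carrier R" "y 1 \<in> carrier R" using x y by auto
  define t where "t = \<ominus> relation_sum (m + 1) x y"
  have t: "t \<in> carrier R" using h_relation_sum(1)[OF m1 x(1) y(1)] by (simp add: t_def)
  have "(\<Sum>i=1..m + 1. x' i * y' i) = (\<Sum>i=1..m + 1. h (x i) * h (y i))" using x y by (intro sum.cong) auto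
  moreover have "x' 1 = h (x 1)" "y' 1 = h (y 1)" using x y by auto
  ultimately have "h (relation_sum (m + 1) x y) = 0"
    using eq h_relation_sum(2)[OF m1 x(1) y(1)] by simp
  then have ht: "h t = 0" using h_relation_sum(1)[OF m1 x(1) y(1)] by (simp add: t_def h_uminus)
  define z where "z = x (m + 1) \<otimes> y (m + 1) \<oplus> t"
  have z: "z \<in> carrier R" using last t by (simp add: z_def mult_closed)
  obtain \<epsilon> where \<epsilon>: "\<epsilon> \<in> carrier R" "\<epsilon> \<otimes> z = z" using unit[OF z] by blast
  define Y X where "Y = y(m + 1 := z)" and "X = x(m + 1 := \<epsilon>)"
  have YX: "\<forall>i\<in>{1..m + 1}. Y i \<in> carrier R" "\<forall>i\<in>{1..m + 1}. X i \<in> carrier R"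
    using x y z \<epsilon> by (auto simp: Y_def X_def)
  have split: "{1..m + 1} = insert (m + 1) {1..m}" by auto
  have sc: "(\<Oplus>i \<in> {1..m}. x i \<otimes> y i) \<in> carrier R"
    using x y by (intro finsum_closed) (auto intro: mult_closed)
  have "(\<Oplus>i \<in> {1..m + 1}. X i \<otimes> Y i) = X (m + 1) \<otimes> Y (m + 1) \<oplus> (\<Oplus>i \<in> {1..m}. X i \<otimes> Y i)"
    unfolding split using YX by (intro finsum_insert) (auto intro: mult_closed)
  also have "(\<Oplus>i \<in> {1..m}. X i \<otimes> Y i) = (\<Oplus>i \<in> {1..m}. x i \<otimes> y i)"
    using x y by (intro finsum_cong') (auto simp: X_def Y_def intro: mult_closed)
  also have "X (m + 1) \<otimes> Y (m + 1) = x (m + 1) \<otimes> y (m + 1) \<oplus> t" using \<epsilon> by (simp add: X_def Y_def z_def)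
  finally have S1: "(\<Oplus>i \<in> {1..m + 1}. X i \<otimes> Y i) =
    x (m + 1) \<otimes> y (m + 1) \<oplus> t \<oplus> (\<Oplus>i \<in> {1..m}. x i \<otimes> y i)" .
  have S2: "(\<Oplus>i \<in> {1..m + 1}. x i \<otimes> y i) = x (m + 1) \<otimes> y (m + 1) \<oplus> (\<Oplus>i \<in> {1..m}. x i \<otimes> y i)"
    unfolding split using x y by (intro finsum_insert) (auto intro: mult_closed)
  have "X 1 = x 1" "Y 1 = y 1" using m by (auto simp: X_def Y_def)
  then have "relation_sum (m + 1) X Y = relation_sum (m + 1) x y \<oplus> t"
    unfolding relation_sum_def S1 S2 using last t sc by (simp add: a_ac mult_closed)
  also have "\<dots> = \<zero>" using h_relation_sum(1)[OF m1 x(1) y(1)] by (simp add: t_def r_neg)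
  finally have "umod (m + 1) Y" unfolding umod_def relation_sum_def using YX by blast
  then obtain v where v: "\<forall>i\<in>{1..m}. v i \<in> carrier R" "umod m (\<lambda>i. Y i \<oplus> v i \<otimes> Y (m + 1))"
    using sr unfolding srange_def by blast
  have "column_unimodular (h ` carrier R) m (\<lambda>i. y' i + h (v i \<otimes> x (m + 1)) * y' (m + 1))"
  proof (rule column_unimodular_cong[OF m _ umod_image[OF m v(2)]])
    fix i assume i: "i \<in> {1..m}"
    then have c: "y i \<in> carrier R" "v i \<in> carrier R" "Y i = y i" "Y (m + 1) = z" "y' i = h (y i)" "y' (m + 1) = h (y (m + 1))"
      using y v by (auto simp: Y_def)
    have "h z = h (x (m + 1)) * h (y (m + 1))" using last t ht by (simp add: z_def h_add h_mult mult_closed)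
    then show "h (Y i \<oplus> v i \<otimes> Y (m + 1)) = y' i + h (v i \<otimes> x (m + 1)) * y' (m + 1)"
      using c z last by (simp add: h_add h_mult mult_closed mult.assoc)
  qed
  then show "\<exists>v. (\<forall>i\<in>{1..m}. v i \<in> h ` carrier R) \<and> column_unimodular (h ` carrier R) m (\<lambda>i. y' i + v i * y' (m + 1))"
    using v(1) last by (intro exI[of _ "\<lambda>i. h (v i \<otimes> x (m + 1))"]) (auto intro: mult_closed)
qed

end

section \<open>Homomorphisms from a quotient algebra\<close>

locale nonunital_ring_hom_kernel = nonunital_ring_hom A \<rho>
  for A :: "('k, 'a, 'm) module_scheme" and \<rho> :: "'a \<Rightarrow> 'r::ring_1" +
  fixes I
  assumes ideal_I: "algebra_ideal A I" and \<rho>_I: "x \<in> I \<Longrightarrow> \<rho> x = 0"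
begin

text \<open>
  The homomorphism is constant on the cosets of \<open>I\<close>, so its image of a coset is a singleton.
\<close>

definition induced :: "'a set \<Rightarrow> 'r" where
  "induced C = the_elem (\<rho> ` C)"

lemma additive_subgroup_I: "additive_subgroup I A"
  using ideal_I by (simp add: algebra_ideal_def)

lemma I_carrier: "x \<in> I \<Longrightarrow> x \<in> carrier A"
  by (rule additive_subgroup.a_Hcarr[OF additive_subgroup_I])

lemma image_coset: "a \<in> carrier A \<Longrightarrow> \<rho> ` (I +>\<^bsub>A\<^esub> a) = {\<rho> a}"
proof -
  assume a: "a \<in> carrier A"
  have z: "\<zero>\<^bsub>A\<^esub> \<in> I" by (rule additive_subgroup.zero_closed[OF additive_subgroup_I])
  have "\<rho> (x \<oplus>\<^bsub>A\<^esub> a) = \<rho> a" if "x \<in> I" for x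
    using that a I_carrier by (simp add: h_add \<rho>_I)
  moreover have "I +>\<^bsub>A\<^esub> a = (\<lambda>x. x \<oplus>\<^bsub>A\<^esub> a) ` I" by (auto simp: a_r_coset_def r_coset_def)
  ultimately show ?thesis using z by (auto simp: image_image)
qed

lemma induced_coset: "a \<in> carrier A \<Longrightarrow> induced (I +>\<^bsub>A\<^esub> a) = \<rho> a"
  by (simp add: induced_def image_coset)

lemma carrier_quotient: "carrier (quotient_algebra A I) = (\<lambda>a. I +>\<^bsub>A\<^esub> a) ` carrier A"
  by (auto simp: quotient_algebra_def ring.defs module.defs FactRing_def A_RCOSETS_def')

lemma coset_subset: "a \<in> carrier A \<Longrightarrow> x \<in> I +>\<^bsub>A\<^esub> a \<Longrightarrow> x \<in> carrier A"
  using I_carrier by (auto simp: a_r_coset_def r_coset_def)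

lemma induced_hom: "nonunital_ring_hom (quotient_algebra A I) induced"
proof (intro nonunital_ring_hom.intro nonunital_ring_hom_axioms.intro)
  show "nonunital_ring (quotient_algebra A I)"
    using nonunital_ring_axioms ideal_I by (rule nonunital_ring_quotient_algebra)
  fix C D assume "C \<in> carrier (quotient_algebra A I)" "D \<in> carrier (quotient_algebra A I)"
  then obtain a b where ab: "a \<in> carrier A" "b \<in> carrier A" "C = I +>\<^bsub>A\<^esub> a" "D = I +>\<^bsub>A\<^esub> b"
    unfolding carrier_quotient by blast
  have cc: "\<rho> ` C = {\<rho> a}" "\<rho> ` D = {\<rho> b}" using ab image_coset by auto
  have sub: "x \<in> carrier A" "\<rho> x = \<rho> a" if "x \<in> C" for x
    using that cc ab coset_subset by auto
  have sub': "x \<in> carrier A" "\<rho> x = \<rho> b" if "x \<in> D" for x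
    using that cc ab coset_subset by auto
  have ne: "C \<noteq> {}" "D \<noteq> {}" using cc by auto
  have "C \<oplus>\<^bsub>quotient_algebra A I\<^esub> D = (\<Union>x\<in>C. \<Union>y\<in>D. {x \<oplus>\<^bsub>A\<^esub> y})"
    by (simp add: quotient_algebra_def ring.defs module.defs FactRing_def set_add_def set_mult_def)
  then have "\<rho> ` (C \<oplus>\<^bsub>quotient_algebra A I\<^esub> D) = (\<Union>x\<in>C. \<Union>y\<in>D. {\<rho> (x \<oplus>\<^bsub>A\<^esub> y)})" by (simp add: image_UN)
  also have "\<dots> = (\<Union>x\<in>C. \<Union>y\<in>D. {\<rho> a + \<rho> b})"
    by (intro SUP_cong refl) (simp add: h_add sub sub')
  also have "\<dots> = {\<rho> a + \<rho> b}" using ne by simp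
  finally show "induced (C \<oplus>\<^bsub>quotient_algebra A I\<^esub> D) = induced C + induced D"
    by (simp add: induced_def cc)
  have "C \<otimes>\<^bsub>quotient_algebra A I\<^esub> D = (\<Union>x\<in>C. \<Union>y\<in>D. I +>\<^bsub>A\<^esub> (x \<otimes>\<^bsub>A\<^esub> y))"
    by (simp add: quotient_algebra_def ring.defs module.defs FactRing_def rcoset_mult_def)
  then have "\<rho> ` (C \<otimes>\<^bsub>quotient_algebra A I\<^esub> D) = (\<Union>x\<in>C. \<Union>y\<in>D. \<rho> ` (I +>\<^bsub>A\<^esub> (x \<otimes>\<^bsub>A\<^esub> y)))" by (simp add: image_UN)
  also have "\<dots> = (\<Union>x\<in>C. \<Union>y\<in>D. {\<rho> a * \<rho> b})"
    by (intro SUP_cong refl) (simp add: image_coset h_mult sub sub' mult_closed)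
  also have "\<dots> = {\<rho> a * \<rho> b}" using ne by simp
  finally show "induced (C \<otimes>\<^bsub>quotient_algebra A I\<^esub> D) = induced C * induced D"
    by (simp add: induced_def cc)
qed

lemma induced_image: "induced ` carrier (quotient_algebra A I) = \<rho> ` carrier A"
  unfolding carrier_quotient image_image using induced_coset by (intro image_cong) auto

lemma induced_inj:
  assumes "\<And>x. x \<in> carrier A \<Longrightarrow> \<rho> x = 0 \<Longrightarrow> x \<in> I"
  shows "inj_on induced (carrier (quotient_algebra A I))"
proof (rule inj_onI)
  fix C D assume "C \<in> carrier (quotient_algebra A I)" "D \<in> carrier (quotient_algebra A I)" and eq: "induced C = induced D"
  then obtain a b where ab: "a \<in> carrier A" "b \<in> carrier A" "C = I +>\<^bsub>A\<^esub> a" "D = I +>\<^bsub>A\<^esub> b"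
    unfolding carrier_quotient by blast
  have "\<rho> (a \<ominus>\<^bsub>A\<^esub> b) = 0" using eq ab by (simp add: induced_coset h_minus)
  then have d: "a \<ominus>\<^bsub>A\<^esub> b \<in> I" using assms ab by simp
  interpret I: additive_subgroup I A by (rule additive_subgroup_I)
  have "(a \<ominus>\<^bsub>A\<^esub> b) \<oplus>\<^bsub>A\<^esub> b \<in> I +>\<^bsub>A\<^esub> b" using d by (auto simp: a_r_coset_def r_coset_def)
  also have "(a \<ominus>\<^bsub>A\<^esub> b) \<oplus>\<^bsub>A\<^esub> b = a" using ab by (simp add: a_minus_def a_assoc l_neg)
  finally have "I +>\<^bsub>A\<^esub> b = I +>\<^bsub>A\<^esub> a"
    using ab by (intro a_repr_independence) (auto simp: I.a_subgroup)
  then show "C = D" using ab by simp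
qed

end

lemma gen_algebra_ideal_least: "algebra_ideal A I \<Longrightarrow> T \<subseteq> I \<Longrightarrow> gen_algebra_ideal A T \<subseteq> I"
  unfolding gen_algebra_ideal_def by blast

lemma gen_algebra_ideal_superset: "T \<subseteq> gen_algebra_ideal A T"
  unfolding gen_algebra_ideal_def by blast

section \<open>Evaluation of the free algebra\<close>

lemma free_algebra_induct [consumes 1, case_names zero gen add mult scale]:
  fixes f :: "'x list \<Rightarrow> 'k::field"
  assumes f: "f \<in> carrier (free_algebra TYPE('k) X)"
    and zero: "P (\<lambda>_. 0)" and gen: "\<And>x. x \<in> X \<Longrightarrow> P (free_gen x)"
    and add: "\<And>f g. \<lbrakk>f \<in> carrier (free_algebra TYPE('k) X); g \<in> carrier (free_algebra TYPE('k) X); P f; P g\<rbrakk> \<Longrightarrow>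
      P (f \<oplus>\<^bsub>free_algebra TYPE('k) X\<^esub> g)"
    and mult: "\<And>f g. \<lbrakk>f \<in> carrier (free_algebra TYPE('k) X); g \<in> carrier (free_algebra TYPE('k) X); P f; P g\<rbrakk> \<Longrightarrow>
      P (f \<otimes>\<^bsub>free_algebra TYPE('k) X\<^esub> g)"
    and scale: "\<And>c f. \<lbrakk>f \<in> carrier (free_algebra TYPE('k) X); P f\<rbrakk> \<Longrightarrow> P (c \<odot>\<^bsub>free_algebra TYPE('k) X\<^esub> f)"
  shows "P f"
proof -
  let ?A = "free_algebra TYPE('k) X"
  define \<delta> where "\<delta> w = (\<lambda>u. if u = w then 1 else 0 :: 'k)" for w :: "'x list"
  have \<delta>_gen: "\<delta> [x] = free_gen x" for x by (simp add: \<delta>_def free_gen_def)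
  have \<delta>_car: "\<delta> w \<in> carrier ?A" if "w \<in> lists X - {[]}" for w
    using that by (auto simp: \<delta>_def free_algebra_def)
  have \<delta>_Cons: "\<delta> (x # w) = free_gen x \<otimes>\<^bsub>?A\<^esub> \<delta> w" for x w
  proof
    fix u
    have "(free_gen x \<otimes>\<^bsub>?A\<^esub> \<delta> w) u = (\<Sum>i\<le>length u. if take i u = [x] \<and> drop i u = w then 1 else 0)"
      by (auto simp: free_algebra_def free_gen_def \<delta>_def intro!: sum.cong)
    also have "\<dots> = (\<Sum>i\<le>length u. if i = 1 then (if u = x # w then 1 else 0) else 0)"
    proof (intro sum.cong refl)
      fix i assume "i \<in> {..length u}"
      then show "(if take i u = [x] \<and> drop i u = w then 1 else 0 :: 'k) = (if i = 1 then (if u = x # w then 1 else 0) else 0)"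
        by (cases u; cases i) (auto simp: take_eq_Nil)
    qed
    also have "\<dots> = (if 1 \<le> length u then (if u = x # w then 1 else 0) else 0)"
      by (subst sum.delta) auto
    also have "\<dots> = \<delta> (x # w) u" by (auto simp: \<delta>_def)
    finally show "\<delta> (x # w) u = (free_gen x \<otimes>\<^bsub>?A\<^esub> \<delta> w) u" by simp
  qed
  have P\<delta>: "P (\<delta> w)" if "w \<in> lists X" "w \<noteq> []" for w
    using that
  proof (induction w)
    case (Cons x w)
    show ?case
    proof (cases "w = []")
      case True
      then show ?thesis using Cons gen by (simp add: \<delta>_gen)
    next
      case False
      then show ?thesis unfolding \<delta>_Cons using Cons \<delta>_car
        by (intro mult) (auto intro: gen free_gen_in_free_algebra)
    qed
  qed simp
  have "P f" if "finite S" "{w. f w \<noteq> 0} = S" "S \<subseteq> lists X - {[]}" for S and f :: "'x list \<Rightarrow> 'k"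
    using that
  proof (induction S arbitrary: f rule: finite_induct)
    case empty
    then have "f = (\<lambda>_. 0)" by auto
    then show ?case using zero by simp
  next
    case (insert w S)
    have w: "w \<in> lists X - {[]}" using insert.prems by blast
    have supp: "{v. (f(w := 0)) v \<noteq> 0} = S" using insert.hyps insert.prems by auto
    then have P1: "P (f(w := 0))" using insert by simp
    have car: "f(w := 0) \<in> carrier ?A" using supp insert by (auto simp: free_algebra_def)
    have "f = (f w \<odot>\<^bsub>?A\<^esub> \<delta> w) \<oplus>\<^bsub>?A\<^esub> f(w := 0)" by (auto simp: free_algebra_def \<delta>_def)
    moreover have "P (f w \<odot>\<^bsub>?A\<^esub> \<delta> w)" using w \<delta>_car P\<delta> by (intro scale) auto
    ultimately show ?case using add[OF free_algebra_smult_closed[OF \<delta>_car[OF w]] car] P1 by metis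
  qed
  then show ?thesis using f by (auto simp: free_algebra_def)
qed

context central_scalars
begin

text \<open>
  The homomorphism from the free algebra that sends the generators to the values of \<open>g\<close>.
\<close>

definition eval :: "('x \<Rightarrow> 'r) \<Rightarrow> ('x list \<Rightarrow> 'k) \<Rightarrow> 'r" where
  "eval g f = (\<Sum>w | f w \<noteq> 0. \<kappa> (f w) * prod_list (map g w))"

lemma eval_superset:
  assumes "finite S" "{w. f w \<noteq> 0} \<subseteq> S"
  shows "eval g f = (\<Sum>w\<in>S. \<kappa> (f w) * prod_list (map g w))"
  unfolding eval_def using assms by (intro sum.mono_neutral_left) (auto simp: \<kappa>_zero)

lemma eval_add:
  assumes "finite {w. f w \<noteq> 0}" "finite {w. h w \<noteq> 0}"
  shows "eval g (\<lambda>w. f w + h w) = eval g f + eval g h"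
proof -
  let ?S = "{w. f w \<noteq> 0} \<union> {w. h w \<noteq> 0}"
  have "finite ?S" using assms by simp
  note S = eval_superset[OF this, of _ g]
  have "eval g (\<lambda>w. f w + h w) = (\<Sum>w\<in>?S. \<kappa> (f w + h w) * prod_list (map g w))" by (rule S) auto
  moreover have "eval g f = (\<Sum>w\<in>?S. \<kappa> (f w) * prod_list (map g w))" by (rule S) auto
  moreover have "eval g h = (\<Sum>w\<in>?S. \<kappa> (h w) * prod_list (map g w))" by (rule S) auto
  ultimately show ?thesis by (simp add: \<kappa>_add distrib_right sum.distrib)
qed

lemma eval_scale:
  assumes "finite {w. f w \<noteq> 0}"
  shows "eval g (\<lambda>w. c * f w) = \<kappa> c * eval g f"
proof -
  have "eval g (\<lambda>w. c * f w) = (\<Sum>w | f w \<noteq> 0. \<kappa> (c * f w) * prod_list (map g w))"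
    by (rule eval_superset[OF assms]) auto
  then show ?thesis by (simp add: eval_def \<kappa>_mult sum_distrib_left mult.assoc)
qed

lemma eval_gen: "eval g (free_gen x) = g x"
proof -
  have "eval g (free_gen x) = (\<Sum>w\<in>{[x]}. \<kappa> (free_gen x w) * prod_list (map g w))"
    by (rule eval_superset) (auto simp: free_gen_def)
  then show ?thesis by (simp add: free_gen_def \<kappa>_one)
qed

text \<open>
  The coefficients of a product are indexed by the ways to cut a word in two.  Grouping the pairs of
  words by their concatenation turns the double sum into the product of the two evaluations.
\<close>

lemma eval_mult:
  assumes f: "finite {w. f w \<noteq> 0}" and h: "finite {w. h w \<noteq> 0}"
  shows "eval g (\<lambda>w. \<Sum>i\<le>length w. f (take i w) * h (drop i w)) = eval g f * eval g h"
proof -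
  let ?F = "{w. f w \<noteq> 0}" and ?H = "{w. h w \<noteq> 0}"
  define S where "S = (\<lambda>(u, v). u @ v) ` (?F \<times> ?H)"
  have fin: "finite (?F \<times> ?H)" "finite S" using f h by (auto simp: S_def)
  define fh where "fh w = (\<Sum>i\<le>length w. f (take i w) * h (drop i w))" for w
  have fh: "fh w = (\<Sum>(u, v) \<in> {x \<in> ?F \<times> ?H. (\<lambda>(u, v). u @ v) x = w}. f u * h v)" for w
  proof -
    have inj: "inj_on (\<lambda>i. (take i w, drop i w)) {..length w}"
    proof (rule inj_onI)
      fix i j assume ij: "i \<in> {..length w}" "j \<in> {..length w}" "(take i w, drop i w) = (take j w, drop j w)"
      then have "length (take i w) = length (take j w)" by simp
      then show "i = j" using ij by simp
    qed
    have "fh w = (\<Sum>(u, v) \<in> (\<lambda>i. (take i w, drop i w)) ` {..length w}. f u * h v)"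
      by (subst sum.reindex[OF inj]) (simp add: fh_def)
    also have "\<dots> = (\<Sum>(u, v) \<in> {x \<in> ?F \<times> ?H. (\<lambda>(u, v). u @ v) x = w}. f u * h v)"
    proof (rule sum.mono_neutral_right)
      show "{x \<in> ?F \<times> ?H. (\<lambda>(u, v). u @ v) x = w} \<subseteq> (\<lambda>i. (take i w, drop i w)) ` {..length w}"
      proof clarify
        fix u v assume "w = u @ v"
        show "(u, v) \<in> (\<lambda>i. (take i (u @ v), drop i (u @ v))) ` {..length (u @ v)}"
          by (rule image_eqI[of _ _ "length u"]) auto
      qed
    qed auto
    finally show ?thesis .
  qed
  have supp: "{w. fh w \<noteq> 0} \<subseteq> S"
  proof
    fix w assume "w \<in> {w. fh w \<noteq> 0}"
    then have "{x \<in> ?F \<times> ?H. (\<lambda>(u, v). u @ v) x = w} \<noteq> {}" unfolding fh by force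
    then show "w \<in> S" by (auto simp: S_def)
  qed
  let ?w = "\<lambda>w. prod_list (map g w)"
  have "eval g fh = (\<Sum>w\<in>S. \<kappa> (fh w) * ?w w)" by (rule eval_superset[OF fin(2) supp])
  also have "\<dots> = (\<Sum>w\<in>S. \<Sum>x \<in> {x \<in> ?F \<times> ?H. (\<lambda>(u, v). u @ v) x = w}. \<kappa> (f (fst x)) * ?w (fst x) * (\<kappa> (h (snd x)) * ?w (snd x)))"
  proof (intro sum.cong refl)
    fix w
    show "\<kappa> (fh w) * ?w w = (\<Sum>x \<in> {x \<in> ?F \<times> ?H. (\<lambda>(u, v). u @ v) x = w}. \<kappa> (f (fst x)) * ?w (fst x) * (\<kappa> (h (snd x)) * ?w (snd x)))"
      unfolding fh \<kappa>_sum sum_distrib_right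
    proof (intro sum.cong refl)
      fix x assume "x \<in> {x \<in> ?F \<times> ?H. (\<lambda>(u, v). u @ v) x = w}"
      then obtain u v where x: "x = (u, v)" "w = u @ v" by auto
      have "\<kappa> (f u * h v) * (?w u * ?w v) = \<kappa> (f u) * (?w u * (\<kappa> (h v) * ?w v))"
        by (simp only: \<kappa>_left_commute[of "?w u"] \<kappa>_mult mult.assoc)
      then show "\<kappa> (case x of (u, v) \<Rightarrow> f u * h v) * ?w w = \<kappa> (f (fst x)) * ?w (fst x) * (\<kappa> (h (snd x)) * ?w (snd x))"
        by (simp add: x mult.assoc)
    qed
  qed
  also have "\<dots> = (\<Sum>x\<in>?F \<times> ?H. \<kappa> (f (fst x)) * ?w (fst x) * (\<kappa> (h (snd x)) * ?w (snd x)))"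
    by (rule sum.group[OF fin]) (simp add: S_def)
  also have "\<dots> = eval g f * eval g h"
    unfolding eval_def sum_product sum.cartesian_product by (intro sum.cong) auto
  finally show ?thesis unfolding fh_def .
qed

end

section \<open>Linear operators on spaces of functions\<close>

text \<open>
  The space is a type of functions, never the zero space, so that the operators form a ring with
  \<open>1 \<noteq> 0\<close>.
\<close>

typedef (overloaded) ('x, 'k::field) op =
  "{f :: ('x \<Rightarrow> 'k) \<Rightarrow> ('x \<Rightarrow> 'k). (\<forall>a b. f (\<lambda>x. a x + b x) = (\<lambda>x. f a x + f b x)) \<and>
     (\<forall>c a. f (\<lambda>x. c * a x) = (\<lambda>x. c * f a x))}"
  morphisms apply_op Op
  by (rule exI[of _ "\<lambda>a. a"]) simp

setup_lifting type_definition_op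

lemma op_eqI: "(\<And>a x. apply_op S a x = apply_op T a x) \<Longrightarrow> S = T"
  by (subst apply_op_inject[symmetric]) (auto intro!: ext)

lemma apply_op_add: "apply_op T (\<lambda>x. a x + b x) = (\<lambda>x. apply_op T a x + apply_op T b x)"
  using apply_op[of T] by simp

lemma apply_op_scale: "apply_op T (\<lambda>x. c * a x) = (\<lambda>x. c * apply_op T a x)"
  using apply_op[of T] by simp

instantiation op :: (type, field) ring_1
begin

lift_definition zero_op :: "('a, 'b) op" is "\<lambda>_ _. 0" by simp
lift_definition one_op :: "('a, 'b) op" is "\<lambda>a. a" by simp
lift_definition plus_op :: "('a, 'b) op \<Rightarrow> ('a, 'b) op \<Rightarrow> ('a, 'b) op" is "\<lambda>f g a x. f a x + g a x"
  by (simp add: algebra_simps)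
lift_definition minus_op :: "('a, 'b) op \<Rightarrow> ('a, 'b) op \<Rightarrow> ('a, 'b) op" is "\<lambda>f g a x. f a x - g a x"
  by (simp add: algebra_simps)
lift_definition uminus_op :: "('a, 'b) op \<Rightarrow> ('a, 'b) op" is "\<lambda>f a x. - f a x"
  by simp
lift_definition times_op :: "('a, 'b) op \<Rightarrow> ('a, 'b) op \<Rightarrow> ('a, 'b) op" is "\<lambda>f g a. f (g a)"
  by simp

instance
proof
  show "(0 :: ('a, 'b) op) \<noteq> 1"
  proof
    assume "(0 :: ('a, 'b) op) = 1"
    then have "apply_op (0 :: ('a, 'b) op) (\<lambda>_. 1) undefined = apply_op (1 :: ('a, 'b) op) (\<lambda>_. 1) undefined" by simp
    then show False by (simp add: zero_op.rep_eq one_op.rep_eq)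
  qed
qed (rule op_eqI; simp add: zero_op.rep_eq one_op.rep_eq plus_op.rep_eq minus_op.rep_eq uminus_op.rep_eq
  times_op.rep_eq apply_op_add algebra_simps)+

end

lift_definition scal :: "'k::field \<Rightarrow> ('x, 'k) op" is "\<lambda>c a x. c * a x"
  by (simp add: algebra_simps)

lemma central_scalars_scal: "central_scalars (scal :: 'k::field \<Rightarrow> ('x, 'k) op)"
  by unfold_locales
    (rule op_eqI; simp add: scal.rep_eq plus_op.rep_eq times_op.rep_eq one_op.rep_eq apply_op_scale algebra_simps)+

lemma apply_op_sum: "apply_op (sum f A) a x = (\<Sum>i\<in>A. apply_op (f i) a x)"
  by (induction A rule: infinite_finite_induct) (auto simp: zero_op.rep_eq plus_op.rep_eq)

section \<open>Homomorphisms from the Leavitt path algebra\<close>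

locale lpa_hom = row_finite_graph E + central_scalars \<kappa> +
    nonunital_ring_hom "lpa_free TYPE('k) E" \<rho>
  for E :: "('v, 'e) pre_digraph" and \<kappa> :: "'k::field \<Rightarrow> 'r::ring_1"
    and \<rho> :: "(('v, 'e) lpa_gen list \<Rightarrow> 'k) \<Rightarrow> 'r" +
  assumes \<rho>_smult: "f \<in> carrier (lpa_free TYPE('k) E) \<Longrightarrow> \<rho> (c \<odot>\<^bsub>lpa_free TYPE('k) E\<^esub> f) = \<kappa> c * \<rho> f"
begin

abbreviation F where "F \<equiv> lpa_free TYPE('k) E"
abbreviation J where "J \<equiv> gen_algebra_ideal F (lpa_relations TYPE('k) E)"
abbreviation V where "V v \<equiv> \<rho> (free_gen (Vertex v))"
abbreviation Ed where "Ed e \<equiv> \<rho> (free_gen (Edge e))"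
abbreviation Gh where "Gh e \<equiv> \<rho> (free_gen (Ghost e))"

lemma gens: "v \<in> verts E \<Longrightarrow> free_gen (Vertex v) \<in> carrier F"
  "e \<in> arcs E \<Longrightarrow> free_gen (Edge e) \<in> carrier F" "e \<in> arcs E \<Longrightarrow> free_gen (Ghost e) \<in> carrier F"
  by (auto simp: lpa_free_def lpa_gens_def intro!: free_gen_in_free_algebra)

lemma smult_closed: "f \<in> carrier F \<Longrightarrow> c \<odot>\<^bsub>F\<^esub> f \<in> carrier F"
  unfolding lpa_free_def by (rule free_algebra_smult_closed)

lemma relation_values:
  "\<lbrakk>v \<in> verts E; w \<in> verts E\<rbrakk> \<Longrightarrow>
    \<rho> (free_gen (Vertex v) \<otimes>\<^bsub>F\<^esub> free_gen (Vertex w) \<ominus>\<^bsub>F\<^esub> (if v = w then free_gen (Vertex v) else \<zero>\<^bsub>F\<^esub>)) =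
    V v * V w - (if v = w then V v else 0)"
  "e \<in> arcs E \<Longrightarrow> \<rho> (free_gen (Vertex (tail E e)) \<otimes>\<^bsub>F\<^esub> free_gen (Edge e) \<ominus>\<^bsub>F\<^esub> free_gen (Edge e)) = V (tail E e) * Ed e - Ed e"
  "e \<in> arcs E \<Longrightarrow> \<rho> (free_gen (Edge e) \<otimes>\<^bsub>F\<^esub> free_gen (Vertex (head E e)) \<ominus>\<^bsub>F\<^esub> free_gen (Edge e)) = Ed e * V (head E e) - Ed e"
  "e \<in> arcs E \<Longrightarrow> \<rho> (free_gen (Vertex (head E e)) \<otimes>\<^bsub>F\<^esub> free_gen (Ghost e) \<ominus>\<^bsub>F\<^esub> free_gen (Ghost e)) = V (head E e) * Gh e - Gh e"
  "e \<in> arcs E \<Longrightarrow> \<rho> (free_gen (Ghost e) \<otimes>\<^bsub>F\<^esub> free_gen (Vertex (tail E e)) \<ominus>\<^bsub>F\<^esub> free_gen (Ghost e)) = Gh e * V (tail E e) - Gh e"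
  "\<lbrakk>e \<in> arcs E; e' \<in> arcs E\<rbrakk> \<Longrightarrow>
    \<rho> (free_gen (Ghost e) \<otimes>\<^bsub>F\<^esub> free_gen (Edge e') \<ominus>\<^bsub>F\<^esub> (if e = e' then free_gen (Vertex (head E e)) else \<zero>\<^bsub>F\<^esub>)) =
    Gh e * Ed e' - (if e = e' then V (head E e) else 0)"
  "v \<in> verts E \<Longrightarrow> \<rho> (free_gen (Vertex v) \<ominus>\<^bsub>F\<^esub> (\<Oplus>\<^bsub>F\<^esub>e \<in> out_arcs E v. free_gen (Edge e) \<otimes>\<^bsub>F\<^esub> free_gen (Ghost e))) =
    V v - (\<Sum>e\<in>out_arcs E v. Ed e * Gh e)"
proof goal_cases
  case 7
  have "finsum F (\<lambda>e. free_gen (Edge e) \<otimes>\<^bsub>F\<^esub> free_gen (Ghost e)) (out_arcs E v) \<in> carrier F"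
    by (intro finsum_closed) (auto intro!: mult_closed gens)
  moreover have "\<rho> (finsum F (\<lambda>e. free_gen (Edge e) \<otimes>\<^bsub>F\<^esub> free_gen (Ghost e)) (out_arcs E v)) =
      (\<Sum>e\<in>out_arcs E v. \<rho> (free_gen (Edge e) \<otimes>\<^bsub>F\<^esub> free_gen (Ghost e)))"
    using row_finite[OF 7] by (intro h_finsum) (auto intro!: mult_closed gens)
  moreover have "\<dots> = (\<Sum>e\<in>out_arcs E v. Ed e * Gh e)"
    by (intro sum.cong refl) (simp add: h_mult gens)
  ultimately show ?case using gens(1)[OF 7] by (simp add: h_minus)
qed (simp_all add: h_minus h_mult mult_closed gens h_zero)

lemma leavitt_family_if_relations:
  assumes rel: "\<And>x. x \<in> lpa_relations TYPE('k) E \<Longrightarrow> \<rho> x = 0"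
  shows "leavitt_family E \<kappa> V Ed Gh"
proof (intro leavitt_family.intro row_finite_graph_axioms central_scalars_axioms leavitt_family_axioms.intro)
  fix v w assume vw: "v \<in> verts E" "w \<in> verts E"
  have "free_gen (Vertex v) \<otimes>\<^bsub>F\<^esub> free_gen (Vertex w) \<ominus>\<^bsub>F\<^esub> (if v = w then free_gen (Vertex v) else \<zero>\<^bsub>F\<^esub>)
      \<in> lpa_relations TYPE('k) E" unfolding lpa_relations_def Let_def using vw by blast
  from rel[OF this] show "V v * V w = (if v = w then V v else 0)" unfolding relation_values(1)[OF vw] by simp
next
  fix e assume e: "e \<in> arcs E"
  have "free_gen (Vertex (tail E e)) \<otimes>\<^bsub>F\<^esub> free_gen (Edge e) \<ominus>\<^bsub>F\<^esub> free_gen (Edge e) \<in> lpa_relations TYPE('k) E"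
    unfolding lpa_relations_def Let_def using e by blast
  from rel[OF this] show "V (tail E e) * Ed e = Ed e" unfolding relation_values(2)[OF e] by simp
  have "free_gen (Edge e) \<otimes>\<^bsub>F\<^esub> free_gen (Vertex (head E e)) \<ominus>\<^bsub>F\<^esub> free_gen (Edge e) \<in> lpa_relations TYPE('k) E"
    unfolding lpa_relations_def Let_def using e by blast
  from rel[OF this] show "Ed e * V (head E e) = Ed e" unfolding relation_values(3)[OF e] by simp
  have "free_gen (Vertex (head E e)) \<otimes>\<^bsub>F\<^esub> free_gen (Ghost e) \<ominus>\<^bsub>F\<^esub> free_gen (Ghost e) \<in> lpa_relations TYPE('k) E"
    unfolding lpa_relations_def Let_def using e by blast
  from rel[OF this] show "V (head E e) * Gh e = Gh e" unfolding relation_values(4)[OF e] by simp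
  have "free_gen (Ghost e) \<otimes>\<^bsub>F\<^esub> free_gen (Vertex (tail E e)) \<ominus>\<^bsub>F\<^esub> free_gen (Ghost e) \<in> lpa_relations TYPE('k) E"
    unfolding lpa_relations_def Let_def using e by blast
  from rel[OF this] show "Gh e * V (tail E e) = Gh e" unfolding relation_values(5)[OF e] by simp
next
  fix e e' assume e: "e \<in> arcs E" "e' \<in> arcs E"
  have "free_gen (Ghost e) \<otimes>\<^bsub>F\<^esub> free_gen (Edge e') \<ominus>\<^bsub>F\<^esub> (if e = e' then free_gen (Vertex (head E e)) else \<zero>\<^bsub>F\<^esub>)
      \<in> lpa_relations TYPE('k) E" unfolding lpa_relations_def Let_def using e by blast
  from rel[OF this] show "Gh e * Ed e' = (if e = e' then V (head E e) else 0)" unfolding relation_values(6)[OF e] by simp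
next
  fix v assume v: "v \<in> verts E" "out_arcs E v \<noteq> {}"
  have "free_gen (Vertex v) \<ominus>\<^bsub>F\<^esub> (\<Oplus>\<^bsub>F\<^esub>e \<in> out_arcs E v. free_gen (Edge e) \<otimes>\<^bsub>F\<^esub> free_gen (Ghost e))
      \<in> lpa_relations TYPE('k) E" unfolding lpa_relations_def Let_def using v by blast
  from rel[OF this] show "V v = (\<Sum>e\<in>out_arcs E v. Ed e * Gh e)" unfolding relation_values(7)[OF v(1)] by simp
qed

lemma relations_if_leavitt_family:
  assumes "leavitt_family E \<kappa> V Ed Gh" and x: "x \<in> lpa_relations TYPE('k) E"
  shows "\<rho> x = 0"
proof -
  interpret L: leavitt_family E \<kappa> V Ed Gh by fact
  from x show ?thesis
    unfolding lpa_relations_def Let_def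
  proof (elim UnE CollectE exE conjE, goal_cases)
    case (1 v w) then show ?thesis using relation_values(1)[of v w] L.V_mult[of v w] by simp
  next
    case (2 e) then show ?thesis using relation_values(2)[of e] L.V_Ed[of e] by simp
  next
    case (3 e) then show ?thesis using relation_values(3)[of e] L.Ed_V[of e] by simp
  next
    case (4 e) then show ?thesis using relation_values(4)[of e] L.V_Gh[of e] by simp
  next
    case (5 e) then show ?thesis using relation_values(5)[of e] L.Gh_V[of e] by simp
  next
    case (6 e e') then show ?thesis using relation_values(6)[of e e'] L.Gh_Ed[of e e'] by simp
  next
    case (7 v) then show ?thesis using relation_values(7)[of v] L.V_sum[of v] by simp
  qed
qed

lemma kernel_ideal: "algebra_ideal F {x \<in> carrier F. \<rho> x = 0}"
  unfolding algebra_ideal_def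
  by (auto simp: h_mult mult_closed h_add h_uminus h_zero \<rho>_smult smult_closed
      intro!: additive_subgroup.intro add.subgroupI simp flip: a_inv_def)

lemma hom_kernel:
  assumes rel: "\<And>x. x \<in> lpa_relations TYPE('k) E \<Longrightarrow> \<rho> x = 0"
  shows "nonunital_ring_hom_kernel F \<rho> J"
proof (intro nonunital_ring_hom_kernel.intro nonunital_ring_hom_axioms nonunital_ring_hom_kernel_axioms.intro)
  show "algebra_ideal F J"
    using lpa_relations_subset smult_closed by (intro algebra_ideal_gen_algebra_ideal) (auto intro: nonunital_ring_axioms)
  fix x assume "x \<in> J"
  moreover have "J \<subseteq> {x \<in> carrier F. \<rho> x = 0}"
    using lpa_relations_subset rel by (intro gen_algebra_ideal_least kernel_ideal) auto
  ultimately show "\<rho> x = 0" by blast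
qed

text \<open>
  The span of the monomials is closed under products and contains the generators; conversely the
  image is a subalgebra that contains all monomials.
\<close>

lemma image_eq_lin_span:
  assumes "leavitt_family E \<kappa> V Ed Gh"
  shows "\<rho> ` carrier F = lin_span (leavitt_family.monomials E V Ed Gh (verts E))"
proof
  interpret L: leavitt_family E \<kappa> V Ed Gh by fact
  show "\<rho> ` carrier F \<subseteq> L.R"
  proof
    fix y assume "y \<in> \<rho> ` carrier F"
    then obtain f where f: "f \<in> carrier (free_algebra TYPE('k) (lpa_gens E))" "y = \<rho> f" by (auto simp: lpa_free_def)
    have "\<rho> f \<in> L.R" using f(1)
    proof (induction rule: free_algebra_induct)
      case zero
      have "(\<lambda>_. 0) = \<zero>\<^bsub>F\<^esub>" by (simp add: lpa_free_def free_algebra_def)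
      then show ?case using h_zero by (simp add: lin_span_zero)
    next
      case (gen x)
      then show ?case by (auto simp: lpa_gens_def L.gens_in_R)
    next
      case (add f g)
      then show ?case using h_add lin_span_add by (simp add: lpa_free_def)
    next
      case (mult f g)
      then show ?case using h_mult subrngD(4)[OF L.subrng_R] by (simp add: lpa_free_def)
    next
      case (scale c f)
      then show ?case using \<rho>_smult lin_span_scale by (simp add: lpa_free_def)
    qed
    then show "y \<in> L.R" using f by simp
  qed
  have closed: "x + y \<in> \<rho> ` carrier F" "x * y \<in> \<rho> ` carrier F" "\<kappa> c * x \<in> \<rho> ` carrier F"
    if xy: "x \<in> \<rho> ` carrier F" "y \<in> \<rho> ` carrier F" for x y c
  proof -
    obtain f g where fg: "f \<in> carrier F" "g \<in> carrier F" "x = \<rho> f" "y = \<rho> g" using xy by blast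
    have "x + y = \<rho> (f \<oplus>\<^bsub>F\<^esub> g)" "x * y = \<rho> (f \<otimes>\<^bsub>F\<^esub> g)" "\<kappa> c * x = \<rho> (c \<odot>\<^bsub>F\<^esub> f)"
      using fg by (simp_all add: h_add h_mult \<rho>_smult)
    then show "x + y \<in> \<rho> ` carrier F" "x * y \<in> \<rho> ` carrier F" "\<kappa> c * x \<in> \<rho> ` carrier F"
      using fg by (auto intro!: imageI mult_closed smult_closed)
  qed
  have ed: "L.ed u p \<in> \<rho> ` carrier F" "L.gh u p \<in> \<rho> ` carrier F" if "awalk u p w" for u p w
    using that by (induction p arbitrary: u) (auto simp: awalk_simps gens intro!: closed(2))
  show "L.R \<subseteq> \<rho> ` carrier F"
  proof
    fix y assume "y \<in> L.R"
    then show "y \<in> \<rho> ` carrier F"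
    proof (induction rule: lin_span.induct)
      case lin_span_zero
      then show ?case using h_zero zero_closed by (metis imageI)
    next
      case (lin_span_step b x c)
      then have b: "b \<in> \<rho> ` carrier F" unfolding L.monomials_def using ed closed(2) by blast
      show ?case by (rule closed(1)[OF closed(3)[OF b b] lin_span_step.IH])
    qed
  qed
qed

end

text \<open>
  The universal property of the Leavitt path algebra.
\<close>

lemma (in leavitt_family) universal_hom:
  shows "\<exists>h. nonunital_ring_hom (leavitt_path_algebra TYPE('k) E) h \<and>
    h ` carrier (leavitt_path_algebra TYPE('k) E) = R"
proof -
  define g where "g x = (case x of Vertex v \<Rightarrow> V v | Edge e \<Rightarrow> Ed e | Ghost e \<Rightarrow> Gh e)" for x
  let ?F = "lpa_free TYPE('k) E"
  have fin: "finite {w. f w \<noteq> 0}" if "f \<in> carrier ?F" for f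
    using that by (simp add: lpa_free_def free_algebra_def)
  interpret H: lpa_hom E \<kappa> "eval g"
  proof (intro lpa_hom.intro row_finite_graph_axioms central_scalars_axioms lpa_hom_axioms.intro
      nonunital_ring_hom.intro nonunital_ring_hom_axioms.intro)
    show "nonunital_ring ?F" unfolding lpa_free_def by (rule nonunital_ring_free_algebra)
    fix f h assume fh: "f \<in> carrier ?F" "h \<in> carrier ?F"
    have "f \<oplus>\<^bsub>?F\<^esub> h = (\<lambda>w. f w + h w)" "f \<otimes>\<^bsub>?F\<^esub> h = (\<lambda>w. \<Sum>i\<le>length w. f (take i w) * h (drop i w))"
      by (simp_all add: lpa_free_def free_algebra_def)
    then show "eval g (f \<oplus>\<^bsub>?F\<^esub> h) = eval g f + eval g h" "eval g (f \<otimes>\<^bsub>?F\<^esub> h) = eval g f * eval g h"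
      by (simp_all only: eval_add[OF fin[OF fh(1)] fin[OF fh(2)]] eval_mult[OF fin[OF fh(1)] fin[OF fh(2)]])
  next
    fix f c assume f: "f \<in> carrier ?F"
    have "c \<odot>\<^bsub>?F\<^esub> f = (\<lambda>w. c * f w)" by (simp add: lpa_free_def free_algebra_def)
    then show "eval g (c \<odot>\<^bsub>?F\<^esub> f) = \<kappa> c * eval g f"
      by (simp only: eval_scale[OF fin[OF f]])
  qed
  have eq: "H.V = V" "H.Ed = Ed" "H.Gh = Gh" by (simp_all add: eval_gen g_def fun_eq_iff)
  have fam: "leavitt_family E \<kappa> H.V H.Ed H.Gh" unfolding eq by unfold_locales
  interpret K: nonunital_ring_hom_kernel ?F "eval g" H.J
    using H.relations_if_leavitt_family[OF fam] by (rule H.hom_kernel)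
  show ?thesis
    unfolding leavitt_path_algebra_def
  proof (intro exI conjI)
    show "nonunital_ring_hom (quotient_algebra ?F H.J) K.induced" by (rule K.induced_hom)
    show "K.induced ` carrier (quotient_algebra ?F H.J) = R"
      using K.induced_image H.image_eq_lin_span[OF fam] unfolding eq by (rule trans)
  qed
qed

section \<open>Representations by linear operators\<close>

text \<open>
  Choose a basis of \<open>J\<close>, extend it to one of \<open>F1\<close> and then to one of the whole space, and let \<open>\<pi>\<close> be the
  projection to the span of the basis vectors of \<open>F1\<close> that do not belong to \<open>J\<close>.
\<close>

lemma projection_modulo_subspace:
  fixes J F1 :: "('x \<Rightarrow> 'k::field) set"
  assumes J: "(\<lambda>_. 0) \<in> J" "\<And>a b. a \<in> J \<Longrightarrow> b \<in> J \<Longrightarrow> (\<lambda>x. a x + b x) \<in> J" "\<And>c a. a \<in> J \<Longrightarrow> (\<lambda>x. c * a x) \<in> J"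
    and F1: "(\<lambda>_. 0) \<in> F1" "\<And>a b. a \<in> F1 \<Longrightarrow> b \<in> F1 \<Longrightarrow> (\<lambda>x. a x + b x) \<in> F1" "\<And>c a. a \<in> F1 \<Longrightarrow> (\<lambda>x. c * a x) \<in> F1"
    and sub: "J \<subseteq> F1"
  shows "\<exists>\<pi> :: ('x, 'k) op. (\<forall>a. apply_op \<pi> a \<in> F1) \<and> (\<forall>a\<in>J. apply_op \<pi> a = (\<lambda>_. 0)) \<and>
    (\<forall>a\<in>F1. (\<lambda>x. apply_op \<pi> a x - a x) \<in> J)"
proof -
  define sc where "sc = (\<lambda>(c::'k) (f::'x \<Rightarrow> 'k) x. c * f x)"
  interpret vs: vector_space sc
    by unfold_locales (auto simp: sc_def fun_eq_iff algebra_simps)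
  interpret vp: vector_space_pair sc sc ..
  have sJ: "vs.subspace J" and sF: "vs.subspace F1"
    using J F1 by (auto intro!: vs.subspaceI simp: plus_fun_def zero_fun_def) (auto simp: sc_def)
  obtain B where B: "B \<subseteq> J" "vs.independent B" "J \<subseteq> vs.span B"
    using vs.maximal_independent_subset[of J] by blast
  obtain B1 where B1: "B \<subseteq> B1" "B1 \<subseteq> F1" "vs.independent B1" "F1 \<subseteq> vs.span B1"
    using vs.maximal_independent_subset_extend[of B F1] B sub by blast
  define B2 where "B2 = vs.extend_basis B1"
  have B2: "B1 \<subseteq> B2" "vs.independent B2" "vs.span B2 = UNIV"
    unfolding B2_def using vs.extend_basis_superset vs.independent_extend_basis vs.span_extend_basis B1(3) by auto
  obtain p where p: "Vector_Spaces.linear sc sc p" "\<forall>b\<in>B2. p b = (if b \<in> B1 - B then b else 0)"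
    using vp.linear_independent_extend[OF B2(2), of "\<lambda>b. if b \<in> B1 - B then b else 0"] by blast
  interpret p: Vector_Spaces.linear sc sc p by (rule p(1))
  have p_add: "p (\<lambda>x. a x + b x) = (\<lambda>x. p a x + p b x)" for a b
    using p.add[of a b] by (simp add: plus_fun_def)
  have p_scale: "p (\<lambda>x. c * a x) = (\<lambda>x. c * p a x)" for c a
    using p.scale[of c a] by (simp add: sc_def)
  have inF: "p a \<in> F1" for a
  proof -
    have "a \<in> vs.span B2" using B2(3) by simp
    then show ?thesis
    proof (induction rule: vs.span_induct_alt)
      case base
      show ?case unfolding p.zero by (rule vs.subspace_0[OF sF])
    next
      case (step c b y)
      have "p b \<in> F1" using step p(2) B1(2) sF by (auto simp: vs.subspace_0)
      then show ?case unfolding p.add p.scale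
        by (intro vs.subspace_add[OF sF] vs.subspace_scale[OF sF] step.IH)
    qed
  qed
  have onJ: "p a = 0" if "a \<in> J" for a
  proof -
    have "a \<in> vs.span B" using that B(3) by blast
    then show ?thesis
    proof (induction rule: vs.span_induct_alt)
      case base
      show ?case by (rule p.zero)
    next
      case (step c b y)
      have "b \<in> B2" using step B1(1) B2(1) by blast
      then have "p b = 0" using p(2) step by simp
      then show ?case unfolding p.add p.scale step.IH by (simp only: vs.scale_zero_right add_0)
    qed
  qed
  have diff: "p a - a \<in> J" if "a \<in> F1" for a
  proof -
    have "a \<in> vs.span B1" using that B1(4) by blast
    then show ?thesis
    proof (induction rule: vs.span_induct_alt)
      case base
      show ?case unfolding p.zero diff_self by (rule vs.subspace_0[OF sJ])
    next
      case (step c b y)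
      have "b \<in> B2" using step B2(1) by blast
      then have "p b - b \<in> J" using p(2) step B(1) sJ by (auto simp: vs.subspace_0 vs.subspace_neg subset_iff)
      then have "sc c (p b - b) + (p y - y) \<in> J"
        by (intro vs.subspace_add[OF sJ] vs.subspace_scale[OF sJ] step.IH)
      also have "sc c (p b - b) + (p y - y) = p (sc c b + y) - (sc c b + y)"
        unfolding p.add p.scale vs.scale_right_diff_distrib by (simp only: add_diff_add)
      finally show ?case .
    qed
  qed
  have ap: "apply_op (Op p) = p" using p_add p_scale by (intro Op_inverse) simp
  show ?thesis
    using inF onJ diff by (intro exI[of _ "Op p"]) (auto simp: ap zero_fun_def fun_diff_def)
qed

text \<open>
  This is the left regular representation of \<open>L(E)\<close> on its unitization \<open>F1 / J\<close>, where \<open>J\<close> is the ideal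
  of relations in the free algebra \<open>F\<close> and \<open>F1 = F \<oplus> K\<delta>\<close> includes the empty word \<open>\<delta>\<close>.  The quotient space is
  realised as the image of a projection \<open>\<pi>\<close>, and \<open>f\<close> acts as \<open>\<pi> \<circ> (f \<cdot>) \<circ> \<pi>\<close>.  It is faithful because \<open>f\<close>
  sends \<open>\<delta>\<close> to \<open>f + J\<close>.
\<close>

lemma (in row_finite_graph) faithful_hom:
  "\<exists>(h :: _ \<Rightarrow> (('v, 'e) lpa_gen list, 'k::field) op) V Ed Gh.
    nonunital_ring_hom (leavitt_path_algebra TYPE('k) E) h \<and>
    inj_on h (carrier (leavitt_path_algebra TYPE('k) E)) \<and>
    leavitt_family E scal V Ed Gh \<and>
    h ` carrier (leavitt_path_algebra TYPE('k) E) = central_scalars.lin_span scal (leavitt_family.monomials E V Ed Gh (verts E))"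
proof -
  let ?F = "lpa_free TYPE('k) E"
  let ?J = "gen_algebra_ideal ?F (lpa_relations TYPE('k) E)"
  interpret F: nonunital_ring ?F unfolding lpa_free_def by (rule nonunital_ring_free_algebra)
  have smult: "c \<odot>\<^bsub>?F\<^esub> f \<in> carrier ?F" if "f \<in> carrier ?F" for c f
    using that unfolding lpa_free_def by (rule free_algebra_smult_closed)
  have ideal: "algebra_ideal ?F ?J"
    using lpa_relations_subset smult by (intro algebra_ideal_gen_algebra_ideal F.nonunital_ring_axioms) auto
  have ops: "f \<oplus>\<^bsub>?F\<^esub> g = (\<lambda>w. f w + g w)" "c \<odot>\<^bsub>?F\<^esub> f = (\<lambda>w. c * f w)" "\<zero>\<^bsub>?F\<^esub> = (\<lambda>_. 0)" for f g c
    by (simp_all add: lpa_free_def free_algebra_def)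
  have m_def: "f \<otimes>\<^bsub>?F\<^esub> g = (\<lambda>w. \<Sum>i\<le>length w. f (take i w) * g (drop i w))" for f g
    by (simp add: lpa_free_def free_algebra_def)
  have m_assoc: "f \<otimes>\<^bsub>?F\<^esub> g \<otimes>\<^bsub>?F\<^esub> n = f \<otimes>\<^bsub>?F\<^esub> (g \<otimes>\<^bsub>?F\<^esub> n)" for f g n
    unfolding lpa_free_def by (rule free_algebra_mult_assoc)
  have m_add_right: "f \<otimes>\<^bsub>?F\<^esub> (\<lambda>w. a w + b w) = (\<lambda>w. (f \<otimes>\<^bsub>?F\<^esub> a) w + (f \<otimes>\<^bsub>?F\<^esub> b) w)" for f a b
    by (simp add: m_def distrib_left sum.distrib)
  have m_scale_right: "f \<otimes>\<^bsub>?F\<^esub> (\<lambda>w. c * a w) = (\<lambda>w. c * (f \<otimes>\<^bsub>?F\<^esub> a) w)" for f a c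
    by (simp add: m_def sum_distrib_left mult.left_commute)
  have m_add_left: "(\<lambda>w. f w + g w) \<otimes>\<^bsub>?F\<^esub> a = (\<lambda>w. (f \<otimes>\<^bsub>?F\<^esub> a) w + (g \<otimes>\<^bsub>?F\<^esub> a) w)" for f g a
    by (simp add: m_def distrib_right sum.distrib)
  have m_scale_left: "(\<lambda>w. c * f w) \<otimes>\<^bsub>?F\<^esub> a = (\<lambda>w. c * (f \<otimes>\<^bsub>?F\<^esub> a) w)" for f a c
    by (simp add: m_def sum_distrib_left mult.assoc)
  have J_carrier: "f \<in> carrier ?F" if "f \<in> ?J" for f
    using ideal that by (auto simp: algebra_ideal_def dest: additive_subgroup.a_Hcarr)
  have J_add: "(\<lambda>w. f w + g w) \<in> ?J" if "f \<in> ?J" "g \<in> ?J" for f g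
    using ideal that additive_subgroup.a_closed[of ?J ?F f g] by (simp add: algebra_ideal_def ops)
  have J_scale: "(\<lambda>w. c * f w) \<in> ?J" if "f \<in> ?J" for f c
    using ideal that unfolding algebra_ideal_def ops by blast
  have J_zero: "(\<lambda>_. 0) \<in> ?J"
    using ideal additive_subgroup.zero_closed[of ?J ?F] by (simp add: algebra_ideal_def ops)
  have J_mult: "f \<otimes>\<^bsub>?F\<^esub> g \<in> ?J" "g \<otimes>\<^bsub>?F\<^esub> f \<in> ?J" if "f \<in> ?J" "g \<in> carrier ?F" for f g
    using ideal that unfolding algebra_ideal_def by blast+
  define F1 where "F1 = {f :: ('v, 'e) lpa_gen list \<Rightarrow> 'k. finite {w. f w \<noteq> 0} \<and> {w. f w \<noteq> 0} \<subseteq> lists (lpa_gens E)}"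
  define \<delta> where "\<delta> w = (if w = [] then 1 else 0 :: 'k)" for w :: "('v, 'e) lpa_gen list"
  have F_F1: "carrier ?F \<subseteq> F1" by (auto simp: lpa_free_def free_algebra_def F1_def)
  have \<delta>_F1: "\<delta> \<in> F1" by (auto simp: F1_def \<delta>_def)
  have F1_add: "(\<lambda>w. f w + g w) \<in> F1" if "f \<in> F1" "g \<in> F1" for f g
  proof -
    have "{w. f w + g w \<noteq> 0} \<subseteq> {w. f w \<noteq> 0} \<union> {w. g w \<noteq> 0}" by auto
    then show ?thesis using that finite_subset unfolding F1_def by fastforce
  qed
  have F1_scale: "(\<lambda>w. c * f w) \<in> F1" if "f \<in> F1" for f c
  proof -
    have "{w. c * f w \<noteq> 0} \<subseteq> {w. f w \<noteq> 0}" by auto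
    then show ?thesis using that finite_subset unfolding F1_def by fastforce
  qed
  have m_\<delta>: "f \<otimes>\<^bsub>?F\<^esub> \<delta> = f" for f
  proof
    fix w
    have "(f \<otimes>\<^bsub>?F\<^esub> \<delta>) w = (\<Sum>i\<le>length w. if i = length w then f w else 0)"
      unfolding m_def \<delta>_def by (intro sum.cong refl) auto
    then show "(f \<otimes>\<^bsub>?F\<^esub> \<delta>) w = f w" by simp
  qed
  have split: "n([] := 0) \<in> carrier ?F" "n = (\<lambda>w. (n([] := 0)) w + n [] * \<delta> w)" if "n \<in> F1" for n
  proof -
    have sub: "{w. (n([] := 0)) w \<noteq> 0} \<subseteq> {w. n w \<noteq> 0} - {[]}" by auto
    have n: "finite {w. n w \<noteq> 0}" "{w. n w \<noteq> 0} \<subseteq> lists (lpa_gens E)"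
      using that by (simp_all add: F1_def)
    have "finite {w. (n([] := 0)) w \<noteq> 0}" by (rule finite_subset[OF sub finite_Diff[OF n(1)]])
    moreover have "{w. (n([] := 0)) w \<noteq> 0} \<subseteq> lists (lpa_gens E) - {[]}"
      by (rule subset_trans[OF sub Diff_mono[OF n(2) subset_refl]])
    ultimately show "n([] := 0) \<in> carrier ?F"
      by (simp only: lpa_free_def free_algebra_def partial_object.simps) blast
    show "n = (\<lambda>w. (n([] := 0)) w + n [] * \<delta> w)" by (auto simp: \<delta>_def)
  qed
  have m_split: "f \<otimes>\<^bsub>?F\<^esub> n = (\<lambda>w. (f \<otimes>\<^bsub>?F\<^esub> n([] := 0)) w + n [] * f w)" if "n \<in> F1" for f n
    by (subst split(2)[OF that]) (simp only: m_add_right m_scale_right m_\<delta>)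
  have m_F1: "f \<otimes>\<^bsub>?F\<^esub> n \<in> carrier ?F" if "f \<in> carrier ?F" "n \<in> F1" for f n
  proof -
    have "f \<otimes>\<^bsub>?F\<^esub> n = (f \<otimes>\<^bsub>?F\<^esub> n([] := 0)) \<oplus>\<^bsub>?F\<^esub> (n [] \<odot>\<^bsub>?F\<^esub> f)"
      unfolding ops by (rule m_split[OF that(2)])
    also have "\<dots> \<in> carrier ?F"
      by (rule F.a_closed[OF F.mult_closed[OF that(1) split(1)[OF that(2)]] smult[OF that(1)]])
    finally show ?thesis .
  qed
  have m_JF1: "f \<otimes>\<^bsub>?F\<^esub> n \<in> ?J" if "f \<in> ?J" "n \<in> F1" for f n
    unfolding m_split[OF that(2)] by (intro J_add J_scale J_mult that split(1))
  have "?J \<subseteq> F1" using J_carrier F_F1 by blast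
  have "(\<lambda>_. 0) \<in> F1" by (simp add: F1_def)
  from projection_modulo_subspace[OF J_zero J_add J_scale this F1_add F1_scale \<open>?J \<subseteq> F1\<close>]
  obtain \<pi> :: "(('v, 'e) lpa_gen list, 'k) op" where \<pi>: "\<And>a. apply_op \<pi> a \<in> F1" "\<And>a. a \<in> ?J \<Longrightarrow> apply_op \<pi> a = (\<lambda>_. 0)"
      "\<And>a. a \<in> F1 \<Longrightarrow> (\<lambda>x. apply_op \<pi> a x - a x) \<in> ?J"
    by blast
  define L where "L f = Op (\<lambda>a. f \<otimes>\<^bsub>?F\<^esub> a)" for f :: "('v, 'e) lpa_gen list \<Rightarrow> 'k"
  have L: "apply_op (L f) = (\<lambda>a. f \<otimes>\<^bsub>?F\<^esub> a)" for f
    unfolding L_def by (rule Op_inverse) (simp add: m_add_right m_scale_right)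
  define \<rho> where "\<rho> f = \<pi> * L f * \<pi>" for f
  have \<rho>: "apply_op (\<rho> f) a = apply_op \<pi> (f \<otimes>\<^bsub>?F\<^esub> apply_op \<pi> a)" for f a
    by (simp add: \<rho>_def times_op.rep_eq L)
  \<comment> \<open>Inside a product \<open>\<pi>\<close> may be omitted, since \<open>J\<close> is an ideal that is killed by \<open>\<pi>\<close>.\<close>
  have absorb: "apply_op \<pi> (f \<otimes>\<^bsub>?F\<^esub> apply_op \<pi> k) = apply_op \<pi> (f \<otimes>\<^bsub>?F\<^esub> k)" if "f \<in> carrier ?F" "k \<in> F1" for f k
  proof -
    have "apply_op \<pi> k = (\<lambda>w. k w + (apply_op \<pi> k w - k w))" by simp
    then have "f \<otimes>\<^bsub>?F\<^esub> apply_op \<pi> k = (\<lambda>w. (f \<otimes>\<^bsub>?F\<^esub> k) w + (f \<otimes>\<^bsub>?F\<^esub> (\<lambda>w. apply_op \<pi> k w - k w)) w)"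
      using m_add_right[of f k "\<lambda>w. apply_op \<pi> k w - k w"] by simp
    moreover have "apply_op \<pi> (f \<otimes>\<^bsub>?F\<^esub> (\<lambda>w. apply_op \<pi> k w - k w)) = (\<lambda>_. 0)"
      using J_mult(2)[OF \<pi>(3)[OF that(2)] that(1)] by (rule \<pi>(2))
    ultimately show ?thesis by (simp add: apply_op_add)
  qed
  interpret S: central_scalars "scal :: 'k \<Rightarrow> (('v, 'e) lpa_gen list, 'k) op" by (rule central_scalars_scal)
  interpret H: lpa_hom E "scal :: 'k \<Rightarrow> (('v, 'e) lpa_gen list, 'k) op" \<rho>
  proof (intro lpa_hom.intro row_finite_graph_axioms S.central_scalars_axioms lpa_hom_axioms.intro
      nonunital_ring_hom.intro nonunital_ring_hom_axioms.intro F.nonunital_ring_axioms)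
    fix f g assume fg: "f \<in> carrier ?F" "g \<in> carrier ?F"
    show "\<rho> (f \<oplus>\<^bsub>?F\<^esub> g) = \<rho> f + \<rho> g"
      by (rule op_eqI) (simp add: \<rho> ops m_add_left apply_op_add plus_op.rep_eq)
    show "\<rho> (f \<otimes>\<^bsub>?F\<^esub> g) = \<rho> f * \<rho> g"
    proof (rule op_eqI)
      fix a x
      let ?n = "g \<otimes>\<^bsub>?F\<^esub> apply_op \<pi> a"
      have n: "?n \<in> F1" using m_F1[OF fg(2) \<pi>(1)] F_F1 by blast
      have "apply_op (\<rho> f * \<rho> g) a = apply_op \<pi> (f \<otimes>\<^bsub>?F\<^esub> apply_op \<pi> (apply_op \<pi> ?n))"
        by (simp add: times_op.rep_eq \<rho>)
      also have "\<dots> = apply_op \<pi> (f \<otimes>\<^bsub>?F\<^esub> ?n)" by (simp only: absorb[OF fg(1)] \<pi>(1) n)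
      also have "\<dots> = apply_op (\<rho> (f \<otimes>\<^bsub>?F\<^esub> g)) a" by (simp only: \<rho> m_assoc)
      finally show "apply_op (\<rho> (f \<otimes>\<^bsub>?F\<^esub> g)) a x = apply_op (\<rho> f * \<rho> g) a x" by simp
    qed
  next
    fix f c assume "f \<in> carrier ?F"
    show "\<rho> (c \<odot>\<^bsub>?F\<^esub> f) = scal c * \<rho> f"
      by (rule op_eqI) (simp add: \<rho> ops m_scale_left apply_op_scale times_op.rep_eq scal.rep_eq)
  qed
  have \<rho>_J: "\<rho> f = 0" if "f \<in> ?J" for f
    by (rule op_eqI) (simp add: \<rho> \<pi>(2)[OF m_JF1[OF that \<pi>(1)]] zero_op.rep_eq)
  have rel: "\<rho> x = 0" if "x \<in> lpa_relations TYPE('k) E" for x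
    by (rule \<rho>_J[OF subsetD[OF gen_algebra_ideal_superset that]])
  interpret K: nonunital_ring_hom_kernel ?F \<rho> ?J by (rule H.hom_kernel[OF rel])
  have inj: "inj_on K.induced (carrier (quotient_algebra ?F ?J))"
  proof (rule K.induced_inj)
    fix f assume f: "f \<in> carrier ?F" "\<rho> f = 0"
    have "apply_op \<pi> f = apply_op (\<rho> f) \<delta>" using absorb[OF f(1) \<delta>_F1] by (simp add: \<rho> m_\<delta>)
    also have "\<dots> = (\<lambda>_. 0)" by (simp add: f(2) zero_op.rep_eq)
    finally have "(\<lambda>w. - 1 * f w) \<in> ?J" using \<pi>(3)[of f] f(1) F_F1 by auto
    from J_scale[OF this, of "- 1"] show "f \<in> ?J" by simp
  qed
  have fam: "leavitt_family E scal H.V H.Ed H.Gh" by (rule H.leavitt_family_if_relations[OF rel])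
  have img: "K.induced ` carrier (quotient_algebra ?F ?J) =
      central_scalars.lin_span scal (leavitt_family.monomials E H.V H.Ed H.Gh (verts E))"
    using K.induced_image H.image_eq_lin_span[OF fam] by (rule trans)
  show ?thesis
    unfolding leavitt_path_algebra_def
    by (rule exI[of _ K.induced], rule exI[of _ H.V], rule exI[of _ H.Ed], rule exI[of _ H.Gh])
       (intro conjI K.induced_hom inj fam img)
qed

text \<open>
  Composition with a partial map of the index set.
\<close>

lift_definition pull :: "('x \<Rightarrow> 'x option) \<Rightarrow> ('x, 'k::field) op" is
  "\<lambda>\<phi> a x. case \<phi> x of None \<Rightarrow> 0 | Some y \<Rightarrow> a y"
  by (auto split: option.splits)

lemma pull_mult: "pull \<phi> * pull \<psi> = pull (\<lambda>x. Option.bind (\<phi> x) \<psi>)"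
  by (rule op_eqI) (simp add: times_op.rep_eq pull.rep_eq split: option.splits)

lemma pull_None: "pull (\<lambda>_. None) = 0"
  by (rule op_eqI) (simp add: zero_op.rep_eq pull.rep_eq)

text \<open>
  Each vertex outside \<open>H\<close> acts as the projection to a copy of the space of functions on \<open>\<nat>\<close>.  If \<open>k\<close> edges
  of \<open>E/H\<close> leave \<open>v\<close>, then the copy at \<open>v\<close> is cut into \<open>k\<close> pieces according to residues modulo \<open>k\<close>, and
  the edge with index \<open>i\<close> identifies the piece of residue \<open>i\<close> with the whole copy at its range.  As \<open>H\<close>
  is saturated, a vertex outside \<open>H\<close> that emits edges in \<open>E\<close> also emits edges in \<open>E/H\<close>, so the
  pieces exhaust the copy.
\<close>

lemma (in row_finite_graph) representation:
  assumes H: "hereditary E H" "saturated E H"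
  shows "\<exists>V Ed (Gh :: 'e \<Rightarrow> ('v \<times> nat, 'k::field) op). leavitt_family E scal V Ed Gh \<and>
    (\<forall>v\<in>H. V v = 0) \<and> (\<forall>v\<in>verts E - H. V v \<noteq> 0)"
proof -
  define out where "out v = {e \<in> out_arcs E v. head E e \<notin> H}" for v
  have fin: "finite (out v)" if "v \<in> verts E" for v 
    by (rule finite_subset[OF _ row_finite[OF that]]) (auto simp: out_def)
  have "\<forall>v. \<exists>f. v \<in> verts E \<longrightarrow> bij_betw f (out v) {0..<card (out v)}"
    using fin ex_bij_betw_finite_nat by blast
  from choice[OF this] obtain f where f: "\<And>v. v \<in> verts E \<Longrightarrow> bij_betw (f v) (out v) {0..<card (out v)}" by blast
  define k where "k v = card (out v)" for v
  define ix where "ix e = f (tail E e) e" for e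
  have ix_less: "ix e < k (tail E e)" if "e \<in> arcs E" "head E e \<notin> H" for e
  proof -
    have "e \<in> out (tail E e)" "tail E e \<in> verts E" using that by (auto simp: out_def)
    then show ?thesis using f[of "tail E e"] by (auto simp: ix_def k_def bij_betw_def)
  qed
  have ix_inj: "e = e'" if "e \<in> arcs E" "e' \<in> arcs E" "head E e \<notin> H" "head E e' \<notin> H" "tail E e = tail E e'" "ix e = ix e'" for e e'
  proof -
    have "e \<in> out (tail E e)" "e' \<in> out (tail E e)" "tail E e \<in> verts E" using that by (auto simp: out_def)
    then show ?thesis using f[of "tail E e"] that(5,6) by (auto simp: ix_def bij_betw_def dest: inj_onD)
  qed
  have ix_surj: "\<exists>e\<in>out v. ix e = n" if "v \<in> verts E" "n < k v" for v n
  proof -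
    have "n \<in> f v ` out v" using f[OF that(1)] that(2) by (auto simp: k_def bij_betw_def)
    then show ?thesis by (auto simp: ix_def out_def)
  qed
  have tailH: "tail E e \<notin> H" if "e \<in> arcs E" "head E e \<notin> H" for e
  proof
    assume "tail E e \<in> H"
    moreover have "tail E e \<rightarrow>\<^sup>* head E e" using that by (auto intro!: reachable_adjI simp: arcs_ends_conv)
    ultimately show False using H(1) that(2) unfolding hereditary_def by blast
  qed
  define V :: "'v \<Rightarrow> ('v \<times> nat, 'k) op" where
    "V v = pull (\<lambda>(w, n). if w = v \<and> v \<notin> H then Some (w, n) else None)" for v
  define Ed :: "'e \<Rightarrow> ('v \<times> nat, 'k) op" where
    "Ed e = pull (\<lambda>(w, n). if head E e \<notin> H \<and> w = tail E e \<and> n mod k w = ix e then Some (head E e, n div k w) else None)" for e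
  define Gh :: "'e \<Rightarrow> ('v \<times> nat, 'k) op" where
    "Gh e = pull (\<lambda>(w, n). if head E e \<notin> H \<and> w = head E e then Some (tail E e, k (tail E e) * n + ix e) else None)" for e
  have "leavitt_family E scal V Ed Gh"
  proof (intro leavitt_family.intro row_finite_graph_axioms central_scalars_scal leavitt_family_axioms.intro)
    fix v w assume "v \<in> verts E" "w \<in> verts E"
    show "V v * V w = (if v = w then V v else 0)"
      unfolding V_def pull_mult pull_None[symmetric] if_distrib[of pull, symmetric]
      by (auto intro!: arg_cong[where f = pull] ext)
  next
    fix e assume e: "e \<in> arcs E"
    show "V (tail E e) * Ed e = Ed e" "Ed e * V (head E e) = Ed e" "V (head E e) * Gh e = Gh e" "Gh e * V (tail E e) = Gh e"
      unfolding V_def Ed_def Gh_def pull_mult using tailH[OF e]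
      by (auto intro!: arg_cong[where f = pull] ext)
  next
    fix e e' assume e: "e \<in> arcs E" "e' \<in> arcs E"
    have bind: "Option.bind (if head E e \<notin> H \<and> w = head E e then Some (tail E e, k (tail E e) * n + ix e) else None)
        (\<lambda>(w, n). if head E e' \<notin> H \<and> w = tail E e' \<and> n mod k w = ix e' then Some (head E e', n div k w) else None) =
        (if e = e' \<and> w = head E e \<and> head E e \<notin> H then Some (w, n) else None)" for w n
    proof (cases "head E e \<notin> H \<and> w = head E e")
      case True
      then have lt: "ix e < k (tail E e)" using ix_less e by blast
      then have "(k (tail E e) * n + ix e) mod k (tail E e) = ix e" "(k (tail E e) * n + ix e) div k (tail E e) = n" by auto
      then show ?thesis using True ix_inj[OF e] by auto
    qed auto
    have "Gh e * Ed e' = pull (\<lambda>(w, n). if e = e' \<and> w = head E e \<and> head E e \<notin> H then Some (w, n) else None)"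
      unfolding Ed_def Gh_def pull_mult
    proof (rule arg_cong[where f = pull], rule ext, goal_cases)
      case (1 x)
      obtain w n where x: "x = (w, n)" by (cases x)
      show ?case unfolding x prod.case by (rule bind)
    qed
    also have "\<dots> = (if e = e' then V (head E e) else 0)"
      by (cases "e = e'") (simp_all add: V_def pull_None[symmetric] case_prod_unfold)
    finally show "Gh e * Ed e' = (if e = e' then V (head E e) else 0)" .
  next
    fix v assume v: "v \<in> verts E" "out_arcs E v \<noteq> {}"
    show "V v = (\<Sum>e\<in>out_arcs E v. Ed e * Gh e)"
    proof (rule op_eqI)
      fix a :: "'v \<times> nat \<Rightarrow> 'k" and x :: "'v \<times> nat"
      obtain w n where x: "x = (w, n)" by (cases x)
      have rhs: "apply_op (Ed e * Gh e) a x = (if head E e \<notin> H \<and> w = v \<and> n mod k v = ix e then a (v, n) else 0)"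
        if e: "e \<in> out_arcs E v" for e
      proof -
        have "k v * (n div k v) + ix e = n" if "n mod k v = ix e" using that by (metis mult_div_mod_eq)
        then show ?thesis using e by (auto simp: Ed_def Gh_def pull_mult pull.rep_eq x)
      qed
      have "(\<Sum>e\<in>out_arcs E v. apply_op (Ed e * Gh e) a x) = (if w = v \<and> v \<notin> H then a (v, n) else 0)"
      proof (cases "w = v \<and> v \<notin> H")
        case True
        have "out v \<noteq> {}"
          using H(2) v True unfolding saturated_def out_def by auto
        then have "k v > 0" using fin[OF v(1)] by (simp add: k_def card_gt_0_iff)
        then obtain e0 where e0: "e0 \<in> out v" "ix e0 = n mod k v" using ix_surj[OF v(1), of "n mod k v"] by auto
        have "(\<Sum>e\<in>out_arcs E v. apply_op (Ed e * Gh e) a x) = (\<Sum>e\<in>out_arcs E v. if e = e0 then a (v, n) else 0)"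
        proof (intro sum.cong refl)
          fix e assume e: "e \<in> out_arcs E v"
          have arcs: "e \<in> arcs E" "tail E e = v" "e0 \<in> arcs E" "tail E e0 = v" "head E e0 \<notin> H"
            using e e0(1) by (simp_all add: out_def)
          have "head E e \<notin> H \<and> n mod k v = ix e \<longleftrightarrow> e = e0"
          proof
            assume "head E e \<notin> H \<and> n mod k v = ix e"
            then show "e = e0" using arcs e0(2) by (intro ix_inj) simp_all
          next
            assume "e = e0"
            then show "head E e \<notin> H \<and> n mod k v = ix e" using arcs(5) e0(2) by simp
          qed
          then show "apply_op (Ed e * Gh e) a x = (if e = e0 then a (v, n) else 0)"
            unfolding rhs[OF e] using True by (simp only: simp_thms)
        qed
        also have "\<dots> = a (v, n)" using e0(1) row_finite[OF v(1)] by (simp add: out_def)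
        finally show ?thesis using True by simp
      next
        case False
        have "apply_op (Ed e * Gh e) a x = 0" if e: "e \<in> out_arcs E v" for e
          using rhs[OF e] False tailH[of e] e by auto
        then have "(\<Sum>e\<in>out_arcs E v. apply_op (Ed e * Gh e) a x) = 0" by (intro sum.neutral) blast
        then show ?thesis using False by (simp only: if_False)
      qed
      then show "apply_op (V v) a x = apply_op (\<Sum>e\<in>out_arcs E v. Ed e * Gh e) a x"
        by (auto simp: apply_op_sum V_def pull.rep_eq x)
    qed
  qed
  moreover have "V v = 0" if "v \<in> H" for v
    using that by (intro op_eqI) (simp add: V_def pull.rep_eq zero_op.rep_eq split: prod.splits)
  moreover have "V v \<noteq> 0" if "v \<in> verts E - H" for v
  proof
    assume "V v = 0"
    then have "apply_op (V v) (\<lambda>_. 1) (v, 0) = apply_op (0 :: ('v \<times> nat, 'k) op) (\<lambda>_. 1) (v, 0)" by simp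
    then show False using that by (simp add: V_def pull.rep_eq zero_op.rep_eq)
  qed
  ultimately show ?thesis by blast
qed

section \<open>The stable rank of a Leavitt path algebra\<close>

lemma (in nonunital_ring) stable_rank_eq:
  "stable_rank R = (if \<exists>m. srange m then enat (LEAST m. srange m) else \<infinity>)"
proof -
  interpret U: nonunital_ring_ideal_embedding R "unitization R" "\<lambda>x. (0, x)" by (rule embedding_unitization)
  show ?thesis by (simp add: stable_rank_def U.stable_rank_in_image)
qed

theorem theorem7p6:
  fixes E :: "('v, 'e) pre_digraph"
  assumes "row_finite_graph E" and "condition_K E"
  shows
    "(acyclic_graph E \<longrightarrow> stable_rank (leavitt_path_algebra TYPE('k::field) E) = 1) \<and>
     ((\<exists>H. hereditary E H \<and> saturated E H \<and>
          verts (quotient_graph E H) \<noteq> {} \<and> finite (verts (quotient_graph E H)) \<and>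
          cofinal_graph (quotient_graph E H) \<and> \<not> (\<exists>v. sink (quotient_graph E H) v)) \<longrightarrow>
        stable_rank (leavitt_path_algebra TYPE('k) E) = \<infinity>) \<and>
     (\<not> acyclic_graph E \<and>
      \<not> (\<exists>H. hereditary E H \<and> saturated E H \<and>
          verts (quotient_graph E H) \<noteq> {} \<and> finite (verts (quotient_graph E H)) \<and>
          cofinal_graph (quotient_graph E H) \<and> \<not> (\<exists>v. sink (quotient_graph E H) v)) \<longrightarrow>
        stable_rank (leavitt_path_algebra TYPE('k) E) = 2)"
proof -
  interpret row_finite_graph E by fact
  let ?L = "leavitt_path_algebra TYPE('k) E"
  obtain h :: "_ \<Rightarrow> (('v, 'e) lpa_gen list, 'k) op" and V Ed Gh where
    hom: "nonunital_ring_hom ?L h" and inj: "inj_on h (carrier ?L)" and fam: "leavitt_family E scal V Ed Gh"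
    and img: "h ` carrier ?L = central_scalars.lin_span scal (leavitt_family.monomials E V Ed Gh (verts E))"
    using faithful_hom by blast
  interpret h: nonunital_ring_hom ?L h by (rule hom)
  interpret A: leavitt_family E scal V Ed Gh by (rule fam)
  have up: "h.srange m" if "stable_range_in A.R m" for m
    using that img by (intro h.srange_of_image inj) simp
  have unit: "\<exists>\<epsilon>\<in>carrier ?L. \<epsilon> \<otimes>\<^bsub>?L\<^esub> x = x" if x: "x \<in> carrier ?L" for x
  proof -
    have "h x \<in> A.R" unfolding img[symmetric] using x by (rule imageI)
    from A.local_left_unit[OF this] obtain \<epsilon>' where \<epsilon>': "\<epsilon>' \<in> A.R" "\<epsilon>' * h x = h x" by (elim bexE)
    then obtain \<epsilon> where "\<epsilon> \<in> carrier ?L" "\<epsilon>' = h \<epsilon>" unfolding img[symmetric] by (elim imageE)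
    then have \<epsilon>: "\<epsilon> \<in> carrier ?L" "h \<epsilon> * h x = h x" using \<epsilon>'(2) by simp_all
    then have "h (\<epsilon> \<otimes>\<^bsub>?L\<^esub> x) = h x" using x by (simp add: h.h_mult)
    then have "\<epsilon> \<otimes>\<^bsub>?L\<^esub> x = x" using inj_onD[OF inj] x \<epsilon> by (simp add: h.mult_closed)
    then show ?thesis using \<epsilon>(1) by (rule bexI)
  qed
  \<comment> \<open>Stable range conditions descend to every family in operators on functions on \<open>E\<^sup>0 \<times> \<nat>\<close>.\<close>
  have down: "stable_range_in (central_scalars.lin_span scal (leavitt_family.monomials E V' Ed' Gh' (verts E))) m"
    if fam': "leavitt_family E scal V' Ed' Gh'" and sr: "h.srange m"
    for V' and Ed' Gh' :: "'e \<Rightarrow> ('v \<times> nat, 'k) op" and m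
  proof -
    interpret B: leavitt_family E scal V' Ed' Gh' by (rule fam')
    obtain g where g: "nonunital_ring_hom ?L g" "g ` carrier ?L = B.R"
      using B.universal_hom by (elim exE conjE)
    interpret g: nonunital_ring_hom ?L g by (rule g(1))
    show ?thesis using g.stable_range_in_image[OF unit sr] g(2) by simp
  qed
  have acyclic_case: "stable_rank ?L = 1" if "acyclic_graph E"
  proof -
    have he: "hereditary E {}" by (simp add: hereditary_def)
    have "stable_rank_one_modulo A.R (A.lin_span (A.monomials {}))"
      using that acyclic_graph_iff by (intro A.stable_rank_one_modulo_span_monomials he) auto
    moreover have "A.lin_span (A.monomials {}) = {0}"
    proof -
      have "x = 0" if "x \<in> A.lin_span {}" for x using that by (induction rule: A.lin_span.induct) auto
      then show ?thesis using A.lin_span_zero by (auto simp: A.monomials_def)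
    qed
    ultimately have "h.srange 1" using stable_range_one[OF A.subrng_R] up by simp
    moreover have "(LEAST m. h.srange m) = 1"
      using \<open>h.srange 1\<close> by (rule Least_equality) (simp add: h.srange_def)
    ultimately show ?thesis by (auto simp: h.stable_rank_eq one_enat_def)
  qed
  have infinite_case: "stable_rank ?L = \<infinity>"
    if H: "hereditary E H" "saturated E H" "verts (quotient_graph E H) \<noteq> {}" "finite (verts (quotient_graph E H))"
      "cofinal_graph (quotient_graph E H)" "\<not> (\<exists>v. sink (quotient_graph E H) v)" for H
  proof -
    obtain V' and Ed' Gh' :: "'e \<Rightarrow> ('v \<times> nat, 'k) op" where fam': "leavitt_family E scal V' Ed' Gh'"
      and V': "\<forall>v\<in>H. V' v = 0" "\<forall>v\<in>verts E - H. V' v \<noteq> 0"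
      using representation[OF H(1,2)] by blast
    interpret B: leavitt_family E scal V' Ed' Gh' by (rule fam')
    have "\<not> h.srange m" for m
    proof
      assume "h.srange m"
      then have "stable_range_in B.R m" by (rule down[OF fam'])
      moreover have "\<not> stable_range_in B.R m"
        using H V' by (intro B.simple_quotient_imp_no_stable_range[OF assms(2)]) auto
      ultimately show False by blast
    qed
    then show ?thesis by (simp add: h.stable_rank_eq)
  qed
  have two_case: "stable_rank ?L = 2"
    if cyc: "\<not> acyclic_graph E" and no: "\<not> (\<exists>H. hereditary E H \<and> saturated E H \<and>
          verts (quotient_graph E H) \<noteq> {} \<and> finite (verts (quotient_graph E H)) \<and>
          cofinal_graph (quotient_graph E H) \<and> \<not> (\<exists>v. sink (quotient_graph E H) v))"
  proof -
    \<comment> \<open>The ideal of \<open>Z\<close> contains all vertices on closed paths.\<close>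
    define Z where "Z = {w. \<exists>u. u \<rightarrow>\<^sup>+\<^bsub>E\<^esub> u \<and> u \<rightarrow>\<^sup>*\<^bsub>E\<^esub> w}"
    have he: "hereditary E Z"
      unfolding hereditary_def Z_def by (auto dest: reachable_in_verts intro: reachable_trans)
    have inf: "infinite {w. w \<rightarrow>\<^sup>*\<^bsub>E\<^esub> z}" if z: "z \<in> Z" for z
    proof
      assume fin: "finite {w. w \<rightarrow>\<^sup>*\<^bsub>E\<^esub> z}"
      obtain u where u: "u \<rightarrow>\<^sup>+\<^bsub>E\<^esub> u" "u \<rightarrow>\<^sup>*\<^bsub>E\<^esub> z" using z by (auto simp: Z_def)
      have "{w. w \<rightarrow>\<^sup>*\<^bsub>E\<^esub> u} \<subseteq> {w. w \<rightarrow>\<^sup>*\<^bsub>E\<^esub> z}" using u(2) by (auto intro: reachable_trans)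
      then have "finite {w. w \<rightarrow>\<^sup>*\<^bsub>E\<^esub> u}" using fin finite_subset by blast
      from finite_ancestors_imp_quotient[OF u(1) this] show False using no by blast
    qed
    have "u \<in> Z" if "u \<rightarrow>\<^sup>+\<^bsub>E\<^esub> u" for u using that by (auto simp: Z_def)
    then have "stable_range_in A.R 2"
      by (intro stable_range_two[OF A.subrng_R A.ideal_in_span_monomials[OF he]] A.stable_rank_one_modulo_span_monomials
        A.absorbing_span_monomials he inf)
    then have two: "h.srange 2" by (rule up)
    have not_one: "\<not> h.srange 1"
    proof
      assume sr: "h.srange 1"
      obtain u where u: "u \<rightarrow>\<^sup>+\<^bsub>E\<^esub> u" using cyc acyclic_graph_iff by blast
      \<comment> \<open>With \<open>H = {}\<close> no vertex acts as zero.\<close>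
      have "hereditary E {}" "saturated E {}" by (auto simp: hereditary_def saturated_def)
      then obtain V' and Ed' Gh' :: "'e \<Rightarrow> ('v \<times> nat, 'k) op" where fam': "leavitt_family E scal V' Ed' Gh'"
        and V': "\<forall>v\<in>verts E - {}. V' v \<noteq> 0"
        using representation by blast
      interpret B: leavitt_family E scal V' Ed' Gh' by (rule fam')
      have "V' u \<noteq> 0" using V' u reachable1_in_verts by auto
      then show False using B.cycle_imp_not_stable_range_one[OF assms(2) u] down[OF fam' sr] by blast
    qed
    have "(LEAST m. h.srange m) = 2"
    proof (rule Least_equality)
      show "h.srange 2" by (rule two)
      fix m assume m: "h.srange m"
      then have "m \<ge> 1" by (simp add: h.srange_def)
      moreover have "m \<noteq> 1" using m not_one by blast
      ultimately show "2 \<le> m" by simp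
    qed
    then show ?thesis using two by (auto simp: h.stable_rank_eq numeral_eq_enat)
  qed
  show ?thesis using acyclic_case infinite_case two_case by blast
qed

end
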